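(* Let $p$ be a prime with $p\equiv 3\pmod 4$ and let $\lambda\in\mathbb F_p^{\times}$. Then $$\#X_{\lambda}^4(\mathbb F_p)=\frac{p^3-1}{p-1}+{}_3G_3\left[\left.\begin{array}{ccc} 1/4&2/4&3/4\\ 0&0&0\end{array}\right|\lambda^4\right]_p-3p\,{}_2G_2\left[\left.\begin{array}{cc} 3/4&1/4\\ 0&1/2\end{array}\right|\lambda^4\right]_p.$$
   Context: For $\lambda\in\mathbb F_p$, $X_\lambda^4$ is the Dwork K3 surface in $\mathbb P^3$ defined by $x_1^4+x_2^4+x_3^4+x_4^4=4\lambda x_1x_2x_3x_4$, and $\#X_\lambda^4(\mathbb F_p)$ is its number of $\mathbb F_p$-rational points. Let $\omega$ be the Teichmüller character of $\mathbb F_p$ (the character with values in $\mathbb Z_p$ satisfying $\omega(x)\equiv x\pmod p$), $\overline\omega=\omega^{-1}$, extended by $\overline\omega^j(0)=0$. $\Gamma_p$ is Morita's $p$-adic Gamma function. For $x\in\mathbb Q$, $\lfloor x\rfloor$ is the floor and $\langle x\rangle=x-\lfloor x\rfloor$. McCarthy's $p$-adic hypergeometric function is defined, for $a_i,b_i\in\mathbb Q\cap\mathbb Z_p$ and $u\in\mathbb F_p$, by $${}_nG_n\left[\left.\begin{array}{ccc}a_1&\ldots&a_n\\ b_1&\ldots&b_n\end{array}\right|u\right]_p:=\frac{-1}{p-1}\sum_{j=0}^{p-2}(-1)^{jn}\,\overline\omega^j(u)\prod_{i=1}^n\frac{\Gamma_p(\langle a_i-\frac{j}{p-1}\rangle)}{\Gamma_p(\langle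 a_i\rangle)}\frac{\Gamma_p(\langle -b_i+\frac{j}{p-1}\rangle)}{\Gamma_p(\langle -b_i\rangle)}(-p)^{-\lfloor\langle a_i\rangle-\frac{j}{p-1}\rfloor-\lfloor\langle -b_i\rangle+\frac{j}{p-1}\rfloor}.$$ *)

theory Defs
  imports Complex_Main "HOL-Number_Theory.Number_Theory"
begin

definition padic_cong :: "nat \<Rightarrow> nat \<Rightarrow> rat \<Rightarrow> rat \<Rightarrow> bool" where
  "padic_cong p k x y \<longleftrightarrow>
     (\<exists>a b :: int. b \<noteq> 0 \<and> coprime b (int p) \<and>
        x - y = of_int (int p ^ k) * of_int a / of_int b)"

text \<open>A sequence of rationals converges p-adically to a rational limit L.
  Elements of Q_p are represented by such sequences; an identity in Q_p whose
  one side is rational is expressed as p-adic convergence.\<close>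
definition padic_tendsto :: "nat \<Rightarrow> (nat \<Rightarrow> rat) \<Rightarrow> rat \<Rightarrow> bool" where
  "padic_tendsto p s L \<longleftrightarrow> (\<forall>k. \<exists>N. \<forall>n\<ge>N. padic_cong p k (s n) L)"

text \<open>The unique r in [0, p^n) with r = x in Z_(p)/p^n (for x in Q \<inter> Z_p).\<close>
definition padic_residue :: "nat \<Rightarrow> nat \<Rightarrow> rat \<Rightarrow> nat" where
  "padic_residue p n x =
     (THE r. r < p ^ n \<and>
        [fst (quotient_of x) = snd (quotient_of x) * int r] (mod int (p ^ n)))"

definition gamma_p_nat :: "nat \<Rightarrow> nat \<Rightarrow> int" where
  "gamma_p_nat p n = (-1) ^ n * (\<Prod>j\<in>{j. 0 < j \<and> j < n \<and> \<not> p dvd j}. int j)"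

text \<open>Morita's Gamma_p(x) = lim Gamma_p(r_n) for natural numbers r_n \<rightarrow> x p-adically;
  we use r_n = padic_residue p n x. This is the n-th approximation.\<close>
definition gamma_p_approx :: "nat \<Rightarrow> nat \<Rightarrow> rat \<Rightarrow> rat" where
  "gamma_p_approx p n x = of_int (gamma_p_nat p (padic_residue p n x))"

text \<open>omega(u) = lim u^(p^n); n-th approximation of omega-bar^j(u) = omega(u)^(-j),
  with the convention omega-bar^j(0) = 0. Elements of F_p are represented by integers.\<close>
definition teich_bar_pow_approx :: "nat \<Rightarrow> nat \<Rightarrow> nat \<Rightarrow> int \<Rightarrow> rat" where
  "teich_bar_pow_approx p n j u =
     (if u mod int p = 0 then 0
      else inverse ((of_int (u mod int p) :: rat) ^ (p ^ n)) ^ j)"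

definition mcG_approx :: "nat \<Rightarrow> rat list \<Rightarrow> rat list \<Rightarrow> int \<Rightarrow> nat \<Rightarrow> rat" where
  "mcG_approx p as bs u m =
     (- 1 / (of_nat p - 1)) *
     (\<Sum>j = 0..p - 2.
        (-1) ^ (j * length as) * teich_bar_pow_approx p m j u *
        (\<Prod>i<length as.
           let a = as ! i; b = bs ! i; t = of_nat j / (of_nat p - 1) in
           gamma_p_approx p m (frac (a - t)) / gamma_p_approx p m (frac a) *
           (gamma_p_approx p m (frac (- b + t)) / gamma_p_approx p m (frac (- b))) *
           (- of_nat p :: rat) powi (- \<lfloor>frac a - t\<rfloor> - \<lfloor>frac (- b) + t\<rfloor>)))"

definition dwork_affine_sols :: "nat \<Rightarrow> int \<Rightarrow> (int \<times> int \<times> int \<times> int) set" where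
  "dwork_affine_sols p lam =
     {(x1, x2, x3, x4). x1 \<in> {0..<int p} \<and> x2 \<in> {0..<int p} \<and> x3 \<in> {0..<int p} \<and> x4 \<in> {0..<int p} \<and>
        (x1, x2, x3, x4) \<noteq> (0, 0, 0, 0) \<and>
        (x1 ^ 4 + x2 ^ 4 + x3 ^ 4 + x4 ^ 4 - 4 * lam * x1 * x2 * x3 * x4) mod int p = 0}"

definition proj_class :: "nat \<Rightarrow> int \<times> int \<times> int \<times> int \<Rightarrow> (int \<times> int \<times> int \<times> int) set" where
  "proj_class p x = (case x of (x1, x2, x3, x4) \<Rightarrow>
     {(c * x1 mod int p, c * x2 mod int p, c * x3 mod int p, c * x4 mod int p) | c. c \<in> {1..<int p}})"

definition dwork_count :: "nat \<Rightarrow> int \<Rightarrow> nat" where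
  "dwork_count p lam = card (proj_class p ` dwork_affine_sols p lam)"

end

theory Submission
  imports Defs "HOL-Computational_Algebra.Formal_Power_Series"
begin

text \<open>
  A torus point \<open>x\<close> is determined up to signs by its fourth powers, and since \<open>- 1\<close> is not a square, the number
  of \<open>x\<close> above \<open>y\<close> is \<open>\<Prod>i. 1 + \<phi> (y\<^sub>i)\<close> with \<open>\<phi>\<close> the Legendre symbol. Scaling and \<open>\<phi> (- 1) = - 1\<close> reduce the count
  to the sums of \<open>1\<close> and of \<open>\<phi> (y\<^sub>1 y\<^sub>2)\<close> over the \<open>y\<close> with \<open>y\<^sub>1 + y\<^sub>2 + y\<^sub>3 + y\<^sub>4 = 1\<close> and
  \<open>256 \<lambda>\<^sup>4 y\<^sub>1 y\<^sub>2 y\<^sub>3 y\<^sub>4 = 1\<close>. Detecting the last condition by Teichmueller characters expands both sums in Jacobi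
  sums of four characters, which the Gross-Koblitz formula turns into products of values of \<open>\<Gamma>\<^sub>p\<close>; the reflection
  and duplication formulas then identify the two expansions with \<open>\<^sub>3G\<^sub>3\<close> and \<open>\<^sub>2G\<^sub>2\<close> term by term.

  The Gross-Koblitz formula over the prime field is obtained without \<open>p\<close>-adic fields. A root of
  \<open>y\<^sup>p\<^sup>-\<^sup>1 = - p\<close> is replaced by rational power series modulo \<open>p + y\<^sup>p\<^sup>-\<^sup>1\<close> and modulo series that are \<open>p\<close>-adically small
  there, in which \<open>E = exp (y + y\<^sup>p / p)\<close> satisfies \<open>E\<^sup>p \<approx> 1\<close> and serves as additive character. Gauss sums become
  multiples of powers of \<open>y\<close>, whose coefficient is the trace of a Dwork operator of rank one modulo exact forms; the
  eigenvalue is \<open>\<Gamma>\<^sub>p\<close> because \<open>(- p)\<^sup>N N! / (a + p N)!\<close> interpolates in \<open>N\<close> through its finite differences.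
\<close>

unbundle fps_syntax

section \<open>Valuations on the rationals\<close>

text \<open>The weight 3 arises because the product of all four \<open>phi (y_i)\<close> is 1 on the
  counted set: complementary pairs agree, so six pairs are three pairs taken twice, and the 2
  cancels since fourth powers see the surfaces for \<open>lam\<close> and \<open>- lam\<close>
  together. The \<open>p\<close> in front of the second function is a carry: with two of the four
  indices shifted by \<open>(p - 1) / 2\<close>, their sum passes multiples of \<open>p - 1\<close>
  once more than the floors of the summand do. At the indices 0 and \<open>(p - 1) / 2\<close> the
  product of the four characters is trivial; these are computed separately, and together with the
  points having a zero coordinate they produce the rational term.

  The analytic obstacle is convergence. A root of \<open>y^(p-1) = - p\<close> has valuation
  \<open>1 / (p - 1)\<close>, the very rate at which inverse factorials grow, so \<open>exp\<close>
  diverges there. The coefficients of \<open>E\<close> gain half a power of \<open>p\<close> for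
  every \<open>p\<close> indices, which is what the finite differences prove. This gain accompanies
  every congruence of series, since a multiple of \<open>p + y^(p-1)\<close> vanishes at the root
  only if its cofactor converges there.\<close>

definition p_integral :: "nat \<Rightarrow> rat \<Rightarrow> bool" where
  "p_integral p x \<longleftrightarrow> (\<exists>a b :: int. \<not> int p dvd b \<and> x = of_int a / of_int b)"

text \<open>A lower bound rather than a valuation: zero satisfies every bound, so sums need no case
  of infinite valuation, and negative \<open>k\<close> admits denominators.\<close>

definition val_ge :: "nat \<Rightarrow> int \<Rightarrow> rat \<Rightarrow> bool" where
  "val_ge p k x \<longleftrightarrow> p_integral p (x * of_nat p powi (- k))"

locale odd_prime =
  fixes p :: nat
  assumes prime: "prime p" and gt2: "p > 2"
begin

abbreviation V :: "int \<Rightarrow> rat \<Rightarrow> bool" where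
  "V \<equiv> val_ge p"

definition padic_eq :: "int \<Rightarrow> rat \<Rightarrow> rat \<Rightarrow> bool" where
  "padic_eq k x y \<longleftrightarrow> V k (x - y)"

lemma p_pos [simp]: "p > 0" "p \<noteq> 0" "of_nat p \<noteq> (0::rat)" "Suc 0 < p" "p \<noteq> Suc 0"
  using gt2 by auto

lemma prime_int: "prime (int p)"
  using prime by simp

lemma odd_p: "odd p"
  using prime gt2 prime_odd_nat by blast

lemma p_integralI: "\<not> int p dvd b \<Longrightarrow> x = of_int a / of_int b \<Longrightarrow> p_integral p x"
  by (auto simp: p_integral_def)

lemma p_integral_of_int [simp]: "p_integral p (of_int a)"
  by (rule p_integralI[of 1 _ a]) (use gt2 in auto)

lemma p_integral_of_nat [simp]: "p_integral p (of_nat a)"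
  using p_integral_of_int[of "int a"] by simp

lemma p_integral_0 [simp]: "p_integral p 0" and p_integral_1 [simp]: "p_integral p 1"
  using p_integral_of_int[of 0] p_integral_of_int[of 1] by simp_all

lemma p_integral_mult: assumes "p_integral p x" "p_integral p y" shows "p_integral p (x * y)"
proof -
  obtain a b c d where "\<not> int p dvd b" "x = of_int a / of_int b" "\<not> int p dvd d" "y = of_int c / of_int d"
    using assms by (auto simp: p_integral_def)
  then show ?thesis
    by (intro p_integralI[of "b * d" _ "a * c"]) (auto simp: prime_dvd_mult_iff[OF prime_int])
qed

lemma p_integral_add: assumes "p_integral p x" "p_integral p y" shows "p_integral p (x + y)"
proof -
  obtain a b c d where *: "\<not> int p dvd b" "x = of_int a / of_int b" "\<not> int p dvd d" "y = of_int c / of_int d"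
    using assms by (auto simp: p_integral_def)
  then have "b \<noteq> 0" "d \<noteq> 0" by auto
  then show ?thesis using *
    by (intro p_integralI[of "b * d" _ "a * d + c * b"])
       (auto simp: prime_dvd_mult_iff[OF prime_int] field_simps)
qed

lemma p_integral_minus: "p_integral p x \<Longrightarrow> p_integral p (- x)"
  using p_integral_mult[OF p_integral_of_int[of "- 1"], of x] by simp

lemma p_integral_inverse_int: "\<not> int p dvd a \<Longrightarrow> p_integral p (inverse (of_int a))"
  by (rule p_integralI[of a _ 1]) (auto simp: field_simps)

lemma V_0_iff: "V 0 x \<longleftrightarrow> p_integral p x"
  by (simp add: val_ge_def)

lemma V_of_int [simp]: "V 0 (of_int a)" and V_of_nat [simp]: "V 0 (of_nat b)"
  and V_0_1 [simp]: "V 0 1" and V_numeral [simp]: "V 0 (numeral w)"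
  using p_integral_of_int[of "numeral w"] by (auto simp: V_0_iff)

lemma V_zero [simp]: "V k 0"
  by (simp add: val_ge_def)

lemma V_add: "V k x \<Longrightarrow> V k y \<Longrightarrow> V k (x + y)"
  unfolding val_ge_def distrib_right by (rule p_integral_add)

lemma V_minus: "V k x \<Longrightarrow> V k (- x)"
  using p_integral_minus by (auto simp: val_ge_def)

lemma V_minus_iff [simp]: "V k (- x) \<longleftrightarrow> V k x"
  using V_minus[of k x] V_minus[of k "- x"] by auto

lemma V_diff: "V k x \<Longrightarrow> V k y \<Longrightarrow> V k (x - y)"
  using V_add[of k x "- y"] by simp

lemma V_sum: "(\<And>i. i \<in> A \<Longrightarrow> V k (f i)) \<Longrightarrow> V k (sum f A)"
  by (induction A rule: infinite_finite_induct) (auto intro: V_add)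

lemma V_mult: assumes "V i x" "V j y" shows "V (i + j) (x * y)"
proof -
  have "x * y * of_nat p powi (- (i + j)) = (x * of_nat p powi (- i)) * (y * of_nat p powi (- j))"
    by (simp add: power_int_add power_int_minus power_int_diff field_simps)
  then show ?thesis using assms unfolding val_ge_def by (simp only: p_integral_mult)
qed

lemma V_multI: "V i x \<Longrightarrow> V j y \<Longrightarrow> i + j = k \<Longrightarrow> V k (x * y)"
  using V_mult by blast

lemma V_powi: "V k (of_nat p powi k)"
  by (simp add: val_ge_def power_int_minus)

lemma V_p_power: "V (int n) (of_nat p ^ n)"
  using V_powi[of "int n"] by simp

lemma V_mono: assumes "V i x" "j \<le> i" shows "V j x"
proof -
  obtain n where n: "i = j + int n" using assms(2) zle_iff_zadd by auto
  have "x * of_nat p powi (- j) = (x * of_nat p powi (- i)) * of_nat (p ^ n)"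
    by (simp add: n power_int_add power_int_minus power_int_diff field_simps)
  then show ?thesis using assms(1) unfolding val_ge_def by (simp only: p_integral_mult p_integral_of_nat)
qed

lemma V_mult_integral: "V k x \<Longrightarrow> V 0 y \<Longrightarrow> V k (x * y)" "V k x \<Longrightarrow> V 0 y \<Longrightarrow> V k (y * x)"
  using V_mult[of k x 0 y] V_mult[of 0 y k x] by simp_all

lemma V_prod0: "(\<And>i. i \<in> A \<Longrightarrow> V 0 (f i)) \<Longrightarrow> V 0 (prod f A)"
  by (induction A rule: infinite_finite_induct) (auto intro: V_mult_integral)

lemma V_power: "V k x \<Longrightarrow> V (int n * k) (x ^ n)"
  by (induction n) (auto intro!: V_multI simp: algebra_simps)

lemma V_power0: "V 0 x \<Longrightarrow> V 0 (x ^ n)"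
  using V_power[of 0 x n] by simp

lemma V_p_mult_iff: "V (k + 1) (of_nat p * x) \<longleftrightarrow> V k x"
proof
  assume "V (k + 1) (of_nat p * x)"
  from V_mult[OF V_powi[of "-1"] this] show "V k x" by (simp add: power_int_minus mult.assoc[symmetric])
next
  assume "V k x"
  then show "V (k + 1) (of_nat p * x)" using V_mult[OF V_powi[of 1], of k x] by (simp add: add.commute)
qed

lemma V_of_int_iff: "V (int n) (of_int a) \<longleftrightarrow> int p ^ n dvd a"
proof
  assume "int p ^ n dvd a"
  then obtain b where "a = int p ^ n * b" by auto
  then show "V (int n) (of_int a)" using V_mult[OF V_p_power[of n] V_of_int[of b]] by simp
next
  assume "V (int n) (of_int a)"
  then obtain c b where cb: "\<not> int p dvd b" "of_int a * of_nat p powi (- int n) = (of_int c / of_int b :: rat)"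
    by (auto simp: val_ge_def p_integral_def)
  then have "b \<noteq> 0" by auto
  with cb have "(of_int (a * b) :: rat) = of_int (c * int p ^ n)"
    by (simp add: power_int_minus field_simps)
  then have "a * b = c * int p ^ n" using of_int_eq_iff by blast
  moreover have "coprime (int p ^ n) b"
    using cb(1) prime_int by (simp add: prime_imp_coprime)
  ultimately show "int p ^ n dvd a" using coprime_dvd_mult_left_iff[of "int p ^ n" b a] by simp
qed

lemma V_inverse_int: "\<not> int p dvd a \<Longrightarrow> V 0 (inverse (of_int a))"
  by (simp add: V_0_iff p_integral_inverse_int)

text \<open>Bridge from the congruence used in the theorem to the valuation calculus, in which
  exponents may be negative.\<close>

lemma padic_cong_iff: "padic_cong p k x y \<longleftrightarrow> padic_eq (int k) x y"
proof
  assume "padic_cong p k x y"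
  then obtain a b where ab: "b \<noteq> 0" "coprime b (int p)" "x - y = of_int (int p ^ k) * of_int a / of_int b"
    by (auto simp: padic_cong_def)
  have "\<not> int p dvd b" using ab(2) prime_int by (auto dest!: coprime_common_divisor)
  then have "V (int k + 0) (of_nat p ^ k * (of_int a / of_int b))"
    by (intro V_mult V_p_power) (auto simp: V_0_iff p_integral_def)
  then show "padic_eq (int k) x y" using ab(3) by (simp add: padic_eq_def)
next
  assume "padic_eq (int k) x y"
  then obtain a b where ab: "\<not> int p dvd b" "(x - y) * of_nat p powi (- int k) = of_int a / of_int b"
    by (auto simp: padic_eq_def val_ge_def p_integral_def)
  then have "b \<noteq> 0" by auto
  moreover have "coprime b (int p)" using prime_imp_coprime[OF prime_int ab(1)]
    by (simp add: coprime_commute)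
  moreover have "x - y = of_int (int p ^ k) * of_int a / of_int b"
    using ab(2) \<open>b \<noteq> 0\<close> by (simp add: power_int_minus field_simps)
  ultimately show "padic_cong p k x y" by (auto simp: padic_cong_def)
qed

text \<open>The units of the localisation of the integers at \<open>p\<close>. Zero has to be
  excluded explicitly, since \<open>inverse 0 = 0\<close> is integral.\<close>

definition punit :: "rat \<Rightarrow> bool" where
  "punit x \<longleftrightarrow> x \<noteq> 0 \<and> V 0 x \<and> V 0 (inverse x)"

lemma punit_of_int: "\<not> int p dvd a \<Longrightarrow> punit (of_int a)"
  by (auto simp: punit_def V_inverse_int)

lemma punit_of_nat: "\<not> p dvd a \<Longrightarrow> punit (of_nat a)"
  using punit_of_int[of "int a"] by simp

lemma punit_mult: "punit x \<Longrightarrow> punit y \<Longrightarrow> punit (x * y)"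
  by (auto simp: punit_def intro: V_mult_integral)

lemma punit_inverse: "punit x \<Longrightarrow> punit (inverse x)"
  by (auto simp: punit_def)

lemma punit_divide: "punit x \<Longrightarrow> punit y \<Longrightarrow> punit (x / y)"
  by (simp add: divide_inverse punit_mult punit_inverse)

lemma punit_minus: "punit x \<Longrightarrow> punit (- x)"
  by (auto simp: punit_def)

lemma punit_1 [simp]: "punit 1"
  by (simp add: punit_def)

lemma punit_power: "punit x \<Longrightarrow> punit (x ^ n)"
  by (induction n) (auto intro: punit_mult)

lemma V_punit_mult_iff: assumes "punit u" shows "V k (u * x) \<longleftrightarrow> V k x"
proof
  assume "V k (u * x)"
  then have "V k (inverse u * (u * x))" using assms by (auto simp: punit_def intro: V_mult_integral)
  then show "V k x" using assms by (simp add: punit_def mult.assoc[symmetric])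
next
  assume "V k x" then show "V k (u * x)" using assms by (auto simp: punit_def intro: V_mult_integral)
qed

section \<open>Congruences modulo powers of \<open>p\<close>\<close>

lemma peq_refl [simp, intro]: "padic_eq k x x"
  by (simp add: padic_eq_def)

lemma peq_sym: "padic_eq k x y \<Longrightarrow> padic_eq k y x"
  using V_minus[of k "x - y"] by (simp add: padic_eq_def)

lemma peq_trans [trans]: "padic_eq k x y \<Longrightarrow> padic_eq k y z \<Longrightarrow> padic_eq k x z"
  using V_add[of k "x - y" "y - z"] by (simp add: padic_eq_def)

lemma peq_mono: "padic_eq k x y \<Longrightarrow> j \<le> k \<Longrightarrow> padic_eq j x y"
  by (auto simp: padic_eq_def intro: V_mono)

lemma peq_add: "padic_eq k x y \<Longrightarrow> padic_eq k x' y' \<Longrightarrow> padic_eq k (x + x') (y + y')"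
  using V_add[of k "x - y" "x' - y'"] by (simp add: padic_eq_def algebra_simps)

lemma peq_minus: "padic_eq k x y \<Longrightarrow> padic_eq k (- x) (- y)"
  using V_minus[of k "x - y"] by (simp add: padic_eq_def)

lemma peq_diff: "padic_eq k x y \<Longrightarrow> padic_eq k x' y' \<Longrightarrow> padic_eq k (x - x') (y - y')"
  using V_diff[of k "x - y" "x' - y'"] by (simp add: padic_eq_def algebra_simps)

lemma peq_sum: "(\<And>i. i \<in> A \<Longrightarrow> padic_eq k (f i) (g i)) \<Longrightarrow> padic_eq k (sum f A) (sum g A)"
  by (simp add: padic_eq_def sum_subtractf[symmetric] V_sum)

lemma peq_mult: assumes "padic_eq k x y" "padic_eq k x' y'" "V 0 x" "V 0 y'"
  shows "padic_eq k (x * x') (y * y')"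
proof -
  have e: "x * x' - y * y' = x * (x' - y') + (x - y) * y'" by (simp add: algebra_simps)
  show ?thesis using assms unfolding padic_eq_def e by (intro V_add V_mult_integral)
qed

lemma peq_mult_left: "padic_eq k x y \<Longrightarrow> V 0 c \<Longrightarrow> padic_eq k (c * x) (c * y)"
  by (auto simp: padic_eq_def right_diff_distrib[symmetric] intro: V_mult_integral)

lemma peq_mult_right: "padic_eq k x y \<Longrightarrow> V 0 c \<Longrightarrow> padic_eq k (x * c) (y * c)"
  by (auto simp: padic_eq_def left_diff_distrib[symmetric] intro: V_mult_integral)

lemma peq_prod: "(\<And>i. i \<in> A \<Longrightarrow> padic_eq k (f i) (g i) \<and> V 0 (f i) \<and> V 0 (g i)) \<Longrightarrow> padic_eq k (prod f A) (prod g A)"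
  by (induction A rule: infinite_finite_induct) (auto intro!: peq_mult V_prod0)

lemma peq_inverse: assumes "padic_eq k x y" "punit x" "punit y" shows "padic_eq k (inverse x) (inverse y)"
proof -
  have "inverse x - inverse y = (y - x) * (inverse x * inverse y)"
    using assms by (auto simp: punit_def field_simps)
  moreover have "V 0 (inverse x * inverse y)" using assms by (auto simp: punit_def intro: V_mult_integral)
  ultimately show ?thesis using assms peq_sym[OF assms(1)] by (auto simp: padic_eq_def intro: V_mult_integral)
qed

lemma peq_cancel_left: assumes "padic_eq k (c * x) (c * y)" "punit c" shows "padic_eq k x y"
  using assms V_punit_mult_iff[of c k "x - y"] by (simp add: padic_eq_def right_diff_distrib)

lemma peq_of_int: "padic_eq (int n) (of_int a) (of_int b) \<longleftrightarrow> [a = b] (mod int p ^ n)"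
  unfolding padic_eq_def of_int_diff[symmetric] V_of_int_iff by (simp add: cong_iff_dvd_diff)

section \<open>Factorials and the integral part of Morita's function\<close>

text \<open>The multiples of \<open>p\<close> up to \<open>n\<close> are \<open>p * i\<close> with
  \<open>i\<close> up to \<open>n div p\<close>; they give a power of \<open>p\<close> and a smaller
  factorial, and the other factors form the product in Morita's function.\<close>

lemma fact_decomp: "(fact n :: int) = int p ^ (n div p) * fact (n div p) * (\<Prod>j\<in>{j. 0 < j \<and> j < Suc n \<and> \<not> p dvd j}. int j)"
proof (induction n)
  case (Suc n)
  let ?S = "\<lambda>n. {j. 0 < j \<and> j < Suc n \<and> \<not> p dvd j}"
  have fin: "finite (?S n)" by simp
  show ?case
  proof (cases "p dvd Suc n")
    case True
    then have d: "Suc n div p = Suc (n div p)" by (simp add: div_Suc dvd_eq_mod_eq_0)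
    have e: "Suc n = p * Suc (n div p)" using True d by auto
    have "?S (Suc n) = ?S n" using True by (auto simp: less_Suc_eq)
    moreover have "(fact (Suc n) :: int) = int (Suc n) * fact n" by simp
    moreover have "int (Suc n) = int p * int (Suc (n div p))" using e by (metis of_nat_mult)
    ultimately show ?thesis using Suc unfolding d by (simp add: algebra_simps)
  next
    case False
    then have d: "Suc n div p = n div p" by (simp add: div_Suc dvd_eq_mod_eq_0)
    have "?S (Suc n) = insert (Suc n) (?S n)" using False by (auto simp: less_Suc_eq)
    then have "(\<Prod>j\<in>?S (Suc n). int j) = int (Suc n) * (\<Prod>j\<in>?S n. int j)" using fin by simp
    then show ?thesis using Suc unfolding d by (simp add: algebra_simps)
  qed
next
  case 0
  show ?case by (subst prod.neutral) auto
qed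

section \<open>Morita's function at natural numbers\<close>

abbreviation gam :: "nat \<Rightarrow> int" where "gam \<equiv> gamma_p_nat p"

lemma gam_unit: "\<not> int p dvd gam n"
proof -
  have "int p dvd (\<Prod>j\<in>{j. 0 < j \<and> j < n \<and> \<not> p dvd j}. int j) \<longleftrightarrow> (\<exists>j\<in>{j. 0 < j \<and> j < n \<and> \<not> p dvd j}. int p dvd int j)"
    by (rule prime_dvd_prod_iff[OF _ prime_int]) simp
  then have "\<not> int p dvd (\<Prod>j\<in>{j. 0 < j \<and> j < n \<and> \<not> p dvd j}. int j)" by auto
  then show ?thesis
    by (cases "even n") (auto simp: gamma_p_nat_def)
qed

lemma punit_gam [simp]: "punit (of_int (gam n))"
  by (rule punit_of_int) (rule gam_unit)

lemma gam_0 [simp]: "gam 0 = 1"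
proof -
  have "{j. 0 < j \<and> j < (0::nat) \<and> \<not> p dvd j} = {}" by auto
  then show ?thesis by (simp add: gamma_p_nat_def)
qed

lemma gam_Suc: "gam (Suc n) = (if p dvd n then - gam n else - int n * gam n)"
proof (cases "p dvd n")
  case True
  then have "{j. 0 < j \<and> j < Suc n \<and> \<not> p dvd j} = {j. 0 < j \<and> j < n \<and> \<not> p dvd j}"
    by (auto simp: less_Suc_eq)
  then show ?thesis using True by (simp add: gamma_p_nat_def)
next
  case False
  then have "n > 0" by (cases n) auto
  then have "{j. 0 < j \<and> j < Suc n \<and> \<not> p dvd j} = insert n {j. 0 < j \<and> j < n \<and> \<not> p dvd j}"
    using False by (auto simp: less_Suc_eq)
  then show ?thesis using False by (simp add: gamma_p_nat_def)
qed

lemma gam_fact: "(fact n :: int) = (- 1) ^ Suc n * gam (Suc n) * int p ^ (n div p) * fact (n div p)"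
  using fact_decomp[of n] by (simp add: gamma_p_nat_def)

text \<open>The induction step for the bound \<open>n div (p - 1)\<close> on the valuation of
  \<open>n!\<close>.\<close>

lemma div_mult_div_le: "n div p + n div p div (p - 1) \<le> n div (p - 1)"
proof -
  define q where "q = n div p"
  have "q * p \<le> n" by (simp add: q_def)
  moreover have "q * p = q * (p - 1) + q"
    by (metis Suc_diff_1 mult_Suc_right add.commute p_pos(1))
  ultimately have "(q * (p - 1) + q) div (p - 1) \<le> n div (p - 1)" by (simp add: div_le_mono)
  then show ?thesis using gt2 by (simp add: q_def)
qed

text \<open>Legendre's bound for the valuation of \<open>n!\<close>, by recursion from
  \<open>n\<close> to \<open>n div p\<close>. It fixes the scale \<open>n div (p - 1)\<close> for
  all later coefficient estimates.\<close>

lemma V_inverse_fact: "V (- int (n div (p - 1))) (1 / fact n)"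
proof (induction n rule: less_induct)
  case (less n)
  show ?case
  proof (cases "n = 0")
    case False
    define q where "q = n div p"
    have "q < n" using False by (simp add: q_def)
    define u where "u = (- 1) ^ Suc n * gam (Suc n)"
    have "fact n = (of_int (fact n) :: rat)" by simp
    also have "\<dots> = of_int u * of_nat p ^ q * fact q"
      by (subst gam_fact[of n]) (simp add: q_def u_def)
    finally have e: "1 / fact n = (inverse (of_int u) * (of_nat p powi (- int q) * (1 / fact q)) :: rat)"
      by (simp add: power_int_minus divide_inverse)
    have "\<not> int p dvd u"
      using gam_unit[of "Suc n"] by (cases "even n") (auto simp: u_def)
    then have "V 0 (inverse (of_int u))" by (rule V_inverse_int)
    moreover have "V (- int q + (- int (q div (p - 1)))) (of_nat p powi (- int q) * (1 / fact q))"
      by (intro V_mult V_powi less \<open>q < n\<close>)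
    ultimately have "V (- int q + (- int (q div (p - 1)))) (1 / fact n)"
      unfolding e by (rule V_mult_integral(2)[rotated])
    then show ?thesis
      by (rule V_mono) (use div_mult_div_le[of n] in \<open>simp add: q_def\<close>)
  qed auto
qed

lemma V_fact: "V (int (n div p)) (fact n)"
proof -
  have "fact n = (of_int (fact n) :: rat)" by simp
  also have "\<dots> = of_nat p ^ (n div p) * of_int ((- 1) ^ Suc n * gam (Suc n) * fact (n div p))"
    by (subst gam_fact[of n]) simp
  finally show ?thesis
    by (simp only:) (intro V_mult_integral V_p_power V_of_int)
qed

lemma punit_p_minus_1: "punit (of_nat p - 1)"
proof -
  have "\<not> p dvd p - 1" using gt2 by (auto dest: dvd_imp_le)
  moreover have "of_nat (p - 1) = (of_nat p - 1 :: rat)" using gt2 by (simp add: of_nat_diff)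
  ultimately show ?thesis using punit_of_nat[of "p - 1"] by simp
qed

text \<open>Wilson's theorem for odd prime powers. In terms of a primitive root \<open>g\<close> of
  order \<open>t = 2 * h\<close> the product is \<open>g\<close> to the power
  \<open>h * (t - 1)\<close>; here \<open>g ^ h\<close> is \<open>- 1\<close> and
  \<open>t - 1\<close> is odd.\<close>

lemma prod_units_prime_power:
  assumes "M > 0"
  shows "[(\<Prod>j\<in>{j. 0 < j \<and> j < p ^ M \<and> \<not> p dvd j}. int j) = - 1] (mod int p ^ M)"
proof -
  define m where "m = p ^ M"
  have m1: "m > 2" using assms gt2 by (simp add: m_def) (metis One_nat_def Suc_leI less_le_trans p_pos(1) power_increasing power_one_right less_or_eq_imp_le le_trans Suc_1)
  obtain g where g: "residue_primroot m g"
    using residue_primroot_odd_prime_power_exists[OF prime odd_p] assms unfolding m_def by metis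
  define t where "t = totient m"
  have "even t" using m1 by (simp add: t_def totient_even)
  then obtain h where h: "t = 2 * h" by auto
  have "t > 0" using m1 by (simp add: t_def)
  then have "h > 0" using h by auto
  have set: "{j. 0 < j \<and> j < p ^ M \<and> \<not> p dvd j} = totatives m"
  proof -
    have "coprime j m \<longleftrightarrow> \<not> p dvd j" for j
      using assms prime coprime_commute[of j p] by (auto simp: m_def prime_imp_coprime coprime_power_right_iff
          dest: coprime_common_divisor_nat) 
    moreover have "j \<noteq> m" if "\<not> p dvd j" for j using that assms by (auto simp: m_def)
    ultimately show ?thesis by (fastforce simp: in_totatives_iff m_def[symmetric])
  qed
  have bij: "bij_betw (\<lambda>i. g ^ i mod m) {..<t} (totatives m)"
    using residue_primroot_is_generator[of m g] g m1 by (simp add: t_def)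
  have "(\<Prod>j\<in>totatives m. j) = (\<Prod>i<t. g ^ i mod m)"
    by (rule prod.reindex_bij_betw[OF bij, symmetric])
  moreover have "[(\<Prod>i<t. g ^ i mod m) = (\<Prod>i<t. g ^ i)] (mod m)"
    by (intro cong_prod) simp
  moreover have "(\<Prod>i<t. g ^ i) = g ^ (\<Sum>i<t. i)"
    by (simp add: power_sum)
  moreover have "(\<Sum>i<t. i) = h * (t - 1)"
    using Sum_Ico_nat[of 0 t] by (simp add: h atLeast0LessThan)
  ultimately have prod: "[(\<Prod>j\<in>totatives m. j) = (g ^ h) ^ (t - 1)] (mod m)"
    by (simp add: power_mult)
  have ordg: "ord m g = t" using g by (simp add: residue_primroot_def t_def)
  have n1: "\<not> [g ^ h = 1] (mod m)"
    using ord_divides[of g h m] \<open>h > 0\<close> h by (auto simp: ordg dest: dvd_imp_le)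
  have "[g ^ t = 1] (mod m)" using ord_divides[of g t m] by (simp add: ordg)
  then have "[int (g ^ t) = int 1] (mod int m)" by (simp only: cong_int_iff)
  then have "int m dvd int g ^ t - 1" by (simp add: cong_iff_dvd_diff)
  moreover have "int g ^ t - 1 = (int g ^ h - 1) * (int g ^ h + 1)"
    by (simp add: h algebra_simps power_mult power2_eq_square)
  ultimately have d: "int p ^ M dvd (int g ^ h - 1) * (int g ^ h + 1)" by (simp add: m_def)
  have "\<not> int p ^ M dvd int g ^ h - 1"
  proof
    assume "int p ^ M dvd int g ^ h - 1"
    then have "[int (g ^ h) = int 1] (mod int m)" by (simp add: cong_iff_dvd_diff m_def)
    then show False using n1 by (simp only: cong_int_iff)
  qed
  \<comment> \<open>Since \<open>p > 2\<close>, it divides at most one of the two factors, so the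
    full power \<open>p ^ M\<close> divides a single one.\<close>
  have "int p ^ M dvd int g ^ h + 1"
  proof (cases "int p dvd int g ^ h - 1")
    case False
    then have "coprime (int p ^ M) (int g ^ h - 1)" by (simp add: prime_imp_coprime[OF prime_int])
    then show ?thesis using d coprime_dvd_mult_right_iff by blast
  next
    case True
    have "\<not> int p dvd int g ^ h + 1"
    proof
      assume "int p dvd int g ^ h + 1"
      then have "int p dvd (int g ^ h + 1) - (int g ^ h - 1)" using True by (rule dvd_diff)
      then have "int p dvd 2" by simp
      then show False using gt2 by (auto dest: zdvd_imp_le)
    qed
    then have "coprime (int p ^ M) (int g ^ h + 1)" by (simp add: prime_imp_coprime[OF prime_int])
    then show ?thesis using d \<open>\<not> int p ^ M dvd int g ^ h - 1\<close> coprime_dvd_mult_left_iff by blast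
  qed
  then have "[int g ^ h = - 1] (mod int p ^ M)" by (simp add: cong_iff_dvd_diff)
  then have "[(int g ^ h) ^ (t - 1) = (- 1) ^ (t - 1)] (mod int p ^ M)" by (rule cong_pow)
  moreover have "(- 1 :: int) ^ (t - 1) = - 1" using \<open>even t\<close> \<open>t > 0\<close> by simp
  moreover have "[int (\<Prod>j\<in>totatives m. j) = int ((g ^ h) ^ (t - 1))] (mod int m)"
    using prod by (simp only: cong_int_iff)
  ultimately show ?thesis unfolding set by (simp add: m_def) (metis cong_trans)
qed

lemma gam_prime_power:
  assumes "M > 0" shows "[gam (p ^ M) = 1] (mod int p ^ M)"
proof -
  have s: "(- 1 :: int) ^ (p ^ M) = - 1" using odd_p by (intro neg_one_odd_power) simp
  have "gam (p ^ M) = - (\<Prod>j\<in>{j. 0 < j \<and> j < p ^ M \<and> \<not> p dvd j}. int j)"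
    unfolding gamma_p_nat_def s by simp
  moreover have "[- (\<Prod>j\<in>{j. 0 < j \<and> j < p ^ M \<and> \<not> p dvd j}. int j) = - (- 1)] (mod int p ^ M)"
    using prod_units_prime_power[OF assms] unfolding cong_minus_minus_iff .
  ultimately show ?thesis by (simp only: minus_minus)
qed

text \<open>Continuity of Morita's function: the recursion \<open>gam_Suc\<close> sees its argument
  only modulo \<open>p ^ M\<close>, and Wilson's theorem supplies the starting value.\<close>

lemma gam_period: assumes "M > 0" shows "[gam (n + p ^ M) = gam n] (mod int p ^ M)"
proof (induction n)
  case 0
  show ?case using gam_prime_power[OF assms] by simp
next
  case (Suc n)
  have d: "p dvd n + p ^ M \<longleftrightarrow> p dvd n" using assms by (simp add: dvd_add_left_iff)
  have c: "[- int (n + p ^ M) = - int n] (mod int p ^ M)" by (simp add: cong_iff_dvd_diff)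
  show ?case
  proof (cases "p dvd n")
    case True
    then show ?thesis using Suc d by (simp add: gam_Suc cong_minus_minus_iff)
  next
    case False
    then show ?thesis using cong_mult[OF c Suc] d by (simp only: gam_Suc add_Suc if_False)
  qed
qed

lemma gam_cong: assumes "M > 0" "[m = n] (mod p ^ M)" shows "[gam m = gam n] (mod int p ^ M)"
proof -
  have *: "[gam (n + k * p ^ M) = gam n] (mod int p ^ M)" for n k
  proof (induction k)
    case (Suc k)
    then show ?case using gam_period[OF assms(1), of "n + k * p ^ M"]
      by (simp add: algebra_simps) (metis cong_trans)
  qed simp
  have **: "[gam n = gam (n mod p ^ M)] (mod int p ^ M)" for n
    using *[of "n mod p ^ M" "n div p ^ M"] by (simp only: mod_div_mult_eq)
  show ?thesis using **[of m] **[of n] assms(2) by (metis cong_def)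
qed

text \<open>The classical sign is \<open>(- 1) ^ a\<close> with \<open>a\<close> the representative
  of \<open>r\<close> between 1 and \<open>p\<close>; for \<open>p dvd r\<close> this is
  \<open>a = p\<close>, which is odd.\<close>

definition refl_sign :: "nat \<Rightarrow> int" where
  "refl_sign r = (if p dvd r then - 1 else (- 1) ^ (r mod p))"

text \<open>Passing from \<open>(r, s + 1)\<close> to \<open>(r + 1, s)\<close> multiplies the
  product by \<open>- r\<close> and divides it by \<open>- s\<close>, and \<open>s\<close> is
  \<open>- r\<close> modulo \<open>p ^ M\<close>, so the sign changes. If \<open>p\<close> divides
  \<open>r\<close>, both factors are \<open>- 1\<close> and nothing changes.\<close>

lemma gam_reflection:
  assumes "M > 0" "[r + s = 1] (mod p ^ M)"
  shows "[gam r * gam s = refl_sign r] (mod int p ^ M)"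
  using assms(2)
proof (induction r arbitrary: s)
  case 0
  then have "[gam s = gam 1] (mod int p ^ M)" using gam_cong[OF assms(1)] by simp
  then show ?case using gam_Suc[of 0] by (simp add: refl_sign_def)
next
  case (Suc r)
  from Suc.prems have c: "[r + s = 0] (mod p ^ M)"
    using cong_add_rcancel_0_nat[of "r + s" 1] cong_add_rcancel_nat[of "r + s" 1 0] by simp
  have IH: "[gam r * gam (Suc s) = refl_sign r] (mod int p ^ M)" using Suc.IH[of "Suc s"] Suc.prems by simp
  have "p ^ M dvd r + s" using c by (simp add: cong_0_iff)
  then have prs: "p dvd r + s" using assms(1) dvd_trans[OF dvd_power[of M p]] by blast
  show ?case
  proof (cases "p dvd r")
    case True
    then have "p dvd s" using prs by (simp add: dvd_add_right_iff)
    have "Suc r mod p = 1" using True gt2 by (auto simp: mod_Suc)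
    then have "refl_sign (Suc r) = refl_sign r"
      using True by (auto simp: refl_sign_def)
    moreover have "gam (Suc r) * gam s = gam r * gam (Suc s)" using True \<open>p dvd s\<close> by (simp add: gam_Suc)
    ultimately show ?thesis using IH by simp
  next
    case False
    then have "\<not> p dvd s" using prs by (metis dvd_add_left_iff)
    have "gam (Suc r) * gam s - (- (gam r * gam (Suc s))) = - int (r + s) * (gam r * gam s)"
      using False \<open>\<not> p dvd s\<close> by (simp add: gam_Suc algebra_simps)
    moreover have "int p ^ M dvd int (r + s)" using \<open>p ^ M dvd r + s\<close> by (metis of_nat_dvd_iff of_nat_power)
    ultimately have "[gam (Suc r) * gam s = - (gam r * gam (Suc s))] (mod int p ^ M)"
      by (simp only: cong_iff_dvd_diff dvd_mult2 dvd_minus_iff minus_mult_left[symmetric])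
    also have "[- (gam r * gam (Suc s)) = - refl_sign r] (mod int p ^ M)"
      using IH by (simp add: cong_minus_minus_iff)
    also have "- refl_sign r = refl_sign (Suc r)"
    proof (cases "p dvd Suc r")
      case True
      then have "r mod p = p - 1" by (metis Suc_pred' dvd_imp_mod_0 mod_Suc nat.discI p_pos(1) diff_Suc_1)
      then show ?thesis using True False odd_p by (simp add: refl_sign_def)
    next
      case F: False
      then have "Suc r mod p = Suc (r mod p)" by (metis dvd_eq_mod_eq_0 mod_Suc)
      then show ?thesis using F False by (simp add: refl_sign_def)
    qed
    finally show ?thesis .
  qed
qed

section \<open>Finite differences\<close>

definition fdiff :: "(nat \<Rightarrow> rat) \<Rightarrow> nat \<Rightarrow> rat" where
  "fdiff F n = F (Suc n) - F n"

lemma fdiff_add: "fdiff (\<lambda>n. F n + G n) = (\<lambda>n. fdiff F n + fdiff G n)"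
  by (auto simp: fdiff_def)

lemma fdiff_pow_add: "(fdiff ^^ k) (\<lambda>n. F n + G n) = (\<lambda>n. (fdiff ^^ k) F n + (fdiff ^^ k) G n)"
  by (induction k) (simp_all add: fdiff_add)

lemma fdiff_pow_Suc: "(fdiff ^^ k) (\<lambda>n. F (Suc n)) = (\<lambda>n. (fdiff ^^ k) F (Suc n))"
proof (induction k)
  case (Suc k)
  then show ?case by (simp add: fun_eq_iff fdiff_def)
qed simp

lemma fdiff_mult: "fdiff (\<lambda>n. F n * G n) = (\<lambda>n. fdiff F n * G (Suc n) + F n * fdiff G n)"
  by (auto simp: fdiff_def algebra_simps)

lemma fdiff_pow_0: "(fdiff ^^ k) (\<lambda>_. 0) = (\<lambda>_. 0)"
  by (induction k) (auto simp: fdiff_def)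

text \<open>Differencing a Newton expansion shifts its coefficients, so the \<open>k\<close>-th
  difference at 0 reads off the \<open>k\<close>-th coefficient.\<close>

lemma fdiff_pow_binomial_sum:
  "(fdiff ^^ k) (\<lambda>N. \<Sum>j\<le>N. of_nat (N choose j) * \<gamma> j) = (\<lambda>N. \<Sum>j\<le>N. of_nat (N choose j) * \<gamma> (j + k))"
proof (induction k)
  case (Suc k)
  have "fdiff (\<lambda>N. \<Sum>j\<le>N. of_nat (N choose j) * g j) N = (\<Sum>j\<le>N. of_nat (N choose j) * g (Suc j))" for g N
  proof -
    have "(\<Sum>j\<le>N. of_nat (N choose j) * g j) = (\<Sum>j\<le>Suc N. of_nat (N choose j) * g j)" by simp
    then have "fdiff (\<lambda>N. \<Sum>j\<le>N. of_nat (N choose j) * g j) N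
        = (\<Sum>j\<le>Suc N. (of_nat (Suc N choose j) - of_nat (N choose j)) * g j)"
      by (simp only: fdiff_def sum_subtractf[symmetric] left_diff_distrib)
    also have "\<dots> = (\<Sum>j\<le>N. (of_nat (Suc N choose Suc j) - of_nat (N choose Suc j)) * g (Suc j))"
      by (subst sum.atMost_Suc_shift) simp
    finally show ?thesis by simp
  qed
  from this[of "\<lambda>j. \<gamma> (j + k)"] show ?case
    unfolding funpow.simps comp_def Suc.IH by (intro ext) simp
qed simp

text \<open>The truncation at \<open>K\<close> allows a function to be bounded by bootstrapping from its difference equation.\<close>
definition small_diffs :: "nat \<Rightarrow> nat \<Rightarrow> (nat \<Rightarrow> rat) \<Rightarrow> bool" where
  "small_diffs K s F \<longleftrightarrow> (\<forall>k\<le>K. \<forall>n. V (int ((s + k + 1) div 2)) ((fdiff ^^ k) F n))"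

lemma small_diffs_mono:
  assumes "small_diffs K s F" "t \<le> s" "K' \<le> K" shows "small_diffs K' t F"
  unfolding small_diffs_def
proof (intro allI impI)
  fix k n assume "k \<le> K'"
  then have "V (int ((s + k + 1) div 2)) ((fdiff ^^ k) F n)" using assms by (simp add: small_diffs_def)
  moreover have "(t + k + 1) div 2 \<le> (s + k + 1) div 2" using assms(2) by (intro div_le_mono) simp
  ultimately show "V (int ((t + k + 1) div 2)) ((fdiff ^^ k) F n)"
    by (rule V_mono[OF _ of_nat_mono])
qed

lemma small_diffs_add: "small_diffs K s F \<Longrightarrow> small_diffs K s G \<Longrightarrow> small_diffs K s (\<lambda>n. F n + G n)"
  by (auto simp: small_diffs_def fdiff_pow_add intro: V_add)

lemma small_diffs_shift: "small_diffs K s F \<Longrightarrow> small_diffs K s (\<lambda>n. F (Suc n))"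
  by (auto simp: small_diffs_def fdiff_pow_Suc)

lemma small_diffs_fdiff: "small_diffs (Suc K) s F \<Longrightarrow> small_diffs K (Suc s) (fdiff F)"
  unfolding small_diffs_def
proof (intro allI impI)
  fix k n assume *: "\<forall>k\<le>Suc K. \<forall>n. V (int ((s + k + 1) div 2)) ((fdiff ^^ k) F n)" "k \<le> K"
  then have "V (int ((s + Suc k + 1) div 2)) ((fdiff ^^ Suc k) F n)" by blast
  then show "V (int ((Suc s + k + 1) div 2)) ((fdiff ^^ k) (fdiff F) n)" by (simp add: funpow_swap1)
qed

lemma small_diffs_SucI:
  assumes "\<And>n. V (int ((s + 1) div 2)) (F n)" "small_diffs K (Suc s) (fdiff F)"
  shows "small_diffs (Suc K) s F"
  unfolding small_diffs_def
proof (intro allI impI)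
  fix k n assume "k \<le> Suc K"
  then show "V (int ((s + k + 1) div 2)) ((fdiff ^^ k) F n)"
    using assms by (cases k) (auto simp: small_diffs_def funpow_swap1)
qed

lemma small_diffs_0: "small_diffs 0 s F \<longleftrightarrow> (\<forall>n. V (int ((s + 1) div 2)) (F n))"
  by (simp add: small_diffs_def)

text \<open>The product rule differences one factor at a time, which raises its weight by one, and
  rounding up half of the weight is subadditive.\<close>

lemma small_diffs_mult:
  "small_diffs K s F \<Longrightarrow> small_diffs K t G \<Longrightarrow> small_diffs K (s + t) (\<lambda>n. F n * G n)"
proof (induction K arbitrary: s t F G)
  case 0
  have "int ((s + t + 1) div 2) \<le> int ((s + 1) div 2) + int ((t + 1) div 2)" by linarith
  then show ?case using 0 unfolding small_diffs_0 by (blast intro: V_mono[OF V_mult])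
next
  case (Suc K)
  note 1 = small_diffs_mono[OF Suc.prems(1) order.refl le_SucI[OF order.refl]]
  note 2 = small_diffs_mono[OF Suc.prems(2) order.refl le_SucI[OF order.refl]]
  have "small_diffs K (Suc (s + t)) (\<lambda>n. fdiff F n * G (Suc n))"
    using Suc.IH[OF small_diffs_fdiff[OF Suc.prems(1)] small_diffs_shift[OF 2]] by simp
  moreover have "small_diffs K (Suc (s + t)) (\<lambda>n. F n * fdiff G n)"
    using Suc.IH[OF 1 small_diffs_fdiff[OF Suc.prems(2)]] by simp
  ultimately have "small_diffs K (Suc (s + t)) (fdiff (\<lambda>n. F n * G n))"
    by (simp add: fdiff_mult small_diffs_add)
  moreover have "V (int ((s + t + 1) div 2)) (F n * G n)" for n
  proof -
    have "V (int ((s + 1) div 2)) (F n)" "V (int ((t + 1) div 2)) (G n)"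
      using Suc.prems[unfolded small_diffs_def, THEN spec, of 0] by auto
    moreover have "int ((s + t + 1) div 2) \<le> int ((s + 1) div 2) + int ((t + 1) div 2)" by linarith
    ultimately show ?thesis using V_mono[OF V_mult] by blast
  qed
  ultimately show ?case by (intro small_diffs_SucI)
qed

lemma small_diffs_const:
  assumes "V (int ((s + 1) div 2)) c" shows "small_diffs K s (\<lambda>_. c)"
proof -
  have "fdiff (\<lambda>_. c) = (\<lambda>_. 0)" by (auto simp: fdiff_def)
  then have "(fdiff ^^ k) (\<lambda>_. c) n = (if k = 0 then c else 0)" for k n
    by (cases k) (simp_all add: funpow_Suc_right fdiff_pow_0 del: funpow.simps(2))
  then show ?thesis using assms by (simp add: small_diffs_def)
qed

text \<open>The values have valuation at least 1, but the first difference is \<open>p\<close>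
  itself and gains nothing. Hence a difference can be credited only with half a power of
  \<open>p\<close>, if \<open>p * n\<close> is to have weight 1.\<close>

lemma small_diffs_linear: "small_diffs K 1 (\<lambda>n. of_nat (p * n))"
proof -
  have f: "fdiff (\<lambda>n. of_nat (p * n)) = (\<lambda>_. of_nat p)" by (auto simp: fdiff_def algebra_simps)
  have p1: "V 1 (of_nat p)" using V_p_power[of 1] by simp
  show ?thesis
  proof (cases K)
    case 0
    have "V 1 (of_nat (p * n))" for n using V_mult_integral(1)[OF p1 V_of_nat] by simp
    then show ?thesis by (simp add: 0 small_diffs_0)
  next
    case (Suc K')
    have "V 1 (of_nat (p * n))" for n using V_mult_integral(1)[OF p1 V_of_nat] by simp
    then show ?thesis unfolding Suc by (intro small_diffs_SucI) (simp_all only: f, auto simp: p1 intro: small_diffs_const)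
  qed
qed

text \<open>Removing the constant term leaves products that contain some factor
  \<open>p * n\<close>, and this factor supplies the weight 1.\<close>

lemma small_diffs_prod_linear:
  assumes "finite A"
  shows "small_diffs K 0 (\<lambda>n. \<Prod>i\<in>A. of_nat (p * n + i))"
    and "small_diffs K 1 (\<lambda>n. (\<Prod>i\<in>A. of_nat (p * n + i)) - (\<Prod>i\<in>A. of_nat i))"
  using assms
proof (induction A rule: finite_induct)
  case empty
  { case 1 show ?case by (simp add: small_diffs_const) }
  { case 2 show ?case by (simp add: small_diffs_const) }
next
  case (insert a A)
  have lin: "small_diffs K 0 (\<lambda>n. of_nat (p * n + a))"
    unfolding of_nat_add
    by (intro small_diffs_add small_diffs_mono[OF small_diffs_linear] small_diffs_const) auto
  { case 1
    show ?case using small_diffs_mult[OF lin insert.IH(1)] insert.hyps by simp }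
  { case 2
    have "small_diffs K 1 (\<lambda>n. of_nat (p * n) * (\<Prod>i\<in>A. of_nat (p * n + i)) +
        of_nat a * ((\<Prod>i\<in>A. of_nat (p * n + i)) - (\<Prod>i\<in>A. of_nat i)))"
      using small_diffs_mult[OF small_diffs_linear insert.IH(1)] 
        small_diffs_mult[OF small_diffs_const[of 0 "of_nat a"] insert.IH(2)]
      by (intro small_diffs_add) simp_all
    then show ?case using insert.hyps by (simp add: algebra_simps) }
qed

section \<open>Dwork's exponential\<close>

text \<open>The series \<open>exp (a y + b y^p)\<close>. For \<open>a = 1\<close> and
  \<open>b = 1 / p\<close>, putting \<open>y = pi * z\<close> with \<open>pi^(p-1) = - p\<close>
  gives Dwork's \<open>exp (pi * (z - z^p))\<close>.\<close>

definition eb :: "rat \<Rightarrow> rat \<Rightarrow> rat fps" where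
  "eb a b = fps_exp a * (fps_exp b oo fps_X ^ p)"

definition dc :: "nat \<Rightarrow> rat" where
  "dc n = eb 1 (1 / of_nat p) $ n"

lemma eb_mult: "eb a b * eb a' b' = eb (a + a') (b + b')"
  by (simp add: eb_def fps_exp_add_mult fps_compose_mult_distrib)

lemma eb_0_0 [simp]: "eb 0 0 = 1"
  by (simp add: eb_def)

lemma eb_power: "eb a b ^ n = eb (of_nat n * a) (of_nat n * b)"
  by (induction n) (simp_all add: eb_mult algebra_simps)

lemma compose_X_power_nth: "((f :: rat fps) oo fps_X ^ p) $ n = (if p dvd n then f $ (n div p) else 0)"
proof -
  have "(f oo fps_X ^ p) $ n = (\<Sum>i = 0..n. f $ i * (if n = p * i then 1 else 0))"
    by (simp add: fps_compose_nth power_mult[symmetric])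
  also have "\<dots> = (\<Sum>i = 0..n. if i = n div p \<and> p dvd n then f $ i else 0)"
    by (intro sum.cong) auto
  also have "\<dots> = (if p dvd n then f $ (n div p) else 0)"
    by (cases "p dvd n") (auto simp: sum.delta)
  finally show ?thesis .
qed

lemma eb_0_nth: "eb 0 b $ n = (if p dvd n then b ^ (n div p) / fact (n div p) else 0)"
  by (simp add: eb_def compose_X_power_nth)

lemma eb_deriv: "fps_deriv (eb a b) = fps_const a * eb a b + fps_const (b * of_nat p) * (fps_X ^ (p - 1) * eb a b)"
proof -
  have "fps_deriv (fps_exp b oo fps_X ^ p) = fps_const b * (fps_exp b oo fps_X ^ p) * (fps_const (of_nat p) * fps_X ^ (p - 1))"
    by (subst fps_compose_deriv) (simp_all add: fps_compose_mult_distrib fps_deriv_power)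
  then show ?thesis
    by (simp add: eb_def algebra_simps fps_const_mult[symmetric] del: fps_const_mult)
qed

lemma dc_Suc: "of_nat (Suc n) * dc (Suc n) = dc n + (if p \<le> Suc n then dc (Suc n - p) else 0)"
proof -
  have "of_nat (Suc n) * dc (Suc n) = fps_deriv (eb 1 (1 / of_nat p)) $ n"
    by (simp add: dc_def)
  also have "\<dots> = dc n + (fps_X ^ (p - 1) * eb 1 (1 / of_nat p)) $ n"
    by (simp add: eb_deriv dc_def)
  also have "(fps_X ^ (p - 1) * eb 1 (1 / of_nat p)) $ n = (if p \<le> Suc n then dc (Suc n - p) else 0)"
    using gt2 by (auto simp: fps_X_power_mult_nth dc_def intro!: arg_cong[where f = "\<lambda>i. _ $ i"])
  finally show ?thesis .
qed

text \<open>Zero coefficients at negative indices let the recurrence \<open>dcz_rec\<close> hold at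
  every integer.\<close>

definition dcz :: "int \<Rightarrow> rat" where
  "dcz i = (if i < 0 then 0 else dc (nat i))"

lemma dcz_rec: "of_int i * dcz i = dcz (i - 1) + dcz (i - int p)"
proof (cases "i \<le> 0")
  case True
  then show ?thesis using gt2 by (auto simp: dcz_def)
next
  case False
  then obtain n where n: "i = int (Suc n)" by (metis gr0_implies_Suc not_le zero_less_imp_eq_int)
  have "nat (int (Suc n) - int p) = Suc n - p" "nat (int (Suc n)) = Suc n" "nat (int (Suc n) - 1) = n" by simp_all
  then show ?thesis using dc_Suc[of n] unfolding dcz_def n by auto
qed

text \<open>For \<open>a < p\<close>, stripping the powers of \<open>p\<close> from the factorials
  leaves, up to sign, the reciprocal of Morita's function at \<open>a + p * N + 1\<close>.\<close>

definition dfact :: "nat \<Rightarrow> nat \<Rightarrow> rat" where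
  "dfact a N = (- of_nat p) ^ N * fact N / fact (a + p * N)"

text \<open>Up to the sign \<open>(- 1) ^ k\<close> these are the Newton coefficients of
  \<open>dfact a\<close>, so that bounds on differences become bounds on \<open>dc\<close>.\<close>

definition dbeta :: "nat \<Rightarrow> nat \<Rightarrow> rat" where
  "dbeta a k = of_nat p ^ k * fact k * dc (a + p * k)"

text \<open>Compares coefficients in \<open>exp y = exp (- y^p / p) * E\<close>; the condition
  \<open>a < p\<close> makes \<open>N\<close> the last multiple that fits.\<close>

lemma inverse_fact_dc:
  assumes "a < p"
  shows "1 / fact (a + p * N) = (\<Sum>k\<le>N. dc (a + p * k) * ((- 1 / of_nat p) ^ (N - k) / fact (N - k)))"
proof -
  define n where "n = a + p * N"
  define B where "B = eb 0 (- 1 / of_nat p)"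
  have "eb 0 (- 1 / of_nat p) * eb 1 (1 / of_nat p) = eb 1 0"
    by (subst eb_mult) simp
  then have "(B * eb 1 (1 / of_nat p)) $ n = 1 / fact n"
    by (simp add: B_def) (simp add: eb_def)
  then have "1 / fact n = (\<Sum>i = 0..n. B $ i * dc (n - i))"
    by (simp add: fps_mult_nth dc_def)
  also have "\<dots> = (\<Sum>i\<in>(\<lambda>j. p * j) ` {..N}. B $ i * dc (n - i))"
  proof (rule sum.mono_neutral_right)
    show "(\<lambda>j. p * j) ` {..N} \<subseteq> {0..n}" by (auto simp: n_def intro!: trans_le_add2 mult_le_mono2)
    show "\<forall>i\<in>{0..n} - (\<lambda>j. p * j) ` {..N}. B $ i * dc (n - i) = 0"
    proof
      fix i assume i: "i \<in> {0..n} - (\<lambda>j. p * j) ` {..N}"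
      have "\<not> p dvd i"
      proof
        assume "p dvd i"
        then obtain j where j: "i = p * j" by auto
        have "p * j < p * Suc N" using i j assms by (auto simp: n_def)
        then have "j \<le> N" unfolding mult_less_cancel1 by simp
        then show False using i j by auto
      qed
      then show "B $ i * dc (n - i) = 0" by (simp add: B_def eb_0_nth)
    qed
  qed simp
  also have "\<dots> = (\<Sum>j\<le>N. B $ (p * j) * dc (n - p * j))"
    by (subst sum.reindex) (auto simp: inj_on_def)
  also have "\<dots> = (\<Sum>j\<le>N. (- 1 / of_nat p) ^ j / fact j * dc (a + p * (N - j)))"
    by (intro sum.cong) (auto simp: B_def eb_0_nth n_def algebra_simps diff_mult_distrib2)
  also have "\<dots> = (\<Sum>k\<le>N. (- 1 / of_nat p) ^ (N - k) / fact (N - k) * dc (a + p * k))"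
    by (rule sum.reindex_bij_witness[of _ "\<lambda>k. N - k" "\<lambda>k. N - k"]) auto
  finally show ?thesis by (simp add: n_def mult.commute)
qed

lemma dfact_binomial_sum:
  assumes "a < p"
  shows "dfact a N = (\<Sum>k\<le>N. of_nat (N choose k) * ((- 1) ^ k * dbeta a k))"
proof -
  have "dfact a N = (- of_nat p) ^ N * fact N * (1 / fact (a + p * N))" by (simp add: dfact_def)
  also have "\<dots> = (\<Sum>k\<le>N. (- of_nat p) ^ N * fact N * (dc (a + p * k) * ((- 1 / of_nat p) ^ (N - k) / fact (N - k))))"
    by (simp only: inverse_fact_dc[OF assms] sum_distrib_left)
  also have "\<dots> = (\<Sum>k\<le>N. of_nat (N choose k) * ((- 1) ^ k * dbeta a k))"
  proof (intro sum.cong refl)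
    fix k assume "k \<in> {..N}"
    then have k: "k \<le> N" by simp
    have "(- of_nat p :: rat) ^ N = (- of_nat p) ^ k * (- of_nat p) ^ (N - k)"
      using k by (simp flip: power_add)
    moreover have "(- of_nat p :: rat) ^ (N - k) * (- 1 / of_nat p) ^ (N - k) = 1"
      by (simp flip: power_mult_distrib)
    ultimately have 1: "(- of_nat p :: rat) ^ N * (- 1 / of_nat p) ^ (N - k) = (- of_nat p) ^ k" by simp
    have 2: "(- of_nat p :: rat) ^ k = (- 1) ^ k * of_nat p ^ k" by (rule power_minus)
    have 3: "fact N / fact (N - k) = (of_nat (N choose k) * fact k :: rat)"
      using k by (simp add: binomial_fact)
    have "(- of_nat p) ^ N * fact N * (dc (a + p * k) * ((- 1 / of_nat p) ^ (N - k) / fact (N - k)))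
        = ((- of_nat p :: rat) ^ N * (- 1 / of_nat p) ^ (N - k)) * (fact N / fact (N - k)) * dc (a + p * k)"
      by simp
    also have "\<dots> = of_nat (N choose k) * ((- 1) ^ k * dbeta a k)"
      unfolding 1 2 3 by (simp add: dbeta_def)
    finally show "(- of_nat p) ^ N * fact N * (dc (a + p * k) * ((- 1 / of_nat p) ^ (N - k) / fact (N - k)))
      = of_nat (N choose k) * ((- 1) ^ k * dbeta a k)" .
  qed
  finally show ?thesis .
qed

lemma dfact_gam:
  assumes "a < p"
  shows "dfact a N = (- 1) ^ Suc a / of_int (gam (a + p * N + 1))"
proof -
  define n where "n = a + p * N"
  have "n div p = N" using assms by (simp add: n_def)
  then have "(fact n :: int) = (- 1) ^ Suc n * gam (Suc n) * int p ^ N * fact N"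
    using gam_fact[of n] by simp
  then have "of_int (fact n) = (of_int ((- 1) ^ Suc n * gam (Suc n) * int p ^ N * fact N) :: rat)"
    by (simp only:)
  then have f: "(fact n :: rat) = (- 1) ^ Suc n * of_int (gam (Suc n)) * of_nat p ^ N * fact N" by simp
  have g: "of_int (gam (Suc n)) \<noteq> (0 :: rat)" using punit_gam[of "Suc n"] by (simp add: punit_def)
  have s: "(- 1 :: rat) ^ N * (- 1) ^ Suc n = (- 1) ^ Suc a"
  proof -
    have "N + Suc n = Suc a + (p + 1) * N" by (simp add: n_def algebra_simps)
    then have "(- 1 :: rat) ^ N * (- 1) ^ Suc n = (- 1) ^ Suc a * ((- 1) ^ (p + 1)) ^ N"
      by (simp only: power_add[symmetric] power_mult[symmetric])
    then show ?thesis using odd_p by simp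
  qed
  have "dfact a N = (- 1) ^ N * of_nat p ^ N * fact N / ((- 1) ^ Suc n * of_int (gam (Suc n)) * of_nat p ^ N * fact N)"
    unfolding dfact_def n_def[symmetric] f by (simp add: power_minus[of "of_nat p"])
  also have "\<dots> = (- 1) ^ N / ((- 1) ^ Suc n * of_int (gam (Suc n)))" by simp
  also have "\<dots> = (- 1) ^ N * (- 1) ^ Suc n / of_int (gam (Suc n))"
    by (cases "even n") simp_all
  also have "\<dots> = (- 1) ^ Suc a / of_int (gam (Suc n))" unfolding s ..
  finally show ?thesis by (simp add: n_def)
qed

lemma punit_dfact: "a < p \<Longrightarrow> punit (dfact a N)"
  by (simp only: dfact_gam) (intro punit_divide punit_power punit_minus punit_1 punit_gam)

lemma fact_add_prod: "(fact (n + k) :: rat) = fact n * (\<Prod>i\<in>{1..k}. of_nat (n + i))"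
  by (induction k) (simp_all add: algebra_simps)

text \<open>The quotient of consecutive values of \<open>dfact a\<close>. The omitted factor
  \<open>p * N + p\<close> cancels against \<open>- p * (N + 1)\<close>, which leaves only factors
  prime to \<open>p\<close> and the sign.\<close>

definition dstep :: "nat \<Rightarrow> nat \<Rightarrow> rat" where
  "dstep a N = - (\<Prod>i\<in>{a + 1..a + p} - {p}. of_nat (p * N + i))"

lemma dfact_step:
  assumes "a < p"
  shows "dfact a N = dstep a N * dfact a (Suc N)"
proof -
  define P where "P = (\<Prod>i\<in>{a + 1..a + p} - {p}. (of_nat (p * N + i) :: rat))"
  have "(\<Prod>i\<in>{1..p}. (of_nat (a + p * N + i) :: rat)) = (\<Prod>i\<in>{a + 1..a + p}. of_nat (p * N + i))"
    by (rule prod.reindex_bij_witness[of _ "\<lambda>i. i - a" "\<lambda>i. i + a"]) (auto simp: algebra_simps)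
  also have "\<dots> = of_nat (p * N + p) * P"
    unfolding P_def using assms by (subst prod.remove[of _ p]) auto
  finally have "(fact (a + p * N + p) :: rat) = fact (a + p * N) * (of_nat (p * N + p) * P)"
    by (simp only: fact_add_prod)
  moreover have "a + p * Suc N = a + p * N + p" by simp
  ultimately have f: "(fact (a + p * Suc N) :: rat) = fact (a + p * N) * (of_nat p * of_nat (Suc N) * P)"
    by (simp add: algebra_simps)
  have "P \<noteq> 0" unfolding P_def prod_zero_iff[OF finite_Diff[OF finite_atLeastAtMost]] of_nat_eq_0_iff by auto
  then show ?thesis
    unfolding dfact_def dstep_def P_def[symmetric] f by (simp add: divide_simps)
qed

text \<open>The value at 0 is a quotient of two values of \<open>gam\<close> at arguments differing
  by \<open>p\<close>, hence 1 modulo \<open>p\<close>; the variable part is a product of linear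
  factors without its constant term.\<close>

lemma small_diffs_dstep:
  assumes "a < p"
  shows "small_diffs K 1 (\<lambda>N. 1 - dstep a N)"
proof -
  have nz: "dfact a N \<noteq> 0" for N using punit_dfact[OF assms] by (simp add: punit_def)
  have "dstep a 0 = dfact a 0 / dfact a 1" using dfact_step[OF assms, of 0] nz[of 1] by simp
  also have "\<dots> = of_int (gam (a + p + 1)) / of_int (gam (a + 1))"
    by (simp add: dfact_gam[OF assms])
  finally have e: "dstep a 0 = of_int (gam (a + 1 + p)) * inverse (of_int (gam (a + 1)))"
    by (simp add: divide_inverse)
  have "padic_eq (int 1) (of_int (gam (a + 1 + p))) (of_int (gam (a + 1)))"
    unfolding peq_of_int using gam_period[of 1 "a + 1"] by simp
  then have "padic_eq 1 (of_int (gam (a + 1 + p)) * inverse (of_int (gam (a + 1)))) (of_int (gam (a + 1)) * inverse (of_int (gam (a + 1))))"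
    using punit_gam[of "a + 1"] by (intro peq_mult_right) (simp_all add: punit_def)
  then have "padic_eq 1 (dstep a 0) 1"
    using punit_gam[of "a + 1"] unfolding e by (simp add: punit_def)
  then have "V 1 (1 - dstep a 0)" using peq_sym by (simp add: padic_eq_def)
  then have "small_diffs K 1 (\<lambda>N. (1 - dstep a 0) + ((\<Prod>i\<in>{a + 1..a + p} - {p}. of_nat (p * N + i))
      - (\<Prod>i\<in>{a + 1..a + p} - {p}. of_nat i)))"
    by (intro small_diffs_add small_diffs_const small_diffs_prod_linear) simp_all
  then show ?thesis by (simp add: dstep_def)
qed

text \<open>Bootstrapping: the difference of \<open>dfact a\<close> is the shifted function times
  \<open>1 - dstep a\<close>. The bounds up to order \<open>K\<close>, together with the weight 1 of
  the second factor, give the bounds up to order \<open>K + 1\<close>.\<close>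

lemma small_diffs_dfact:
  assumes "a < p"
  shows "small_diffs K 0 (dfact a)"
proof (induction K)
  case 0
  show ?case using punit_dfact[OF assms] by (simp add: small_diffs_0 punit_def)
next
  case (Suc K)
  have "fdiff (dfact a) = (\<lambda>N. (1 - dstep a N) * dfact a (Suc N))"
    by (intro ext) (simp add: fdiff_def left_diff_distrib flip: dfact_step[OF assms])
  then have "small_diffs K 1 (fdiff (dfact a))"
    using small_diffs_mult[OF small_diffs_dstep[OF assms] small_diffs_shift[OF Suc]] by simp
  then show ?case using punit_dfact[OF assms] by (intro small_diffs_SucI) (simp_all add: punit_def)
qed

text \<open>The \<open>k\<close>-th difference of \<open>dfact a\<close> at 0 is this coefficient up
  to sign.\<close>

lemma V_dbeta:
  assumes "a < p"
  shows "V (int ((k + 1) div 2)) (dbeta a k)"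
proof -
  have "dfact a = (\<lambda>N. \<Sum>k\<le>N. of_nat (N choose k) * ((- 1) ^ k * dbeta a k))"
    using dfact_binomial_sum[OF assms] by auto
  then have "(fdiff ^^ k) (dfact a) 0 = (- 1) ^ k * dbeta a k"
    by (simp only: fdiff_pow_binomial_sum) simp
  moreover have "V (int ((0 + k + 1) div 2)) ((fdiff ^^ k) (dfact a) 0)"
    using small_diffs_dfact[OF assms, of k] unfolding small_diffs_def by blast
  ultimately have "V (int ((k + 1) div 2)) ((- 1) ^ k * dbeta a k)" by simp
  then show ?thesis by (cases "even k") simp_all
qed

text \<open>The loss \<open>n div (p - 1)\<close> is compensated at a root of
  \<open>y^(p-1) = - p\<close>; the gain \<open>n div (2 * p)\<close>, coming from
  \<open>V_dbeta\<close> with \<open>k = n div p\<close>, is the surplus that makes the series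
  converge there.\<close>

lemma V_dc: "V (int (n div (2 * p)) - int (n div (p - 1))) (dc n)"
proof -
  define a k where "a = n mod p" and "k = n div p"
  have n: "n = a + p * k" by (simp add: a_def k_def)
  have "a < p" by (simp add: a_def)
  have "dc n = dbeta a k * (of_nat p powi (- int k) * (1 / fact k))"
    by (simp add: dbeta_def n power_int_minus field_simps)
  moreover have "V (int ((k + 1) div 2) + (- int k + - int (k div (p - 1)))) (dbeta a k * (of_nat p powi (- int k) * (1 / fact k)))"
    by (intro V_mult V_powi V_inverse_fact V_dbeta \<open>a < p\<close>)
  moreover have "n div (2 * p) = k div 2" by (simp add: k_def div_mult2_eq mult.commute)
  moreover have "k + k div (p - 1) \<le> n div (p - 1)" using div_mult_div_le[of n] by (simp add: k_def)
  ultimately show ?thesis by (auto elim!: V_mono)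
qed

lemma V_dc0: "V (- int (n div (p - 1))) (dc n)"
  using V_mono[OF V_dc[of n]] by simp

section \<open>The Gross-Koblitz formula over the prime field\<close>

lemma p_integral_approx_nat:
  assumes "V 0 x" shows "\<exists>r. padic_eq (int M) x (of_nat r)"
proof -
  obtain a b where ab: "\<not> int p dvd b" "x = of_int a / of_int b"
    using assms by (auto simp: V_0_iff p_integral_def)
  have "coprime b (int p ^ M)"
    using prime_imp_coprime[OF prime_int ab(1)] by (simp add: coprime_commute)
  then obtain c where c: "[b * c = 1] (mod int p ^ M)" using cong_solve_coprime_int by blast
  define r where "r = nat ((a * c) mod int p ^ M)"
  have r: "int r = (a * c) mod int p ^ M" by (simp add: r_def)
  have "[b * int r = b * (a * c)] (mod int p ^ M)" unfolding r by (intro cong_mult) (simp_all add: cong_def)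
  also have "b * (a * c) = a * (b * c)" by simp
  also have "[a * (b * c) = a * 1] (mod int p ^ M)" by (intro cong_mult c cong_refl)
  finally have "padic_eq (int M) (of_int (b * int r)) (of_int a)" by (simp only: peq_of_int mult_1_right)
  moreover have "b \<noteq> 0" using ab by auto
  ultimately have "padic_eq (int M) (of_int b * of_nat r) (of_int b * x)" by (simp add: ab(2))
  then show ?thesis using peq_cancel_left punit_of_int[OF ab(1)] peq_sym by blast
qed

lemma peq_pochhammer: "padic_eq k z w \<Longrightarrow> V 0 z \<Longrightarrow> V 0 w \<Longrightarrow> padic_eq k (pochhammer z l) (pochhammer w l)"
  unfolding pochhammer_prod by (intro peq_prod conjI V_add peq_add) auto

lemma pochhammer_of_nat_dvd: "\<exists>c::nat. pochhammer (of_nat r :: rat) l = fact l * of_nat c"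
proof (cases "r = 0")
  case True
  then show ?thesis by (cases l) (auto simp: pochhammer_rec intro: exI[of _ 0] exI[of _ 1])
next
  case False
  have "fact l dvd pochhammer r l"
  proof -
    have "pochhammer r l = (fact l :: nat) * ((r + l - 1) choose l)"
    proof -
      have "(of_nat (pochhammer r l) :: rat) = of_nat (fact l * ((r + l - 1) choose l))"
        using False
        by (simp add: pochhammer_of_nat[symmetric] binomial_gbinomial gbinomial_pochhammer' of_nat_diff)
      then show ?thesis using of_nat_eq_iff by blast
    qed
    then show ?thesis by simp
  qed
  then obtain c where "pochhammer r l = fact l * c" by auto
  then have "pochhammer (of_nat r :: rat) l = of_nat (fact l * c)"
    by (metis pochhammer_of_nat)
  then show ?thesis by auto
qed

text \<open>At a natural number the rising factorial is \<open>l!\<close> times a binomial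
  coefficient; a sufficiently close natural number transports the bound.\<close>

lemma V_pochhammer:
  assumes "V 0 z" shows "V (int (l div p)) (pochhammer z l)"
proof -
  obtain r where r: "padic_eq (int (l div p)) z (of_nat r)" using p_integral_approx_nat[OF assms] by blast
  obtain c where c: "pochhammer (of_nat r :: rat) l = fact l * of_nat c" using pochhammer_of_nat_dvd by blast
  have "V (int (l div p)) (pochhammer z l - pochhammer (of_nat r) l)"
    using peq_pochhammer[OF r assms V_of_nat] by (simp add: padic_eq_def)
  moreover have "V (int (l div p)) (pochhammer (of_nat r) l)"
    unfolding c by (intro V_mult_integral V_fact V_of_nat)
  ultimately show ?thesis using V_add by fastforce
qed

text \<open>The matrix of Dwork's operator on \<open>y^n\<close>, and the coordinate functions \<open>fr\<close> expressing
  \<open>y^m\<close> through \<open>1\<close> and the exact forms \<open>(y d/dy + \<alpha> + y) y^j\<close>: the operator has rank one modulo exact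
  forms and is multiplied by \<open>p\<close> on them, so its trace is its eigenvalue divided by \<open>1 - p\<close>.\<close>
definition psi :: "nat \<Rightarrow> nat \<Rightarrow> nat \<Rightarrow> rat" where
  "psi a m n = dcz (int (p * m + a) - int n) * (- of_nat p) ^ m"

definition fr :: "rat \<Rightarrow> nat \<Rightarrow> nat \<Rightarrow> rat" where
  "fr \<alpha> m n = (- 1) ^ (m - n) * pochhammer (\<alpha> + of_nat n) (m - n)"

lemma fr_same [simp]: "fr \<alpha> m m = 1"
  by (simp add: fr_def)

lemma fr_rec_right: "n < m \<Longrightarrow> fr \<alpha> m n = - (\<alpha> + of_nat n) * fr \<alpha> m (Suc n)"
proof -
  assume "n < m"
  then have "m - n = Suc (m - Suc n)" by simp
  then show ?thesis by (simp add: fr_def pochhammer_rec algebra_simps)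
qed

lemma fr_rec_left: "n \<le> m \<Longrightarrow> fr \<alpha> (Suc m) n = - (\<alpha> + of_nat m) * fr \<alpha> m n"
  by (simp add: fr_def Suc_diff_le pochhammer_rec' of_nat_diff algebra_simps)

text \<open>Coefficient of \<open>y^(m+1)\<close> in the rule that Dwork's operator after
  \<open>y d/dy + \<alpha> + y\<close> is \<open>p\<close> times the same derivation after the
  operator. It is the recurrence of \<open>dcz\<close> combined with
  \<open>\<alpha> * (p - 1) = a\<close>.\<close>

lemma psi_rel:
  assumes "\<alpha> * (of_nat p - 1) = of_nat a"
  shows "psi a (Suc m) (Suc n) + (of_nat n + \<alpha>) * psi a (Suc m) n
       = of_nat p * ((of_nat (Suc m) + \<alpha>) * psi a (Suc m) n + psi a m n)"
proof -
  define i where "i = int (p * Suc m + a) - int n"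
  have 1: "psi a (Suc m) (Suc n) = dcz (i - 1) * (- of_nat p) ^ Suc m"
    by (simp add: psi_def i_def algebra_simps)
  have 2: "psi a (Suc m) n = dcz i * (- of_nat p) ^ Suc m" by (simp add: psi_def i_def)
  have 3: "of_nat p * psi a m n = - (dcz (i - int p) * (- of_nat p) ^ Suc m)"
    by (simp add: psi_def i_def algebra_simps)
  have 4: "of_nat p * (of_nat (Suc m) + \<alpha>) - (of_nat n + \<alpha>) = of_int i"
    using assms by (simp add: i_def algebra_simps)
  have "of_nat p * ((of_nat (Suc m) + \<alpha>) * psi a (Suc m) n + psi a m n)
      - (psi a (Suc m) (Suc n) + (of_nat n + \<alpha>) * psi a (Suc m) n)
     = (of_nat p * (of_nat (Suc m) + \<alpha>) - (of_nat n + \<alpha>)) * psi a (Suc m) n + of_nat p * psi a m n - psi a (Suc m) (Suc n)"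
    by (simp only: algebra_simps)
  also have "\<dots> = (of_int i * dcz i - dcz (i - int p) - dcz (i - 1)) * (- of_nat p) ^ Suc m"
    unfolding 1 2 3 4 by (simp only: algebra_simps)
  also have "\<dots> = 0" by (simp add: dcz_rec)
  finally show ?thesis by simp
qed

text \<open>Modulo exact forms \<open>y^(j+1)\<close> equals \<open>- (\<alpha> + j) * y^j\<close>,
  so the first sum is the coordinate of the image of \<open>y^n\<close> on \<open>y^n\<close> after
  reducing all higher powers, and the second is the same for \<open>n + 1\<close>. The diagonal
  entry is their difference up to the factor \<open>1 - p\<close>; truncation at \<open>X\<close>
  leaves the last term.\<close>

lemma trace_step:
  assumes "\<alpha> * (of_nat p - 1) = of_nat a" "n \<le> X"
  shows "(1 - of_nat p) * psi a n n = (\<Sum>m\<in>{n..X}. fr \<alpha> m n * psi a m n)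
     - (\<Sum>m\<in>{Suc n..X}. fr \<alpha> m (Suc n) * psi a m (Suc n)) - of_nat p * fr \<alpha> (Suc X) (Suc n) * psi a X n"
  using assms(2)
proof (induction X rule: dec_induct)
  case base
  then show ?case by (simp add: left_diff_distrib)
next
  case (step X)
  define R where "R = fr \<alpha> (Suc X) (Suc n)"
  have a: "fr \<alpha> (Suc X) n = - (\<alpha> + of_nat n) * R" unfolding R_def using step by (intro fr_rec_right) simp
  have b: "fr \<alpha> (Suc (Suc X)) (Suc n) = - (\<alpha> + of_nat (Suc X)) * R"
    unfolding R_def using step by (intro fr_rec_left) simp
  have "fr \<alpha> (Suc X) n * psi a (Suc X) n - R * psi a (Suc X) (Suc n)
     - of_nat p * fr \<alpha> (Suc (Suc X)) (Suc n) * psi a (Suc X) n + of_nat p * R * psi a X n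
   = R * (of_nat p * ((of_nat (Suc X) + \<alpha>) * psi a (Suc X) n + psi a X n)
     - (psi a (Suc X) (Suc n) + (of_nat n + \<alpha>) * psi a (Suc X) n))"
    unfolding a b by (simp add: algebra_simps)
  also have "\<dots> = 0" using psi_rel[OF assms(1), of X n] by simp
  finally show ?case using step R_def by simp
qed

text \<open>Summation over \<open>n\<close> telescopes: the coordinate of the image of 1 survives,
  which is the eigenvalue on the quotient by exact forms, along with the boundary terms.\<close>

lemma trace_formula:
  assumes "\<alpha> * (of_nat p - 1) = of_nat a"
  shows "(1 - of_nat p) * (\<Sum>n\<le>X. psi a n n) = (\<Sum>m\<le>X. fr \<alpha> m 0 * psi a m 0)
    - of_nat p * (\<Sum>n\<le>X. fr \<alpha> (Suc X) (Suc n) * psi a X n)"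
proof -
  define Q where "Q n = (\<Sum>m\<in>{n..X}. fr \<alpha> m n * psi a m n)" for n
  have "(1 - of_nat p) * (\<Sum>n\<le>X. psi a n n)
      = (\<Sum>n\<le>X. Q n - Q (Suc n) - of_nat p * (fr \<alpha> (Suc X) (Suc n) * psi a X n))"
    unfolding sum_distrib_left Q_def
    by (intro sum.cong refl) (simp add: trace_step[OF assms] mult.assoc)
  also have "\<dots> = (\<Sum>n\<le>X. Q n - Q (Suc n)) - of_nat p * (\<Sum>n\<le>X. fr \<alpha> (Suc X) (Suc n) * psi a X n)"
    by (simp add: sum_subtractf sum_distrib_left)
  also have "(\<Sum>n\<le>X. Q n - Q (Suc n)) = Q 0 - Q (Suc X)" by (rule sum_telescope)
  finally show ?thesis by (simp add: Q_def atLeast0AtMost)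
qed

text \<open>Up to sign these are binomial coefficients, which are integers at natural arguments;
  approximation carries integrality over.\<close>

lemma V_pochhammer_fact:
  assumes "V 0 z" shows "V 0 (pochhammer z m / fact m)"
proof -
  obtain r where r: "padic_eq (int (m div (p - 1))) z (of_nat r)" using p_integral_approx_nat[OF assms] by blast
  obtain c where c: "pochhammer (of_nat r :: rat) m = fact m * of_nat c" using pochhammer_of_nat_dvd by blast
  have "V (int (m div (p - 1))) (pochhammer z m - pochhammer (of_nat r) m)"
    using peq_pochhammer[OF r assms V_of_nat] by (simp add: padic_eq_def)
  from V_mult[OF this V_inverse_fact[of m]]
  have "V 0 (pochhammer z m / fact m - pochhammer (of_nat r) m / fact m)" by (simp add: diff_divide_distrib)
  moreover have "pochhammer (of_nat r :: rat) m / fact m = of_nat c" using c by simp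
  ultimately show ?thesis using V_add[OF _ V_of_nat[of c]] by fastforce
qed

lemma dcz_of_nat: "dcz (int n) = dc n"
  by (simp add: dcz_def)

lemma fr_psi_0: "fr \<alpha> m 0 * psi a m 0 = dbeta a m * (pochhammer \<alpha> m / fact m)"
proof -
  have e: "int (p * m + a) - int 0 = int (a + p * m)" by simp
  have "psi a m 0 = dc (a + p * m) * ((- 1) ^ m * of_nat p ^ m)"
    unfolding psi_def e dcz_of_nat power_minus[of "of_nat p" m] ..
  moreover have "(- 1 :: rat) ^ m * (- 1) ^ m = 1" by (simp flip: power_mult_distrib)
  ultimately show ?thesis by (simp add: fr_def dbeta_def algebra_simps)
qed

text \<open>The eigenvalue is the Newton series of \<open>dfact a\<close> at
  \<open>- \<alpha>\<close>. Replacing \<open>- \<alpha>\<close> by the natural number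
  \<open>R\<close> makes the series finite with value \<open>dfact a R\<close>; terms from index
  \<open>2 * M\<close> on vanish modulo \<open>p ^ M\<close> by \<open>V_dbeta\<close>.\<close>

lemma eigenvalue_sum:
  assumes "a < p" "V 0 \<alpha>" "2 * M \<le> X" "padic_eq (int (3 * M)) \<alpha> (- of_nat R)"
  shows "padic_eq (int M) (\<Sum>m\<le>X. fr \<alpha> m 0 * psi a m 0) (dfact a R)"
proof -
  define t where "t z m = dbeta a m * (pochhammer z m / fact m)" for z m
  have tV: "V (int ((m + 1) div 2)) (t z m)" if "V 0 z" for z m
    unfolding t_def using V_dbeta[OF assms(1)] V_pochhammer_fact[OF that] by (rule V_mult_integral(1))
  have trunc: "padic_eq (int M) (\<Sum>m\<le>Y. t z m) (\<Sum>m<2 * M. t z m)" if "V 0 z" "2 * M \<le> Y" for z Y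
  proof -
    have "{..Y} = {..<2 * M} \<union> {2 * M..Y}" "{..<2 * M} \<inter> {2 * M..Y} = {}" using that by auto
    then have "(\<Sum>m\<le>Y. t z m) = (\<Sum>m<2 * M. t z m) + (\<Sum>m\<in>{2 * M..Y}. t z m)"
      using sum.union_disjoint[of "{..<2 * M}" "{2 * M..Y}"] by simp
    moreover have "V (int M) (\<Sum>m\<in>{2 * M..Y}. t z m)"
      by (intro V_sum V_mono[OF tV[OF that(1)]]) auto
    ultimately show ?thesis by (simp add: padic_eq_def)
  qed
  have R: "V 0 (- of_nat R)" by simp
  \<comment> \<open>Dividing by \<open>m!\<close> costs at most \<open>m < 2 * M\<close> powers of
    \<open>p\<close>, hence the precision \<open>3 * M\<close> demanded of \<open>R\<close>.\<close>
  have "padic_eq (int M) (t \<alpha> m) (t (- of_nat R) m)" if "m < 2 * M" for m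
  proof -
    have "V (int (3 * M)) (pochhammer \<alpha> m - pochhammer (- of_nat R) m)"
      using peq_pochhammer[OF assms(4,2) R] by (simp add: padic_eq_def)
    from V_mult[OF this V_inverse_fact[of m]]
    have "V (int (3 * M) + - int (m div (p - 1))) (pochhammer \<alpha> m / fact m - pochhammer (- of_nat R) m / fact m)"
      by (simp add: diff_divide_distrib)
    moreover have "m div (p - 1) \<le> m" by (rule div_le_dividend)
    ultimately have "padic_eq (int M) (pochhammer \<alpha> m / fact m) (pochhammer (- of_nat R) m / fact m)"
      unfolding padic_eq_def using that by (elim V_mono) linarith
    then show ?thesis unfolding t_def
      by (rule peq_mult_left) (rule V_mono[OF V_dbeta[OF assms(1)]], simp)
  qed
  then have mid: "padic_eq (int M) (\<Sum>m<2 * M. t \<alpha> m) (\<Sum>m<2 * M. t (- of_nat R) m)"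
    by (intro peq_sum) auto
  have t_R: "t (- of_nat R) m = of_nat (R choose m) * ((- 1) ^ m * dbeta a m)" for m
  proof -
    have "(of_nat (R choose m) :: rat) = (- 1) ^ m * pochhammer (- of_nat R) m / fact m"
      by (simp add: binomial_gbinomial gbinomial_pochhammer)
    moreover have "(- 1 :: rat) ^ m * (- 1) ^ m = 1" by (simp flip: power_mult_distrib)
    ultimately show ?thesis by (simp add: t_def algebra_simps)
  qed
  have "(\<Sum>m\<le>R + 2 * M. t (- of_nat R) m) = (\<Sum>m\<le>R. t (- of_nat R) m)"
    by (rule sum.mono_neutral_right) (auto simp: t_R)
  then have dR: "(\<Sum>m\<le>R + 2 * M. t (- of_nat R) m) = dfact a R"
    by (simp add: dfact_binomial_sum[OF assms(1)] t_R)
  have "padic_eq (int M) (\<Sum>m\<le>X. t \<alpha> m) (\<Sum>m<2 * M. t \<alpha> m)" using trunc assms by blast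
  also note mid
  also have "padic_eq (int M) (\<Sum>m<2 * M. t (- of_nat R) m) (\<Sum>m\<le>R + 2 * M. t (- of_nat R) m)"
    using trunc[OF R, of "R + 2 * M"] peq_sym by simp
  finally show ?thesis unfolding dR by (simp add: fr_psi_0 t_def)
qed

text \<open>With \<open>l = X - n\<close> and index \<open>N = (p - 1) * X + l + a\<close> of the
  coefficient, the gains \<open>X\<close>, \<open>l / p\<close> and \<open>N / (2 * p)\<close> face
  the loss \<open>N / (p - 1)\<close>, about \<open>X + l / (p - 1)\<close>. As
  \<open>N / (2 * p)\<close> is at least \<open>X / 3\<close> and \<open>l / (p - 1) - l / p\<close>
  at most \<open>X / 6\<close>, at least \<open>X / 6\<close> remains, less 3 for roundings and
  \<open>a\<close>.\<close>

lemma trace_error: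
  assumes "V 0 \<alpha>" "a < p" "n \<le> X" "6 * (M + 3) \<le> X"
  shows "V (int M) (fr \<alpha> (Suc X) (Suc n) * psi a X n)"
proof -
  define l where "l = X - n"
  define N where "N = (p - 1) * X + l + a"
  have pX: "p * X = (p - 1) * X + X"
    by (metis Suc_diff_1 mult_Suc add.commute p_pos(1))
  have N: "int (p * X + a) - int n = int N" using assms(3) unfolding pX by (simp add: N_def l_def)
  have 1: "V (int (l div p)) (fr \<alpha> (Suc X) (Suc n))"
  proof -
    have "V (int (l div p)) (pochhammer (\<alpha> + of_nat (Suc n)) l)"
      using assms(1) by (intro V_pochhammer V_add V_of_nat)
    then show ?thesis by (cases "even l") (simp_all add: fr_def l_def)
  qed
  have "V ((int (N div (2 * p)) - int (N div (p - 1))) + int X) (dc N * of_nat p ^ X)"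
    by (intro V_mult V_dc V_p_power)
  then have 2: "V ((int (N div (2 * p)) - int (N div (p - 1))) + int X) (psi a X n)"
    unfolding psi_def N dcz_of_nat by (cases "even X") simp_all
  have "int M \<le> int (l div p) + ((int (N div (2 * p)) - int (N div (p - 1))) + int X)"
  proof -
    define P where "P = real p"
    have P: "P \<ge> 3" using gt2 by (simp add: P_def)
    have rp: "real (p - Suc 0) = P - 1" using gt2 by (simp add: P_def of_nat_diff)
    have rdiv: "real x / real y - 1 \<le> real (x div y)" for x y :: nat
    proof (cases "y = 0")
      case False
      have "real x = real y * real (x div y) + real (x mod y)"
        by (metis of_nat_add of_nat_mult mult_div_mod_eq)
      moreover have "real (x mod y) \<le> real y" using False by simp
      ultimately have "real x \<le> (real (x div y) + 1) * real y" by (simp add: algebra_simps)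
      then have "real x / real y \<le> real (x div y) + 1" using False by (simp add: pos_divide_le_eq)
      then show ?thesis by simp
    qed auto
    have lX: "real l \<le> real X" by (simp add: l_def)
    have rN: "real N = (P - 1) * real X + real l + real a" by (simp add: N_def rp)
    have a1: "real (N div (p - 1)) \<le> real N / (P - 1)" using of_nat_mono[OF div_times_less_eq_dividend[of N "p - 1"], where 'a = real] P
      by (simp add: rp pos_le_divide_eq)
    have a2: "real N / (P - 1) \<le> real X + real l / (P - 1) + 1"
    proof -
      have "real a \<le> P - 1" using assms(2) gt2 by (simp add: P_def)
      then have "real a / (P - 1) \<le> 1" using P by simp
      moreover have "real N / (P - 1) = real X + real l / (P - 1) + real a / (P - 1)"
        unfolding rN using P by (simp add: add_divide_distrib)
      ultimately show ?thesis by linarith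
    qed
    have b: "real l / P - 1 \<le> real (l div p)" using rdiv[of l p] by (simp add: P_def)
    have c1: "real N / (2 * P) - 1 \<le> real (N div (2 * p))" using rdiv[of N "2 * p"] by (simp add: P_def)
    have c2: "real X / 3 \<le> real N / (2 * P)"
    proof -
      have "real X / 3 * (2 * P) \<le> (P - 1) * real X"
        using P mult_right_mono[of "2 * P" "3 * (P - 1)" "real X"] by (simp add: algebra_simps)
      also have "\<dots> \<le> real N" by (simp add: rN)
      finally show ?thesis using P by (simp add: field_simps)
    qed
    have d: "real l / (P - 1) - real l / P \<le> real X / 6"
    proof -
      have "real l / (P - 1) - real l / P = real l / (P * (P - 1))" using P by (simp add: field_simps)
      also have "\<dots> \<le> real l / 6"
      proof (intro divide_left_mono)
        show "6 \<le> P * (P - 1)" using mult_mono[of 3 P 2 "P - 1"] P by simp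
      qed (use P in auto)
      finally show ?thesis using lX by simp
    qed
    have "real M + 3 \<le> real X / 6"
      using of_nat_mono[OF assms(4), where 'a = real] by simp
    then have "real M + real (N div (p - 1)) \<le> real (l div p) + real (N div (2 * p)) + real X"
      using a1 a2 b c1 c2 d unfolding One_nat_def by linarith
    then have "M + N div (p - 1) \<le> l div p + N div (2 * p) + X"
      by (simp only: of_nat_add[symmetric] of_nat_le_iff)
    then show ?thesis by linarith
  qed
  then show ?thesis using V_mono[OF V_mult[OF 1 2]] by blast
qed

text \<open>The sum is the trace of Dwork's operator, so up to sign and truncation the left side is
  its eigenvalue \<open>dfact a R\<close>. This is a reciprocal value of \<open>gam\<close>, which
  the reflection formula converts into \<open>gam r\<close>.\<close>

theorem gross_koblitz:
  assumes a: "a < p - 1" and M: "M > 0" and r: "padic_eq (int M) (of_nat a / (of_nat p - 1)) (of_nat r)"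
    and X: "6 * (M + 3) \<le> X"
  shows "padic_eq (int M) ((of_nat p - 1) * (\<Sum>n\<le>X. (- of_nat p) ^ n * dc (a + (p - 1) * n))) (- of_int (gam r))"
proof -
  define \<alpha> where "\<alpha> = (of_nat a / (of_nat p - 1) :: rat)"
  have ap: "a < p" using a by simp
  have pn: "(of_nat p :: rat) - 1 \<noteq> 0" using punit_p_minus_1 by (simp add: punit_def)
  have \<alpha>: "\<alpha> * (of_nat p - 1) = of_nat a" using pn by (simp add: \<alpha>_def)
  have V\<alpha>: "V 0 \<alpha>" unfolding \<alpha>_def divide_inverse using punit_p_minus_1
    by (intro V_mult_integral V_of_nat) (simp add: punit_def)
  obtain R where "padic_eq (int (3 * M)) (- \<alpha>) (of_nat R)"
    using p_integral_approx_nat[OF V_minus[OF V\<alpha>], of "3 * M"] by blast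
  then have R: "padic_eq (int (3 * M)) \<alpha> (- of_nat R)" using peq_minus by fastforce
  \<comment> \<open>Because \<open>a = (p - 1) * \<alpha>\<close> and \<open>R\<close> is close to
    \<open>- \<alpha>\<close>, this argument is close to \<open>1 - \<alpha>\<close>, the reflection
    of \<open>r\<close>.\<close>
  define s where "s = a + p * R + 1"
  have "padic_eq (int M) (of_nat p * \<alpha>) (of_nat p * (- of_nat R))"
    by (intro peq_mult_left V_of_nat peq_mono[OF R]) simp
  from peq_diff[OF r[folded \<alpha>_def] this]
  have "padic_eq (int M) (- of_nat a) (of_nat r + of_nat (p * R))" using \<alpha> by (simp add: algebra_simps)
  from peq_add[OF peq_refl[of "int M" "of_nat a + 1"] this]
  have "padic_eq (int M) 1 (of_nat (s + r))" by (simp add: s_def algebra_simps)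
  then have "padic_eq (int M) (of_int 1) (of_int (int (s + r)))" by simp
  then have "[int 1 = int (s + r)] (mod int (p ^ M))" unfolding peq_of_int by simp
  then have c: "[s + r = 1] (mod p ^ M)" unfolding cong_int_iff by (rule cong_sym)
  have "\<not> p dvd a + 1" "(a + 1) mod p = a + 1" using a by (auto dest: dvd_imp_le)
  moreover have "s mod p = (a + 1) mod p" "p dvd s \<longleftrightarrow> p dvd a + 1"
  proof -
    have e: "s = (a + 1) + p * R" by (simp add: s_def)
    show "s mod p = (a + 1) mod p" unfolding e by simp
    show "p dvd s \<longleftrightarrow> p dvd a + 1" unfolding e by (rule dvd_add_left_iff) simp
  qed
  ultimately have "refl_sign s = (- 1) ^ Suc a" by (simp add: refl_sign_def)
  then have "padic_eq (int M) (of_int (gam s * gam r)) (of_int ((- 1) ^ Suc a))"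
    using gam_reflection[OF M c] unfolding peq_of_int by simp
  then have "padic_eq (int M) (inverse (of_int (gam s)) * (of_int (gam s * gam r))) (inverse (of_int (gam s)) * of_int ((- 1) ^ Suc a))"
    using punit_gam[of s] by (intro peq_mult_left) (auto simp: punit_def)
  then have "padic_eq (int M) (of_int (gam r)) (dfact a R)"
    using punit_gam[of s] dfact_gam[OF ap, of R] by (simp add: punit_def s_def divide_inverse mult.commute mult.left_commute)
  then have 1: "padic_eq (int M) (dfact a R) (of_int (gam r))" by (rule peq_sym)
  have 2: "padic_eq (int M) (\<Sum>m\<le>X. fr \<alpha> m 0 * psi a m 0) (dfact a R)"
    using X by (intro eigenvalue_sum ap V\<alpha> R) simp
  have "V (int M) (\<Sum>n\<le>X. fr \<alpha> (Suc X) (Suc n) * psi a X n)"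
    by (intro V_sum trace_error V\<alpha> ap X) simp
  then have "V (int M) (of_nat p * (\<Sum>n\<le>X. fr \<alpha> (Suc X) (Suc n) * psi a X n))"
    by (intro V_mult_integral V_of_nat)
  then have "padic_eq (int M) ((1 - of_nat p) * (\<Sum>n\<le>X. psi a n n)) (\<Sum>m\<le>X. fr \<alpha> m 0 * psi a m 0)"
    unfolding trace_formula[OF \<alpha>] by (simp add: padic_eq_def)
  also note 2
  also note 1
  finally have "padic_eq (int M) (- ((1 - of_nat p) * (\<Sum>n\<le>X. psi a n n))) (- of_int (gam r))"
    by (rule peq_minus)
  moreover have "psi a n n = (- of_nat p) ^ n * dc (a + (p - 1) * n)" for n
  proof -
    have "p * n = (p - 1) * n + n" by (metis Suc_diff_1 mult_Suc add.commute p_pos(1))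
    then have e: "int (p * n + a) - int n = int (a + (p - 1) * n)" by simp
    show ?thesis unfolding psi_def e dcz_of_nat by simp
  qed
  ultimately show ?thesis by (simp add: algebra_simps)
qed

section \<open>Evaluating power series at a root of \<open>y\<^sup>p\<^sup>-\<^sup>1 = - p\<close>\<close>

text \<open>If \<open>pi\<close> has valuation \<open>1 / (p - 1)\<close>, every term
  \<open>f $ n * pi^n\<close> has valuation at least \<open>M\<close>; rounding
  \<open>n / (p - 1)\<close> down keeps the bounds integral.\<close>

definition smallc :: "int \<Rightarrow> rat fps \<Rightarrow> bool" where
  "smallc M f \<longleftrightarrow> (\<forall>n. V (M - int (n div (p - 1))) (f $ n))"

text \<open>The rate is that of \<open>V_dc\<close>. The constant \<open>A\<close> absorbs rounding
  losses in products and makes the class a ring, at no cost for convergence.\<close>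

definition growth :: "rat fps \<Rightarrow> bool" where
  "growth f \<longleftrightarrow> (\<exists>A. \<forall>n. V (int (n div (2 * p)) - A - int (n div (p - 1))) (f $ n))"

definition DD :: "rat fps" where
  "DD = fps_const (of_nat p) + fps_X ^ (p - 1)"

text \<open>\<open>feq M f g\<close> expresses that the values of \<open>f\<close> and \<open>g\<close> at a root \<open>\<pi>\<close> of \<open>y\<^sup>p\<^sup>-\<^sup>1 = - p\<close> are
  congruent modulo \<open>p\<^sup>M\<close>, the condition \<open>growth\<close> ensuring convergence at \<open>\<pi>\<close>.\<close>
definition feq :: "int \<Rightarrow> rat fps \<Rightarrow> rat fps \<Rightarrow> bool" where
  "feq M f g \<longleftrightarrow> (\<exists>e h. f - g = e + DD * h \<and> smallc M e \<and> growth e \<and> growth h)"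

text \<open>Series with integral values at the root: multiplication by them preserves
  \<open>feq\<close> without loss of precision.\<close>

definition nice :: "rat fps \<Rightarrow> bool" where
  "nice f \<longleftrightarrow> smallc 0 f \<and> growth f"

lemma div_diff_le: fixes i n d :: nat shows "i \<le> n \<Longrightarrow> i div d + (n - i) div d \<le> n div d"
  using div_add1_eq[of i "n - i" d] by simp

lemma div_diff_ge: fixes i n d :: nat assumes "i \<le> n" shows "n div d \<le> i div d + (n - i) div d + 1"
proof (cases "d = 0")
  case False
  have "i mod d < d" "(n - i) mod d < d" using False by simp_all
  then have "i mod d + (n - i) mod d < d * 2" by linarith
  then have "(i mod d + (n - i) mod d) div d < 2" by (rule less_mult_imp_div_less[of _ 2 d, simplified mult.commute])
  then show ?thesis using div_add1_eq[of i "n - i" d] assms by simp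
qed simp

lemma smallc_0 [simp]: "smallc M 0"
  by (simp add: smallc_def)

lemma smallc_mono: "smallc M f \<Longrightarrow> N \<le> M \<Longrightarrow> smallc N f"
  by (auto simp: smallc_def intro: V_mono)

lemma smallc_add: "smallc M f \<Longrightarrow> smallc M g \<Longrightarrow> smallc M (f + g)"
  by (auto simp: smallc_def intro: V_add)

lemma smallc_uminus: "smallc M f \<Longrightarrow> smallc M (- f)"
  by (simp add: smallc_def)

lemma smallc_mult: assumes "smallc M f" "smallc N g" shows "smallc (M + N) (f * g)"
  unfolding smallc_def fps_mult_nth
proof (intro allI V_sum)
  fix n i :: nat assume "i \<in> {0..n}"
  then have "i div (p - 1) + (n - i) div (p - 1) \<le> n div (p - 1)" by (intro div_diff_le) simp
  moreover have "V ((M - int (i div (p - 1))) + (N - int ((n - i) div (p - 1)))) (f $ i * g $ (n - i))"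
    using assms by (intro V_mult) (simp_all add: smallc_def)
  ultimately show "V (M + N - int (n div (p - 1))) (f $ i * g $ (n - i))"
    by (elim V_mono) linarith
qed

lemma smallc_const: "V M c \<Longrightarrow> smallc M (fps_const c)"
  by (simp add: smallc_def)

lemma smallc_X_power: "smallc (int (i div (p - 1))) (fps_X ^ i)"
  by (simp add: smallc_def)

lemma growth_0 [simp]: "growth 0"
  by (simp add: growth_def)

lemma growth_add: assumes "growth f" "growth g" shows "growth (f + g)"
proof -
  obtain A B where A: "\<And>n. V (int (n div (2 * p)) - A - int (n div (p - 1))) (f $ n)"
    and B: "\<And>n. V (int (n div (2 * p)) - B - int (n div (p - 1))) (g $ n)"
    using assms by (auto simp: growth_def)
  have "V (int (n div (2 * p)) - max A B - int (n div (p - 1))) ((f + g) $ n)" for n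
    unfolding fps_add_nth by (intro V_add V_mono[OF A] V_mono[OF B]) auto
  then show ?thesis unfolding growth_def by blast
qed

lemma growth_uminus: "growth f \<Longrightarrow> growth (- f)"
  by (simp add: growth_def)

lemma growth_mult: assumes "growth f" "growth g" shows "growth (f * g)"
proof -
  obtain A B where A: "\<And>n. V (int (n div (2 * p)) - A - int (n div (p - 1))) (f $ n)"
    and B: "\<And>n. V (int (n div (2 * p)) - B - int (n div (p - 1))) (g $ n)"
    using assms by (auto simp: growth_def)
  have "V (int (n div (2 * p)) - (A + B + 1) - int (n div (p - 1))) ((f * g) $ n)" for n
    unfolding fps_mult_nth
  proof (intro V_sum)
    fix i assume i: "i \<in> {0..n}"
    have "i div (p - 1) + (n - i) div (p - 1) \<le> n div (p - 1)" using i by (intro div_diff_le) simp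
    moreover have "n div (2 * p) \<le> i div (2 * p) + (n - i) div (2 * p) + 1" using i by (intro div_diff_ge) simp
    ultimately show "V (int (n div (2 * p)) - (A + B + 1) - int (n div (p - 1))) (f $ i * g $ (n - i))"
      by (intro V_mono[OF V_mult[OF A[of i] B[of "n - i"]]]) linarith
  qed
  then show ?thesis unfolding growth_def by blast
qed

lemma growth_const: "V k c \<Longrightarrow> growth (fps_const c)"
  unfolding growth_def by (rule exI[of _ "- k"]) simp

lemma growth_X_power: "growth (fps_X ^ i)"
  unfolding growth_def by (rule exI[of _ "int (i div (2 * p))"]) (auto intro: V_mono[OF V_0_1])

lemma nice_0 [simp]: "nice 0"
  by (simp add: nice_def)

lemma nice_add: "nice f \<Longrightarrow> nice g \<Longrightarrow> nice (f + g)"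
  by (auto simp: nice_def intro: smallc_add growth_add)

lemma nice_sum: "(\<And>i. i \<in> I \<Longrightarrow> nice (f i)) \<Longrightarrow> nice (sum f I)"
  by (induction I rule: infinite_finite_induct) (auto intro: nice_add)

lemma nice_mult: "nice f \<Longrightarrow> nice g \<Longrightarrow> nice (f * g)"
  using smallc_mult[of 0 f 0 g] by (auto simp: nice_def intro: growth_mult)

lemma nice_const: "V 0 c \<Longrightarrow> nice (fps_const c)"
  by (auto simp: nice_def intro: smallc_const growth_const)

lemma nice_1 [simp]: "nice 1"
  using nice_const[OF V_0_1] by simp

lemma nice_power: "nice f \<Longrightarrow> nice (f ^ n)"
  by (induction n) (auto intro: nice_mult)

lemma nice_X_power: "nice (fps_X ^ i)"
  using smallc_mono[OF smallc_X_power[of i], of 0] growth_X_power by (simp add: nice_def)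

lemma feqI: "f - g = e + DD * h \<Longrightarrow> smallc M e \<Longrightarrow> growth e \<Longrightarrow> growth h \<Longrightarrow> feq M f g"
  by (auto simp: feq_def)

lemma feq_DD: "f - g = DD * h \<Longrightarrow> growth h \<Longrightarrow> feq M f g"
  by (rule feqI[of f g 0 h]) auto

lemma feq_small: "smallc M (f - g) \<Longrightarrow> growth (f - g) \<Longrightarrow> feq M f g"
  by (rule feqI[of f g "f - g" 0]) auto

lemma feq_refl [simp, intro]: "feq M f f"
  by (rule feq_DD[of _ _ 0]) auto

lemma feq_add: assumes "feq M f g" "feq M f' g'" shows "feq M (f + f') (g + g')"
proof -
  obtain e h e' h' where *: "f - g = e + DD * h" "smallc M e" "growth e" "growth h"
    "f' - g' = e' + DD * h'" "smallc M e'" "growth e'" "growth h'"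
    using assms by (auto simp: feq_def)
  have "f + f' - (g + g') = (f - g) + (f' - g')" by simp
  then have "f + f' - (g + g') = (e + e') + DD * (h + h')"
    unfolding *(1,5) by (simp add: algebra_simps)
  then show ?thesis by (rule feqI) (auto intro: smallc_add growth_add *)
qed

lemma feq_minus: assumes "feq M f g" shows "feq M (- f) (- g)"
proof -
  obtain e h where *: "f - g = e + DD * h" "smallc M e" "growth e" "growth h"
    using assms by (auto simp: feq_def)
  have "- f - (- g) = - (f - g)" by simp
  then have "- f - (- g) = (- e) + DD * (- h)" unfolding * by simp
  then show ?thesis by (rule feqI) (auto intro: smallc_uminus growth_uminus *)
qed

lemma feq_sym: "feq M f g \<Longrightarrow> feq M g f"
  using feq_add[OF feq_minus[of M f g] feq_refl[of M "f + g"]] by simp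

lemma feq_trans [trans]: "feq M f g \<Longrightarrow> feq M g h \<Longrightarrow> feq M f h"
  using feq_add[of M f g "g" h] feq_add[of M "f + g" "g + h" "- g" "- g"] by simp

lemma feq_sum: "(\<And>i. i \<in> I \<Longrightarrow> feq M (f i) (g i)) \<Longrightarrow> feq M (sum f I) (sum g I)"
  by (induction I rule: infinite_finite_induct) (auto intro: feq_add)

lemma feq_mult_left: assumes "feq M f g" "nice k" shows "feq M (k * f) (k * g)"
proof -
  obtain e h where *: "f - g = e + DD * h" "smallc M e" "growth e" "growth h"
    using assms by (auto simp: feq_def)
  have "k * f - k * g = k * (f - g)" by (simp add: algebra_simps)
  then have "k * f - k * g = k * e + DD * (k * h)" unfolding * by (simp add: algebra_simps)
  moreover have "smallc (0 + M) (k * e)" using assms * by (intro smallc_mult) (simp_all add: nice_def)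
  ultimately show ?thesis using assms *
    by (intro feqI[of "k * f" "k * g" "k * e" "k * h"]) (auto intro: growth_mult simp: nice_def)
qed

lemma feq_mult: "feq M f g \<Longrightarrow> feq M f' g' \<Longrightarrow> nice f \<Longrightarrow> nice g' \<Longrightarrow> feq M (f * f') (g * g')"
  using feq_trans[OF feq_mult_left[of M f' g' f], of "g * g'"] feq_mult_left[of M f g g']
  by (simp add: mult.commute)

lemma feq_power: "feq M f g \<Longrightarrow> nice f \<Longrightarrow> nice g \<Longrightarrow> feq M (f ^ n) (g ^ n)"
  by (induction n) (auto intro: feq_mult nice_power)

lemma feq_mono: "feq M f g \<Longrightarrow> N \<le> M \<Longrightarrow> feq N f g"
  unfolding feq_def using smallc_mono by blast

lemma X_power_reduce: "\<exists>h. growth h \<and> fps_X ^ ((p - 1) * k) - fps_const ((- of_nat p) ^ k) = DD * h"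
proof (induction k)
  case (Suc k)
  then obtain h where h: "growth h" "fps_X ^ ((p - 1) * k) - fps_const ((- of_nat p) ^ k) = DD * h" by blast
  have X: "fps_X ^ ((p - 1) * k) = fps_const ((- of_nat p) ^ k) + DD * h"
    using h(2) by (simp add: algebra_simps)
  have c: "fps_const ((- of_nat p :: rat) ^ Suc k) = - (fps_const (of_nat p) * fps_const ((- of_nat p) ^ k))"
    by simp
  have "fps_X ^ ((p - 1) * Suc k) - fps_const ((- of_nat p :: rat) ^ Suc k)
      = fps_X ^ (p - 1) * fps_X ^ ((p - 1) * k) + fps_const (of_nat p) * fps_const ((- of_nat p) ^ k)"
    unfolding c by (simp add: power_add)
  also have "\<dots> = DD * (fps_const ((- of_nat p) ^ k) + fps_X ^ (p - 1) * h)"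
    unfolding X by (simp only: DD_def algebra_simps)
  finally show ?case using h(1) 
    by (intro exI[of _ "fps_const ((- of_nat p) ^ k) + fps_X ^ (p - 1) * h"] conjI growth_add growth_mult growth_X_power
        growth_const[of 0] V_power0) auto
qed (auto intro: exI[of _ 0])

text \<open>The functional \<open>S\<close> takes the coordinate of the value at the root on 1 in
  the basis of powers below \<open>p - 1\<close>. On a multiple of \<open>DD\<close> it telescopes
  to one boundary term, which \<open>growth\<close> makes small.\<close>

lemma feq_const_dest:
  assumes "feq (int M) (fps_const c) (fps_const d)" shows "padic_eq (int M) c d"
proof -
  obtain e h where *: "fps_const c - fps_const d = e + DD * h" "smallc (int M) e" "growth e" "growth h"
    using assms by (auto simp: feq_def)
  obtain A where A: "\<And>n. V (int (n div (2 * p)) - A - int (n div (p - 1))) (h $ n)"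
    using *(4) by (auto simp: growth_def)
  define S where "S f K = (\<Sum>k\<le>K. (- of_nat p) ^ k * f $ ((p - 1) * k))" for f :: "rat fps" and K
  have S_const: "S (fps_const x) K = x" for x K
    using gt2 by (induction K) (auto simp: S_def)
  have S_DD: "S (DD * h) K = - ((- of_nat p) ^ Suc K * h $ ((p - 1) * K))" for K
  proof (induction K)
    case 0
    then show ?case using gt2 by (simp add: S_def DD_def)
  next
    case (Suc K)
    have "(DD * h) $ ((p - 1) * Suc K) = of_nat p * h $ ((p - 1) * Suc K) + h $ ((p - 1) * K)"
      by (simp add: DD_def distrib_right fps_X_power_mult_nth)
    then show ?case using Suc by (simp add: S_def algebra_simps)
  qed
  \<comment> \<open>The surplus at index \<open>(p - 1) * K\<close> is about
    \<open>K * (p - 1) / (2 * p)\<close>, at least \<open>K / 3\<close>; it has to outweigh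
    \<open>M\<close> and the growth constant \<open>A\<close>.\<close>
  define K where "K = 3 * (M + nat \<bar>A\<bar>)"
  have "S (fps_const c - fps_const d) K = S e K + S (DD * h) K"
    unfolding * by (simp add: S_def sum.distrib algebra_simps)
  then have "c - d = S e K + S (DD * h) K"
    unfolding fps_const_sub[of c d, symmetric] by (simp add: S_const fps_const_sub del: S_DD)
  moreover have "V (int M) (S e K)" unfolding S_def
  proof (intro V_sum)
    fix k
    have "V (int k + (int M - int ((p - 1) * k div (p - 1)))) (of_nat p ^ k * e $ ((p - 1) * k))"
      using *(2) unfolding smallc_def by (intro V_mult V_p_power) blast
    moreover have "(p - 1) * k div (p - 1) = k" using gt2 by simp
    ultimately have "V (int M) (of_nat p ^ k * e $ ((p - 1) * k))" by simp
    then show "V (int M) ((- of_nat p) ^ k * e $ ((p - 1) * k))" by (cases "even k") simp_all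
  qed
  moreover have "V (int M) (S (DD * h) K)"
  proof -
    have 1: "V (int (Suc K) + (int ((p - 1) * K div (2 * p)) - A - int ((p - 1) * K div (p - 1)))) (of_nat p ^ Suc K * h $ ((p - 1) * K))"
      by (intro V_mult A V_p_power)
    have "(p - 1) * K div (p - 1) = K" using gt2 by simp
    moreover have "M + nat \<bar>A\<bar> \<le> (p - 1) * K div (2 * p)"
    proof -
      have "(M + nat \<bar>A\<bar>) * (2 * p) \<le> (M + nat \<bar>A\<bar>) * (3 * (p - 1))" using gt2 by (intro mult_le_mono2) linarith
      also have "\<dots> = (p - 1) * K" by (simp add: K_def)
      finally show ?thesis by (simp add: less_eq_div_iff_mult_less_eq)
    qed
    ultimately have "int M \<le> int (Suc K) + (int ((p - 1) * K div (2 * p)) - A - int ((p - 1) * K div (p - 1)))"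
      by linarith
    from V_mono[OF 1 this] show ?thesis unfolding S_DD
      by (cases "even K") (simp_all del: power_Suc)
  qed
  ultimately show ?thesis by (simp add: padic_eq_def V_add)
qed

section \<open>The additive character\<close>

abbreviation EE :: "rat fps" where "EE \<equiv> eb 1 (1 / of_nat p)"

lemma nice_EE: "nice EE"
  unfolding nice_def smallc_def growth_def using V_dc0 V_dc
  by (auto simp: dc_def intro: exI[of _ 0])

lemma exp_compose_unique:
  fixes f B :: "rat fps"
  assumes "fps_deriv f = fps_deriv B * f" "f $ 0 = 1" "B $ 0 = 0"
  shows "f = fps_exp 1 oo B"
proof -
  define e where "e = fps_exp (- 1) oo B"
  have "fps_deriv e = - (fps_deriv B * e)"
    unfolding e_def using assms(3) by (simp add: fps_compose_deriv fps_compose_uminus algebra_simps flip: fps_const_neg)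
  then have "fps_deriv (f * e) = 0" using assms(1) by (simp add: algebra_simps)
  then have "f * e = fps_const ((f * e) $ 0)" by (simp only: fps_deriv_eq_0_iff)
  also have "(f * e) $ 0 = 1" using assms(2) by (simp add: e_def)
  finally have fe: "f * e = 1" by simp
  have "e * (fps_exp 1 oo B) = fps_exp (- 1 + 1) oo B"
    unfolding e_def fps_exp_add_mult using fps_compose_mult_distrib[OF assms(3)] by simp
  then have "e * (fps_exp 1 oo B) = 1" by simp
  then have "f * (e * (fps_exp 1 oo B)) = f" by simp
  then show ?thesis using fe by (simp add: mult.assoc[symmetric])
qed

lemma eb_nth_0 [simp]: "eb a b $ 0 = 1"
  by (simp add: eb_def)

text \<open>The exponent \<open>p y + y^p\<close> is \<open>y\<close> times \<open>DD\<close>; both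
  sides solve the same linear differential equation.\<close>

lemma eb_p_1: "eb (of_nat p) 1 = fps_exp 1 oo (fps_X * DD)"
proof (rule exp_compose_unique)
  have "fps_X * DD = fps_const (of_nat p) * fps_X + fps_X ^ p"
    unfolding DD_def using power_Suc[of "fps_X :: rat fps" "p - 1"] by (simp add: algebra_simps)
  then have "fps_deriv (fps_X * DD) = fps_const (of_nat p) + fps_const (of_nat p) * fps_X ^ (p - 1)"
    by (simp add: fps_deriv_power)
  then show "fps_deriv (eb (of_nat p) 1) = fps_deriv (fps_X * DD) * eb (of_nat p) 1"
    by (simp add: eb_deriv algebra_simps)
qed simp_all

lemma smallc_DD: "smallc 1 DD"
  unfolding smallc_def
proof
  fix n
  have "V 1 (of_nat p)" using V_p_power[of 1] by simp
  moreover have "(p - 1) div (p - 1) = 1" using gt2 by simp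
  ultimately show "V (1 - int (n div (p - 1))) (DD $ n)"
    using gt2 by (cases "n = 0"; cases "n = p - 1") (auto simp: DD_def)
qed

lemma smallc_DD_power: "smallc (int k) (DD ^ k)"
proof (induction k)
  case (Suc k)
  then show ?case using smallc_mult[OF smallc_DD Suc] by simp
qed (simp add: smallc_def)

lemma DD_power_nth: "(p - 1) * k < n \<Longrightarrow> (DD ^ k) $ n = 0"
proof (induction k arbitrary: n)
  case (Suc k)
  have "(DD ^ Suc k) $ n = of_nat p * (DD ^ k) $ n + (fps_X ^ (p - 1) * DD ^ k) $ n"
    by (simp add: DD_def distrib_right)
  moreover have "(DD ^ k) $ n = 0" "(DD ^ k) $ (n - (p - 1)) = 0" using Suc.prems by (auto intro!: Suc.IH)
  ultimately show ?case by (simp add: fps_X_power_mult_nth)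
qed simp

text \<open>In \<open>exp (y * DD) - 1\<close> the factor \<open>DD\<close> can be split off, and
  the cofactor still has the required growth. For \<open>EE\<close> itself the exponent also
  vanishes at the root, but there the powers of \<open>1 / p\<close> spoil the cofactor, and no such
  relation holds.\<close>

lemma eb_p_1_feq: "feq M (eb (of_nat p) 1) 1"
proof -
  \<comment> \<open>For positive \<open>i\<close> this is the \<open>i\<close>-th power of
    \<open>y * DD\<close> divided by \<open>DD\<close>; it starts in degree \<open>i\<close>, so
    every coefficient of the series below is a finite sum.\<close>
  define B where "B i = fps_X ^ i * DD ^ (i - 1)" for i
  have B0: "B i $ n = 0" if "n < i" for i n using that by (simp add: B_def fps_X_power_mult_nth)
  define h where "h = Abs_fps (\<lambda>n. \<Sum>i\<in>{1..Suc n}. B i $ n / fact i)"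
  have h_ext: "h $ n = (\<Sum>i\<in>{1..K}. B i $ n / fact i)" if "n < K" for n K
    unfolding h_def fps_nth_Abs_fps using that by (intro sum.mono_neutral_left) (auto simp: B0)
  have "eb (of_nat p) 1 - 1 = DD * h"
  proof (rule fps_ext)
    fix n
    have "(DD * h) $ n = of_nat p * h $ n + (if n < p - 1 then 0 else h $ (n - (p - 1)))"
      by (simp add: DD_def distrib_right fps_X_power_mult_nth)
    also have "\<dots> = (\<Sum>i\<in>{1..Suc n}. (of_nat p * B i $ n + (if n < p - 1 then 0 else B i $ (n - (p - 1)))) / fact i)"
      using h_ext[of n "Suc n"] h_ext[of "n - (p - 1)" "Suc n"]
      by (auto simp: sum_distrib_left sum.distrib add_divide_distrib simp del: sum.cl_ivl_Suc)
    also have "\<dots> = (\<Sum>i\<in>{1..Suc n}. (DD * B i) $ n / fact i)"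
      by (simp add: DD_def distrib_right fps_X_power_mult_nth)
    also have "\<dots> = (\<Sum>i\<in>{1..Suc n}. ((fps_X * DD) ^ i) $ n / fact i)"
    proof (intro sum.cong refl)
      fix i assume "i \<in> {1..Suc n}"
      then have "DD * B i = (fps_X * DD) ^ i" by (cases i) (simp_all add: B_def power_mult_distrib)
      then show "(DD * B i) $ n / fact i = ((fps_X * DD) ^ i) $ n / fact i" by simp
    qed
    also have "\<dots> = (\<Sum>i\<in>{1..n}. ((fps_X * DD) ^ i) $ n / fact i)"
      by (intro sum.mono_neutral_right) (auto simp: power_mult_distrib fps_X_power_mult_nth le_Suc_eq)
    finally have 1: "(DD * h) $ n = (\<Sum>i\<in>{1..n}. ((fps_X * DD) ^ i) $ n / fact i)" .
    have "eb (of_nat p) 1 $ n = (\<Sum>i = 0..n. ((fps_X * DD) ^ i) $ n / fact i)"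
      by (simp add: eb_p_1 fps_compose_nth)
    also have "\<dots> = (1 :: rat fps) $ n + (\<Sum>i\<in>{1..n}. ((fps_X * DD) ^ i) $ n / fact i)"
      by (subst sum.atLeast_Suc_atMost) simp_all
    finally show "(eb (of_nat p) 1 - 1) $ n = (DD * h) $ n" using 1 by simp
  qed
  moreover have "growth h"
    unfolding growth_def
  proof (intro exI allI)
    fix n
    show "V (int (n div (2 * p)) - 1 - int (n div (p - 1))) (h $ n)"
      unfolding h_def fps_nth_Abs_fps
    proof (intro V_sum)
      fix i assume i: "i \<in> {1..Suc n}"
      show "V (int (n div (2 * p)) - 1 - int (n div (p - 1))) (B i $ n / fact i)"
      proof (cases "B i $ n = 0")
        case False
        have ile: "i \<le> n" using B0[of n i] False by (cases "n < i") auto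
        have "(DD ^ (i - 1)) $ (n - i) \<noteq> 0" using False by (simp add: B_def fps_X_power_mult_nth split: if_splits)
        then have "\<not> (p - 1) * (i - 1) < n - i" using DD_power_nth by blast
        then have "n \<le> i + (p - 1) * (i - 1)" by linarith
        also have "\<dots> \<le> i + (p - 1) * i" by simp
        also have "\<dots> = p * i" by (metis Suc_diff_1 mult_Suc p_pos(1))
        finally have "n \<le> p * i" .
        then have "n div p \<le> i" using div_le_mono[of n "p * i" p] by simp
        moreover have "n div (2 * p) \<le> n div p" by (intro div_le_mono2) auto
        ultimately have le: "n div (2 * p) \<le> i" by linarith
        have "V (int (i div (p - 1)) + int (i - 1) - int (n div (p - 1))) (B i $ n)"
          using smallc_mult[OF smallc_X_power[of i] smallc_DD_power[of "i - 1"]] unfolding B_def smallc_def by blast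
        from V_mult[OF this V_inverse_fact[of i]]
        have "V (int (i - 1) - int (n div (p - 1))) (B i $ n / fact i)" by simp
        then show ?thesis by (rule V_mono) (use le i ile in auto)
      qed simp
    qed
  qed
  ultimately show ?thesis by (rule feq_DD)
qed

section \<open>Teichmueller representatives\<close>

text \<open>An integer that agrees with the Teichmueller lift modulo \<open>p ^ Suc L\<close>, one
  power more than the level; characters thus remain integer-valued.\<close>

definition teich :: "nat \<Rightarrow> int \<Rightarrow> int" where
  "teich L x = x ^ (p ^ L)"

lemma teich_mult: "teich L (x * y) = teich L x * teich L y"
  by (simp add: teich_def power_mult_distrib)

lemma teich_power: "teich L (x ^ k) = teich L x ^ k"
  by (simp add: teich_def power_mult[symmetric] mult.commute)

lemma teich_1 [simp]: "teich L 1 = 1"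
  by (simp add: teich_def)

text \<open>In \<open>x^p - y^p = (x - y) * sum\<close> the \<open>p\<close> summands of the
  cofactor are congruent modulo \<open>p\<close>, so it contributes one more factor
  \<open>p\<close>.\<close>

lemma power_p_cong:
  assumes "[x = y] (mod int p ^ Suc k)" shows "[x ^ p = y ^ p] (mod int p ^ Suc (Suc k))"
proof -
  have xy: "int p ^ Suc k dvd x - y" using assms by (simp add: cong_iff_dvd_diff)
  then have "[x = y] (mod int p)" using dvd_trans[of "int p" "int p ^ Suc k"] by (simp add: cong_iff_dvd_diff)
  then have "[(\<Sum>i<p. y ^ (p - Suc i) * x ^ i) = (\<Sum>i<p. y ^ (p - Suc i) * y ^ i)] (mod int p)"
    by (intro cong_sum cong_mult cong_pow cong_refl)
  also have "(\<Sum>i<p. y ^ (p - Suc i) * y ^ i) = (\<Sum>i<p. y ^ (p - 1))"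
    by (intro sum.cong refl) (simp flip: power_add)
  also have "\<dots> = int p * y ^ (p - 1)" by simp
  also have "[int p * y ^ (p - 1) = 0] (mod int p)" by (simp add: cong_0_iff)
  finally have "int p dvd (\<Sum>i<p. y ^ (p - Suc i) * x ^ i)" by (simp only: cong_0_iff)
  then have "int p ^ Suc k * int p dvd (x - y) * (\<Sum>i<p. y ^ (p - Suc i) * x ^ i)"
    using xy by (rule mult_dvd_mono[rotated])
  also have "(x - y) * (\<Sum>i<p. y ^ (p - Suc i) * x ^ i) = x ^ p - y ^ p"
    by (rule power_diff_sumr2[symmetric])
  finally show ?thesis by (simp add: cong_iff_dvd_diff mult.commute)
qed

lemma teich_cong: "[x = y] (mod int p) \<Longrightarrow> [teich L x = teich L y] (mod int p ^ Suc L)"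
proof (induction L)
  case (Suc L)
  have "teich (Suc L) z = teich L z ^ p" for z by (simp add: teich_def power_mult[symmetric] mult.commute)
  then show ?case using power_p_cong[OF Suc.IH[OF Suc.prems]] by simp
qed (simp add: teich_def)

lemma fermat_int: assumes "\<not> int p dvd x" shows "[x ^ (p - 1) = 1] (mod int p)"
proof -
  define n where "n = nat (x mod int p)"
  have n: "int n = x mod int p" by (simp add: n_def)
  have "\<not> p dvd n"
  proof
    assume "p dvd n"
    then have "int p dvd x mod int p" unfolding n[symmetric] by simp
    then show False using assms by (simp add: dvd_mod_iff)
  qed
  then have "[n ^ (p - 1) = 1] (mod p)" by (rule fermat_theorem[OF prime])
  then have "[int (n ^ (p - 1)) = int 1] (mod int p)" by (simp only: cong_int_iff)
  moreover have "[int n = x] (mod int p)" unfolding n by (simp add: cong_def)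
  then have "[int n ^ (p - 1) = x ^ (p - 1)] (mod int p)" by (rule cong_pow)
  ultimately show ?thesis by (simp add: cong_def)
qed

lemma teich_id: "[teich L x = x] (mod int p)"
proof (induction L)
  case (Suc L)
  have p1: "Suc (p - 1) = p" by simp
  have "[x ^ p = x] (mod int p)"
  proof (cases "int p dvd x")
    case True
    then show ?thesis by (simp add: cong_iff_dvd_diff dvd_power_le dvd_diff dvd_trans[OF True dvd_power[of p x]])
  next
    case False
    from cong_mult[OF cong_refl[of x] fermat_int[OF this]]
    have "[x * x ^ (p - 1) = x] (mod int p)" by simp
    then show ?thesis unfolding power_Suc[symmetric] p1 .
  qed
  moreover have "[teich L x ^ p = x ^ p] (mod int p)" using Suc by (rule cong_pow)
  moreover have "teich (Suc L) x = teich L x ^ p" by (simp add: teich_def power_mult[symmetric] mult.commute)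
  ultimately show ?case using cong_trans by metis
qed (simp add: teich_def)

lemma teich_fermat: "\<not> int p dvd x \<Longrightarrow> [teich L x ^ (p - 1) = 1] (mod int p ^ Suc L)"
  using teich_cong[OF fermat_int, of x L] by (simp add: teich_power)

lemma teich_teich: "L \<le> L' \<Longrightarrow> [teich L' x = teich L x] (mod int p ^ Suc L)"
proof -
  assume "L \<le> L'"
  then have "p ^ L' = p ^ (L' - L) * p ^ L" by (simp flip: power_add)
  then have "teich L' x = teich L (teich (L' - L) x)"
    by (simp add: teich_def power_mult)
  then show ?thesis using teich_cong[OF teich_id] by simp
qed

lemma teich_not_dvd: "\<not> int p dvd x \<Longrightarrow> \<not> int p dvd teich L x"
  using teich_id[of L x] by (simp add: cong_dvd_iff)

lemma teich_pow_cong: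
  assumes "\<not> int p dvd x" "[k = l] (mod p - 1)"
  shows "[teich L x ^ k = teich L x ^ l] (mod int p ^ Suc L)"
proof -
  have *: "[teich L x ^ k = teich L x ^ (k mod (p - 1))] (mod int p ^ Suc L)" for k
  proof -
    have "teich L x ^ k = (teich L x ^ (p - 1)) ^ (k div (p - 1)) * teich L x ^ (k mod (p - 1))"
      by (simp only: power_mult[symmetric] power_add[symmetric] mult_div_mod_eq)
    moreover have "[(teich L x ^ (p - 1)) ^ (k div (p - 1)) * teich L x ^ (k mod (p - 1)) = 1 ^ (k div (p - 1)) * teich L x ^ (k mod (p - 1))] (mod int p ^ Suc L)"
      by (intro cong_mult cong_pow teich_fermat assms cong_refl)
    ultimately show ?thesis by simp
  qed
  show ?thesis using *[of k] *[of l] assms(2) by (metis cong_def)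
qed

section \<open>Orthogonality of the Teichmueller characters\<close>

lemma bij_mult_mod:
  assumes "\<not> p dvd c" shows "bij_betw (\<lambda>x. c * x mod p) {1..<p} {1..<p}"
proof -
  have cop: "coprime c p" using prime_imp_coprime[OF prime assms] by (simp add: coprime_commute)
  have "inj_on (\<lambda>x. c * x mod p) {1..<p}"
  proof (rule inj_onI)
    fix x y assume xy: "x \<in> {1..<p}" "y \<in> {1..<p}" "c * x mod p = c * y mod p"
    then have "[x = y] (mod p)" using cong_mult_lcancel_nat[OF cop, of x y] by (simp add: cong_def)
    then show "x = y" using xy by (simp add: cong_def)
  qed
  moreover have "(\<lambda>x. c * x mod p) ` {1..<p} \<subseteq> {1..<p}"
  proof (rule image_subsetI)
    fix x assume x: "x \<in> {1..<p}"
    then have "\<not> p dvd x" by (auto dest: dvd_imp_le)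
    then have "\<not> p dvd c * x" using assms prime by (simp add: prime_dvd_mult_iff)
    then show "c * x mod p \<in> {1..<p}" by (auto simp: dvd_eq_mod_eq_0 Suc_le_eq)
  qed
  ultimately show ?thesis by (simp add: bij_betw_def endo_inj_surj)
qed

lemma unit_range: "x \<in> {1..<p} \<Longrightarrow> \<not> p dvd x" "x \<in> {1..<p} \<Longrightarrow> \<not> int p dvd int x"
  by (auto dest: dvd_imp_le)

text \<open>Invertibility of this difference, not just its being nonzero, is what allows
  cancellation modulo a prime power; a primitive root is a nontrivial value already modulo
  \<open>p\<close>.\<close>

lemma teich_power_nontrivial:
  assumes "\<not> (p - 1) dvd k"
  shows "\<exists>g. \<not> p dvd g \<and> coprime (int p ^ Suc L) (1 - teich L (int g) ^ k)"
proof -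
  obtain g where g: "residue_primroot p g"
    using prime_primitive_root_exists[of p] prime gt2 by auto
  have ordg: "ord p g = p - 1" using g prime by (simp add: residue_primroot_def totient_prime)
  have g1: "\<not> [g ^ k = 1] (mod p)" using assms ord_divides[of g k p] ordg by simp
  have gp: "\<not> p dvd g"
    using g prime by (auto simp: residue_primroot_def dest: coprime_common_divisor_nat)
  have "\<not> int p dvd 1 - teich L (int g) ^ k"
  proof
    assume "int p dvd 1 - teich L (int g) ^ k"
    then have "[1 = teich L (int g) ^ k] (mod int p)" by (simp add: cong_iff_dvd_diff)
    also have "[teich L (int g) ^ k = int g ^ k] (mod int p)" by (intro cong_pow teich_id)
    finally have "[int 1 = int (g ^ k)] (mod int p)" by simp
    then show False using g1 unfolding cong_int_iff by (simp add: cong_sym)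
  qed
  then have "coprime (int p ^ Suc L) (1 - teich L (int g) ^ k)"
    by (simp add: prime_imp_coprime[OF prime_int] del: power_Suc)
  then show ?thesis using gp by blast
qed

lemma teich_cong_mult: "[teich L (int (c * x mod p)) = teich L (int c) * teich L (int x)] (mod int p ^ Suc L)"
proof -
  have "[int (c * x mod p) = int c * int x] (mod int p)" by (simp add: cong_def zmod_int)
  then show ?thesis using teich_cong by (simp flip: teich_mult)
qed

text \<open>Reindexing by a multiplier \<open>g\<close> with nontrivial character value multiplies
  the sum by that value, which forces it to vanish.\<close>

lemma teich_sum:
  "[(\<Sum>x\<in>{1..<p}. teich L (int x) ^ k) = (if (p - 1) dvd k then int p - 1 else 0)] (mod int p ^ Suc L)"
proof (cases "(p - 1) dvd k")
  case True
  then have "[k = 0] (mod p - 1)" by (simp add: cong_0_iff)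
  then have "[(\<Sum>x\<in>{1..<p}. teich L (int x) ^ k) = (\<Sum>x\<in>{1..<p}. teich L (int x) ^ 0)] (mod int p ^ Suc L)"
    by (intro cong_sum teich_pow_cong) (auto dest: unit_range)
  also have "(\<Sum>x\<in>{1..<p}. teich L (int x) ^ 0) = int p - 1" using gt2 by (simp add: of_nat_diff)
  finally show ?thesis using True by simp
next
  case False
  define S where "S = (\<Sum>x\<in>{1..<p}. teich L (int x) ^ k)"
  obtain g where g: "\<not> p dvd g" "coprime (int p ^ Suc L) (1 - teich L (int g) ^ k)"
    using teich_power_nontrivial[OF False] by blast
  have "S = (\<Sum>x\<in>{1..<p}. teich L (int (g * x mod p)) ^ k)"
    unfolding S_def by (rule sum.reindex_bij_betw[OF bij_mult_mod[OF g(1)], symmetric])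
  also have "[\<dots> = (\<Sum>x\<in>{1..<p}. (teich L (int g) * teich L (int x)) ^ k)] (mod int p ^ Suc L)"
    by (intro cong_sum cong_pow teich_cong_mult)
  also have "(\<Sum>x\<in>{1..<p}. (teich L (int g) * teich L (int x)) ^ k) = teich L (int g) ^ k * S"
    by (simp add: S_def power_mult_distrib sum_distrib_left)
  finally have "int p ^ Suc L dvd S - teich L (int g) ^ k * S" by (simp add: cong_iff_dvd_diff)
  then have "int p ^ Suc L dvd (1 - teich L (int g) ^ k) * S" by (simp add: left_diff_distrib)
  then have "int p ^ Suc L dvd S" using g(2) coprime_dvd_mult_right_iff by blast
  then show ?thesis using False by (simp add: S_def cong_0_iff)
qed

section \<open>Evaluation of Gauss sums\<close>

lemma eb_nth: "eb a b $ n = (\<Sum>i = 0..n. (if p dvd i then b ^ (i div p) / fact (i div p) else 0) * (a ^ (n - i) / fact (n - i)))"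
proof -
  have "eb a b = (fps_exp b oo fps_X ^ p) * fps_exp a" by (simp add: eb_def mult.commute)
  then show ?thesis by (simp add: fps_mult_nth compose_X_power_nth if_distrib[of "\<lambda>x. x * _"] cong: if_cong)
qed

text \<open>Substitution of \<open>t * y\<close> for \<open>y\<close>.\<close>

lemma eb_scale: "eb (t * a) (t ^ p * b) $ n = t ^ n * eb a b $ n"
  unfolding eb_nth sum_distrib_left
proof (intro sum.cong refl)
  fix i assume i: "i \<in> {0..n}"
  show "(if p dvd i then (t ^ p * b) ^ (i div p) / fact (i div p) else 0) * ((t * a) ^ (n - i) / fact (n - i)) =
      t ^ n * ((if p dvd i then b ^ (i div p) / fact (i div p) else 0) * (a ^ (n - i) / fact (n - i)))"
  proof (cases "p dvd i")
    case True
    have "t ^ n = t ^ i * t ^ (n - i)" using i by (simp flip: power_add)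
    also have "t ^ i = (t ^ p) ^ (i div p)" using True by (simp flip: power_mult)
    finally show ?thesis using True by (simp add: power_mult_distrib)
  qed simp
qed

text \<open>At the root \<open>y^p\<close> has valuation above 1, which outweighs the inverse
  factorials, so the factor \<open>p ^ L\<close> is gained in full.\<close>

lemma eb_0_small: "feq (int L) (eb 0 (of_nat (p ^ L * v))) 1"
proof (rule feq_small)
  define f where "f = eb 0 (of_nat (p ^ L * v)) - 1"
  have V: "V (int L * int j - int (j div (p - 1))) (f $ (p * j)) \<and> (j = 0 \<longrightarrow> f $ (p * j) = 0)" for j
  proof (cases "j = 0")
    case False
    have "f $ (p * j) = of_nat p ^ (L * j) * (of_nat (v ^ j)) * (1 / fact j)"
      using False by (simp add: f_def eb_0_nth power_mult_distrib power_mult)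
    moreover have "V (int (L * j) + 0 + - int (j div (p - 1))) (of_nat p ^ (L * j) * (of_nat (v ^ j)) * (1 / fact j))"
      by (intro V_mult V_inverse_fact V_p_power V_of_nat)
    ultimately show ?thesis using False by simp
  qed (simp add: f_def)
  have nd: "f $ n = 0" if "\<not> p dvd n" for n using that by (cases "n = 0") (auto simp: f_def eb_0_nth)
  have pj: "p * j div (p - 1) = j + j div (p - 1)" for j
  proof -
    have "p * j = j + j * (p - 1)" by (metis Suc_diff_1 mult_Suc mult.commute p_pos(1))
    then show ?thesis using gt2 by simp
  qed
  show "smallc (int L) f" unfolding smallc_def
  proof
    fix n
    show "V (int L - int (n div (p - 1))) (f $ n)"
    proof (cases "p dvd n")
      case True
      then obtain j where j: "n = p * j" by auto
      show ?thesis
      proof (cases "j = 0")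
        case False
        then have "int L \<le> int L * int j + int j" by (cases j) (simp_all add: algebra_simps)
        then show ?thesis using V[of j] unfolding j pj by (auto elim!: V_mono)
      qed (use V[of j] j in simp)
    qed (simp add: nd)
  qed
  show "growth f" unfolding growth_def
  proof (intro exI allI)
    fix n
    show "V (int (n div (2 * p)) - 0 - int (n div (p - 1))) (f $ n)"
    proof (cases "p dvd n")
      case True
      then obtain j where j: "n = p * j" by auto
      have "n div (2 * p) = j div 2" unfolding j by (simp add: mult.commute)
      moreover have "j div 2 \<le> j" by simp
      ultimately have "int (n div (2 * p)) - int j \<le> int L * int j"
        by (metis diff_left_mono diff_self mult_nonneg_nonneg of_nat_0_le_iff of_nat_mono order_trans diff_right_mono)
      then show ?thesis using V[of j] unfolding j pj by (auto elim!: V_mono)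
    qed (simp add: nd)
  qed
qed

lemma EE_power_p: "feq M (EE ^ p) 1"
  using eb_p_1_feq by (simp add: eb_power)

lemma EE_power_mod: "feq M (EE ^ n) (EE ^ (n mod p))"
proof -
  have "EE ^ n = EE ^ (n mod p) * (EE ^ p) ^ (n div p)"
    by (simp flip: power_mult power_add)
  moreover have "feq M (EE ^ (n mod p) * (EE ^ p) ^ (n div p)) (EE ^ (n mod p) * 1 ^ (n div p))"
    by (intro feq_mult_left feq_power EE_power_p nice_power nice_EE nice_1)
  ultimately show ?thesis by simp
qed

text \<open>The right side is \<open>EE\<close> at \<open>T * y\<close>. Writing
  \<open>T = x + p * w\<close> and \<open>T^p = T + p ^ Suc L * v\<close> factors it as
  \<open>EE ^ x\<close>, a power of \<open>exp (p y + y^p)\<close>, and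
  \<open>exp (p ^ L * v * y^p)\<close>; the last two are nearly 1.\<close>

lemma EE_power_teich:
  assumes "x \<in> {1..<p}"
  shows "feq (int L) (EE ^ x) (Abs_fps (\<lambda>n. dc n * of_int (teich L (int x) ^ n)))"
proof -
  define T where "T = x ^ (p ^ L)"
  have T: "int T = teich L (int x)" by (simp add: T_def teich_def)
  have "x \<le> T" using assms unfolding T_def by (intro self_le_power) auto
  have "[int T = int x] (mod int p)" using teich_id[of L "int x"] T by simp
  then have "[x = T] (mod p)" by (simp add: cong_int_iff cong_sym)
  then have "p dvd T - x" using \<open>x \<le> T\<close> cong_altdef_nat[of x T p] by (simp add: cong_sym_eq)
  then obtain w where "T - x = p * w" ..
  then have w: "T = x + p * w" using \<open>x \<le> T\<close> by simp
  have "[int T ^ p = int T] (mod int p ^ Suc L)"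
    using teich_teich[of L "Suc L" "int x"] unfolding T by (simp add: teich_def power_mult[symmetric] mult.commute)
  then have "[int (T ^ p) = int T] (mod int (p ^ Suc L))" by simp
  then have c: "[T ^ p = T] (mod p ^ Suc L)" unfolding cong_int_iff .
  have le: "T \<le> T ^ p" using assms by (intro self_le_power) (auto simp: T_def)
  then have "p ^ Suc L dvd T ^ p - T" using c cong_altdef_nat[of T "T ^ p" "p ^ Suc L"] by simp
  then obtain v where "T ^ p - T = p ^ Suc L * v" ..
  then have v: "T ^ p = T + p ^ Suc L * v" using le by simp
  have "eb (of_nat T * 1) (of_nat T ^ p * (1 / of_nat p)) = EE ^ x * (eb (of_nat p) 1 ^ w * eb 0 (of_nat (p ^ L * v)))"
  proof -
    have "of_nat T ^ p = (of_nat x + of_nat p * of_nat w + of_nat p * (of_nat p ^ L * of_nat v) :: rat)"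
      using arg_cong[OF v, of "of_nat :: nat \<Rightarrow> rat"] arg_cong[OF w, of "of_nat :: nat \<Rightarrow> rat"] by simp
    then have "of_nat T ^ p * (1 / of_nat p) = (of_nat x * (1 / of_nat p) + (of_nat w * 1 + of_nat (p ^ L * v)) :: rat)"
      by (simp add: field_simps)
    moreover have "of_nat T * 1 = (of_nat x * 1 + (of_nat w * of_nat p + 0) :: rat)" by (simp add: w)
    ultimately show ?thesis by (simp only: eb_power eb_mult)
  qed
  moreover have "Abs_fps (\<lambda>n. dc n * of_int (teich L (int x) ^ n)) = eb (of_nat T * 1) (of_nat T ^ p * (1 / of_nat p))"
    by (rule fps_ext) (simp only: eb_scale fps_nth_Abs_fps, simp add: dc_def T[symmetric])
  ultimately have e: "Abs_fps (\<lambda>n. dc n * of_int (teich L (int x) ^ n)) = EE ^ x * (eb (of_nat p) 1 ^ w * eb 0 (of_nat (p ^ L * v)))"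
    by simp
  have np: "nice (eb (of_nat p) 1)" using nice_power[OF nice_EE, of p] by (simp add: eb_power)
  have "feq (int L) (eb (of_nat p) 1 ^ w * eb 0 (of_nat (p ^ L * v))) (1 ^ w * 1)"
    by (intro feq_mult feq_power eb_p_1_feq eb_0_small nice_power np nice_1)
  then have "feq (int L) (EE ^ x * (eb (of_nat p) 1 ^ w * eb 0 (of_nat (p ^ L * v)))) (EE ^ x * (1 ^ w * 1))"
    by (rule feq_mult_left) (intro nice_power nice_EE)
  then show ?thesis unfolding e by (simp add: feq_sym)
qed

text \<open>The Gauss sum of the inverse Teichmueller character to the power \<open>a\<close>; the
  exponent \<open>p - 1 - a\<close> stands for \<open>- a\<close>.\<close>

definition gauss_series :: "nat \<Rightarrow> nat \<Rightarrow> rat fps" where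
  "gauss_series L a = (\<Sum>x\<in>{1..<p}. fps_const (of_int (teich L (int x) ^ (p - 1 - a))) * EE ^ x)"

lemma nice_gauss_series: "nice (gauss_series L a)"
  unfolding gauss_series_def by (intro nice_sum nice_mult nice_const nice_power nice_EE V_of_int)

text \<open>Summing the expansions of \<open>EE ^ x\<close> over \<open>x\<close> keeps the degrees
  congruent to \<open>a\<close> modulo \<open>p - 1\<close>. These reduce to \<open>y^a\<close>
  times the sum evaluated by \<open>gross_koblitz\<close>.\<close>

lemma gauss_series_eval:
  assumes a: "a < p - 1" and M: "M > 0" and L: "M \<le> L"
    and r: "padic_eq (int M) (of_nat a / (of_nat p - 1)) (of_nat r)"
  shows "feq (int M) (gauss_series L a) (fps_const (- of_int (gam r)) * fps_X ^ a)"
proof -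
  define q where "q = p - 1"
  have q: "q > 0" "a < q" using gt2 a by (simp_all add: q_def)
  \<comment> \<open>The first summand makes the tail beyond degree \<open>a + q * K\<close> vanish
    modulo \<open>p ^ M\<close>, the second meets the threshold of
    \<open>gross_koblitz\<close>.\<close>
  define K where "K = 2 * p * M + 6 * (M + 3)"
  define c where "c k = (of_nat p - 1) * dc (a + q * k)" for k
  define S where "S = Abs_fps (\<lambda>n. if q dvd (q - a + n) then (of_nat p - 1) * dc n else 0)"
  define tail where "tail = Abs_fps (\<lambda>n. if q dvd (q - a + n) \<and> a + q * K < n then (of_nat p - 1) * dc n else 0)"
  have dvd_iff: "q dvd (q - a + n) \<longleftrightarrow> (\<exists>k. n = a + q * k)" for n
  proof
    assume "q dvd (q - a + n)"
    then obtain k where k: "q - a + n = q * k" by auto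
    then have "k \<noteq> 0" using q by (cases k) auto
    then obtain k' where "k = Suc k'" by (cases k) auto
    then have "n = a + q * k'" using k q by simp
    then show "\<exists>k. n = a + q * k" by blast
  next
    assume "\<exists>k. n = a + q * k"
    then obtain k where "n = a + q * k" by blast
    then have "q - a + n = q * Suc k" using q by simp
    then show "q dvd (q - a + n)" by (metis dvd_triv_left)
  qed
  have "feq (int M) (gauss_series L a) (\<Sum>x\<in>{1..<p}. fps_const (of_int (teich L (int x) ^ (q - a))) * Abs_fps (\<lambda>n. dc n * of_int (teich L (int x) ^ n)))"
    (is "feq _ _ ?F")
    unfolding gauss_series_def q_def
  proof (intro feq_sum feq_mult_left nice_const V_of_int)
    fix x assume "x \<in> {1..<p}"
    from feq_mono[OF EE_power_teich[OF this, of L]]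
    show "feq (int M) (EE ^ x) (Abs_fps (\<lambda>n. dc n * of_int (teich L (int x) ^ n)))" using L by simp
  qed
  also have "feq (int M) ?F S"
  proof -
    have F: "?F $ n = dc n * of_int (\<Sum>x\<in>{1..<p}. teich L (int x) ^ (q - a + n))" for n
      by (simp add: fps_sum_nth sum_distrib_left power_add algebra_simps)
    have "\<forall>n. \<exists>z. (?F - S) $ n = dc n * of_int (int p ^ Suc L * z)"
    proof
      fix n
      have "[(\<Sum>x\<in>{1..<p}. teich L (int x) ^ (q - a + n)) = (if q dvd (q - a + n) then int p - 1 else 0)] (mod int p ^ Suc L)"
        using teich_sum[of L "q - a + n"] by (simp add: q_def)
      then obtain z where "(\<Sum>x\<in>{1..<p}. teich L (int x) ^ (q - a + n)) - (if q dvd (q - a + n) then int p - 1 else 0) = int p ^ Suc L * z"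
        by (metis cong_iff_dvd_diff dvdE)
      then have "dc n * of_int ((\<Sum>x\<in>{1..<p}. teich L (int x) ^ (q - a + n)) - (if q dvd (q - a + n) then int p - 1 else 0)) = dc n * of_int (int p ^ Suc L * z)"
        by simp
      moreover have "dc n * of_int ((\<Sum>x\<in>{1..<p}. teich L (int x) ^ (q - a + n)) - (if q dvd (q - a + n) then int p - 1 else 0)) = (?F - S) $ n"
        unfolding fps_sub_nth F S_def fps_nth_Abs_fps by (simp add: algebra_simps)
      ultimately show "\<exists>z. (?F - S) $ n = dc n * of_int (int p ^ Suc L * z)" by (intro exI[of _ z]) (rule trans[OF sym])
    qed
    from choice[OF this] obtain z where "\<forall>n. (?F - S) $ n = dc n * of_int (int p ^ Suc L * z n)" by (rule exE)
    then have z: "(?F - S) $ n = dc n * of_int (int p ^ Suc L * z n)" for n by (rule spec)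
    have pz: "V (int (Suc L)) (of_int (int p ^ Suc L * z n))" for n
      unfolding V_of_int_iff by simp
    have "smallc (int M) (?F - S)" unfolding smallc_def z
      using L by (intro allI V_mono[OF V_mult[OF V_dc0 pz]]) simp
    moreover have "growth (?F - S)" unfolding growth_def z
      by (intro exI[of _ 0] allI V_mono[OF V_mult[OF V_dc pz]]) simp
    ultimately show ?thesis by (rule feq_small)
  qed
  \<comment> \<open>The reduction by \<open>y^(p-1) = - p\<close> acts on single powers, so the
    series is cut into finitely many terms and a negligible tail.\<close>
  also have "S = (\<Sum>k\<le>K. fps_const (c k) * fps_X ^ (a + q * k)) + tail"
  proof (rule fps_ext)
    fix n
    show "S $ n = ((\<Sum>k\<le>K. fps_const (c k) * fps_X ^ (a + q * k)) + tail) $ n"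
    proof (cases "q dvd (q - a + n)")
      case True
      then obtain k where k: "n = a + q * k" using dvd_iff by blast
      have "(\<Sum>k\<le>K. fps_const (c k) * fps_X ^ (a + q * k)) $ n = (\<Sum>k'\<le>K. if k' = k then c k' else 0)"
        unfolding fps_sum_nth using q by (intro sum.cong) (auto simp: k)
      also have "\<dots> = (if k \<le> K then c k else 0)" by simp
      finally show ?thesis using True q by (auto simp: S_def tail_def k c_def)
    next
      case False
      then have "(\<Sum>k\<le>K. fps_const (c k) * fps_X ^ (a + q * k)) $ n = 0"
        unfolding fps_sum_nth using dvd_iff[of n] by (intro sum.neutral) auto
      then show ?thesis using False by (simp add: S_def tail_def)
    qed
  qed
  also have "feq (int M) \<dots> ((\<Sum>k\<le>K. fps_const (c k * (- of_nat p) ^ k) * fps_X ^ a) + 0)"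
  proof (intro feq_add feq_sum)
    fix k
    obtain h where h: "growth h" "fps_X ^ (q * k) - fps_const ((- of_nat p) ^ k) = DD * h"
      using X_power_reduce[of k] by (auto simp: q_def)
    have "fps_const (c k) * fps_X ^ (a + q * k) - fps_const (c k * (- of_nat p) ^ k) * fps_X ^ a
        = fps_const (c k) * fps_X ^ a * (fps_X ^ (q * k) - fps_const ((- of_nat p) ^ k))"
      unfolding fps_const_mult[symmetric] power_add by (simp only: algebra_simps)
    also have "\<dots> = DD * (fps_const (c k) * fps_X ^ a * h)" unfolding h by (simp only: algebra_simps)
    finally show "feq (int M) (fps_const (c k) * fps_X ^ (a + q * k)) (fps_const (c k * (- of_nat p) ^ k) * fps_X ^ a)"
    proof (rule feq_DD)
      have "V (- int ((a + q * k) div (p - 1))) (c k)"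
        unfolding c_def using punit_p_minus_1 by (intro V_mult_integral V_dc0) (simp add: punit_def)
      then show "growth (fps_const (c k) * fps_X ^ a * h)"
        by (intro growth_mult growth_X_power h growth_const)
    qed
  next
    have V0: "V 0 (of_nat p - 1)" using punit_p_minus_1 by (simp add: punit_def)
    show "feq (int M) tail 0"
    proof (rule feq_small)
      show "smallc (int M) (tail - 0)" unfolding smallc_def
      proof
        fix n
        show "V (int M - int (n div (p - 1))) ((tail - 0) $ n)"
        proof (cases "a + q * K < n")
          case True
          have "2 * p * M \<le> K" by (simp add: K_def)
          also have "K \<le> q * K" using q by simp
          also have "q * K \<le> n" using True by simp
          finally have "M \<le> n div (2 * p)" using gt2 by (simp add: less_eq_div_iff_mult_less_eq mult.commute)
          then have "V (int M - int (n div (p - 1))) ((of_nat p - 1) * dc n)"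
            using V_mult[OF V0 V_dc[of n]] by (auto elim!: V_mono)
          then show ?thesis by (simp add: tail_def)
        qed (simp add: tail_def)
      qed
      show "growth (tail - 0)" unfolding growth_def
        using V_mult[OF V0 V_dc] by (intro exI[of _ 0]) (simp add: tail_def)
    qed
  qed
  also have "(\<Sum>k\<le>K. fps_const (c k * (- of_nat p) ^ k) * fps_X ^ a) + 0
     = fps_const ((of_nat p - 1) * (\<Sum>n\<le>K. (- of_nat p) ^ n * dc (a + (p - 1) * n))) * fps_X ^ a"
  proof -
    have "(\<Sum>k\<le>K. fps_const (c k * (- of_nat p) ^ k)) = fps_const (\<Sum>k\<le>K. c k * (- of_nat p) ^ k)"
      by (induction K) simp_all
    moreover have "(\<Sum>k\<le>K. c k * (- of_nat p) ^ k) = (of_nat p - 1) * (\<Sum>n\<le>K. (- of_nat p) ^ n * dc (a + (p - 1) * n))"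
      by (simp add: c_def q_def sum_distrib_left algebra_simps)
    ultimately show ?thesis by (simp add: sum_distrib_right[symmetric])
  qed
  also have "feq (int M) \<dots> (fps_const (- of_int (gam r)) * fps_X ^ a)"
  proof (rule feq_small)
    define d where "d = (of_nat p - 1) * (\<Sum>n\<le>K. (- of_nat p) ^ n * dc (a + (p - 1) * n)) - (- of_int (gam r))"
    have "V (int M) d" using gross_koblitz[OF a M r, of K] by (simp add: padic_eq_def d_def K_def)
    moreover have e: "fps_const ((of_nat p - 1) * (\<Sum>n\<le>K. (- of_nat p) ^ n * dc (a + (p - 1) * n))) * fps_X ^ a -
         fps_const (- of_int (gam r)) * fps_X ^ a = fps_const d * fps_X ^ a"
      unfolding d_def by (simp only: fps_const_sub[symmetric] left_diff_distrib)
    ultimately show "smallc (int M) (fps_const ((of_nat p - 1) * (\<Sum>n\<le>K. (- of_nat p) ^ n * dc (a + (p - 1) * n))) * fps_X ^ a -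
         fps_const (- of_int (gam r)) * fps_X ^ a)"
      using smallc_mult[OF smallc_const[of "int M" d] smallc_mono[OF smallc_X_power[of a], of 0]] by simp
    show "growth (fps_const ((of_nat p - 1) * (\<Sum>n\<le>K. (- of_nat p) ^ n * dc (a + (p - 1) * n))) * fps_X ^ a -
         fps_const (- of_int (gam r)) * fps_X ^ a)"
      unfolding e using \<open>V (int M) d\<close> by (intro growth_mult growth_const growth_X_power)
  qed
  finally show ?thesis .
qed

section \<open>Jacobi sums in four variables\<close>

abbreviation units4 :: "(nat \<times> nat \<times> nat \<times> nat) set" where
  "units4 \<equiv> {1..<p} \<times> {1..<p} \<times> {1..<p} \<times> {1..<p}"

fun sum4 :: "nat \<times> nat \<times> nat \<times> nat \<Rightarrow> nat" where
  "sum4 (y1, y2, y3, y4) = y1 + y2 + y3 + y4"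

fun char4 :: "nat \<Rightarrow> nat \<times> nat \<times> nat \<times> nat \<Rightarrow> nat \<times> nat \<times> nat \<times> nat \<Rightarrow> int" where
  "char4 L (a1, a2, a3, a4) (y1, y2, y3, y4) = teich L (int y1) ^ (p - 1 - a1) * (teich L (int y2) ^ (p - 1 - a2)
     * (teich L (int y3) ^ (p - 1 - a3) * teich L (int y4) ^ (p - 1 - a4)))"

fun scale4 :: "nat \<Rightarrow> nat \<times> nat \<times> nat \<times> nat \<Rightarrow> nat \<times> nat \<times> nat \<times> nat" where
  "scale4 s (y1, y2, y3, y4) = (s * y1 mod p, s * y2 mod p, s * y3 mod p, s * y4 mod p)"

text \<open>For \<open>s = 1\<close> the Jacobi sum, for \<open>s = 0\<close> its degenerate
  companion; both are needed when the product of the characters is trivial.\<close>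

definition charsum :: "nat \<Rightarrow> nat \<times> nat \<times> nat \<times> nat \<Rightarrow> nat \<Rightarrow> int" where
  "charsum L a s = (\<Sum>y\<in>units4. if sum4 y mod p = s then char4 L a y else 0)"

lemma sum_times_sum:
  fixes f :: "'a \<Rightarrow> 'c :: semiring_0"
  shows "sum f A * sum g B = (\<Sum>z\<in>A \<times> B. f (fst z) * g (snd z))"
  by (simp add: sum_product sum.cartesian_product case_prod_unfold)

lemma fps_const_sum: "fps_const (sum f A) = (\<Sum>x\<in>A. fps_const (f x))"
  by (induction A rule: infinite_finite_induct) (simp_all flip: fps_const_add)

lemma bij_scale4:
  assumes "\<not> p dvd s" shows "bij_betw (scale4 s) units4 units4"
proof -
  have inj: "inj_on (\<lambda>x. s * x mod p) {1..<p}" and im: "\<And>x. x \<in> {1..<p} \<Longrightarrow> s * x mod p \<in> {1..<p}"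
    using bij_mult_mod[OF assms] by (auto simp: bij_betw_def)
  have "inj_on (scale4 s) units4"
  proof (rule inj_onI)
    fix y z assume yz: "y \<in> units4" "z \<in> units4" "scale4 s y = scale4 s z"
    obtain y1 y2 y3 y4 z1 z2 z3 z4 where e: "y = (y1, y2, y3, y4)" "z = (z1, z2, z3, z4)"
      by (cases y, cases z)
    have "y1 = z1" using yz by (rule_tac inj_onD[OF inj]) (simp_all add: e)
    moreover have "y2 = z2" using yz by (rule_tac inj_onD[OF inj]) (simp_all add: e)
    moreover have "y3 = z3" using yz by (rule_tac inj_onD[OF inj]) (simp_all add: e)
    moreover have "y4 = z4" using yz by (rule_tac inj_onD[OF inj]) (simp_all add: e)
    ultimately show "y = z" by (simp add: e)
  qed
  moreover have "scale4 s ` units4 \<subseteq> units4" using im by auto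
  ultimately show ?thesis by (simp add: bij_betw_def endo_inj_surj)
qed

lemma sum4_scale4: "[sum4 (scale4 s y) = s * sum4 y] (mod p)"
proof -
  obtain y1 y2 y3 y4 where y: "y = (y1, y2, y3, y4)" by (cases y)
  have "[s * x mod p = s * x] (mod p)" for x by (simp add: cong_def)
  then show ?thesis unfolding y scale4.simps sum4.simps distrib_left by (intro cong_add)
qed

lemma char4_scale4:
  "[char4 L (a1, a2, a3, a4) (scale4 s y) = teich L (int s) ^ ((p - 1 - a1) + (p - 1 - a2) + (p - 1 - a3) + (p - 1 - a4)) * char4 L (a1, a2, a3, a4) y] (mod int p ^ Suc L)"
proof -
  obtain y1 y2 y3 y4 where y: "y = (y1, y2, y3, y4)" by (cases y)
  have "[char4 L (a1, a2, a3, a4) (scale4 s y) = (teich L (int s) * teich L (int y1)) ^ (p - 1 - a1) * ((teich L (int s) * teich L (int y2)) ^ (p - 1 - a2)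
     * ((teich L (int s) * teich L (int y3)) ^ (p - 1 - a3) * (teich L (int s) * teich L (int y4)) ^ (p - 1 - a4)))] (mod int p ^ Suc L)"
    unfolding y scale4.simps char4.simps by (intro cong_mult cong_pow teich_cong_mult)
  also have "(teich L (int s) * teich L (int y1)) ^ (p - 1 - a1) * ((teich L (int s) * teich L (int y2)) ^ (p - 1 - a2)
     * ((teich L (int s) * teich L (int y3)) ^ (p - 1 - a3) * (teich L (int s) * teich L (int y4)) ^ (p - 1 - a4)))
     = teich L (int s) ^ ((p - 1 - a1) + (p - 1 - a2) + (p - 1 - a3) + (p - 1 - a4)) * char4 L (a1, a2, a3, a4) y"
    unfolding y char4.simps power_add power_mult_distrib by (simp only: ac_simps)
  finally show ?thesis .
qed

text \<open>Multiplying all coordinates by \<open>s\<close> scales their sum and multiplies the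
  characters by a value of the product character.\<close>

lemma charsum_scale:
  assumes s: "\<not> p dvd s" and a: "a1 < p - 1" "a2 < p - 1" "a3 < p - 1" "a4 < p - 1"
  shows "[charsum L (a1, a2, a3, a4) (s * t mod p)
       = teich L (int s) ^ (p - 1 - (a1 + a2 + a3 + a4) mod (p - 1)) * charsum L (a1, a2, a3, a4) (t mod p)] (mod int p ^ Suc L)"
proof -
  define w where "w = char4 L (a1, a2, a3, a4)"
  define e where "e = (p - 1 - a1) + (p - 1 - a2) + (p - 1 - a3) + (p - 1 - a4)"
  have cop: "coprime s p" using prime_imp_coprime[OF prime s] by (simp add: coprime_commute)
  have iff: "sum4 (scale4 s y) mod p = s * t mod p \<longleftrightarrow> sum4 y mod p = t mod p" for y
    using sum4_scale4[of s y] cong_mult_lcancel_nat[OF cop, of "sum4 y" t] by (simp add: cong_def)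
  have "charsum L (a1, a2, a3, a4) (s * t mod p) = (\<Sum>y\<in>units4. if sum4 (scale4 s y) mod p = s * t mod p then w (scale4 s y) else 0)"
    unfolding charsum_def w_def by (rule sum.reindex_bij_betw[OF bij_scale4[OF s], symmetric])
  then have 1: "charsum L (a1, a2, a3, a4) (s * t mod p) = (\<Sum>y\<in>units4. if sum4 y mod p = t mod p then w (scale4 s y) else 0)"
    unfolding iff .
  have 2: "[(\<Sum>y\<in>units4. if sum4 y mod p = t mod p then w (scale4 s y) else 0)
      = (\<Sum>y\<in>units4. teich L (int s) ^ e * (if sum4 y mod p = t mod p then w y else 0))] (mod int p ^ Suc L)"
  proof (rule cong_sum)
    fix y
    have "[w (scale4 s y) = teich L (int s) ^ e * w y] (mod int p ^ Suc L)"
      unfolding w_def e_def by (rule char4_scale4)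
    then show "[(if sum4 y mod p = t mod p then w (scale4 s y) else 0) = teich L (int s) ^ e * (if sum4 y mod p = t mod p then w y else 0)] (mod int p ^ Suc L)"
      by (cases "sum4 y mod p = t mod p") (simp_all del: power_Suc)
  qed
  have 3: "(\<Sum>y\<in>units4. teich L (int s) ^ e * (if sum4 y mod p = t mod p then w y else 0)) = teich L (int s) ^ e * charsum L (a1, a2, a3, a4) (t mod p)"
    unfolding charsum_def w_def sum_distrib_left ..
  have 4: "[teich L (int s) ^ e * charsum L (a1, a2, a3, a4) (t mod p) = teich L (int s) ^ (p - 1 - (a1 + a2 + a3 + a4) mod (p - 1)) * charsum L (a1, a2, a3, a4) (t mod p)] (mod int p ^ Suc L)"
  proof (intro cong_mult cong_refl teich_pow_cong)
    show "\<not> int p dvd int s" using s by simp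
    define q where "q = p - 1"
    have q: "q > 0" using gt2 by (simp add: q_def)
    have 1: "e + (a1 + a2 + a3 + a4) = 4 * q" using a by (simp add: e_def q_def)
    have "q - n mod q + n = q * (1 + n div q)" for n
    proof -
      define r d where "r = n mod q" and "d = n div q"
      have n: "n = q * d + r" by (simp add: r_def d_def)
      have "r < q" using q by (simp add: r_def)
      then show ?thesis unfolding r_def[symmetric] d_def[symmetric] by (subst n) simp
    qed
    from this[of "a1 + a2 + a3 + a4"]
    have "[e + (a1 + a2 + a3 + a4) = q - (a1 + a2 + a3 + a4) mod q + (a1 + a2 + a3 + a4)] (mod q)"
      unfolding 1 by (simp add: cong_def)
    then have "[e = q - (a1 + a2 + a3 + a4) mod q] (mod q)" by (simp only: cong_add_rcancel_nat)
    then show "[e = p - 1 - (a1 + a2 + a3 + a4) mod (p - 1)] (mod p - 1)" by (simp add: q_def)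
  qed
  show ?thesis unfolding 1 by (rule cong_trans[OF 2 4[folded 3]])
qed

lemma prod_gauss_series:
  "gauss_series L a1 * (gauss_series L a2 * (gauss_series L a3 * gauss_series L a4))
   = (\<Sum>y\<in>units4. fps_const (of_int (char4 L (a1, a2, a3, a4) y)) * EE ^ sum4 y)"
  unfolding gauss_series_def sum_times_sum
proof (intro sum.cong refl)
  fix y assume "y \<in> units4"
  obtain y1 y2 y3 y4 where y: "y = (y1, y2, y3, y4)" by (cases y)
  show "fps_const (of_int (teich L (int (fst y)) ^ (p - 1 - a1))) * EE ^ fst y *
    (fps_const (of_int (teich L (int (fst (snd y))) ^ (p - 1 - a2))) * EE ^ fst (snd y) *
      (fps_const (of_int (teich L (int (fst (snd (snd y)))) ^ (p - 1 - a3))) * EE ^ fst (snd (snd y)) *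
        (fps_const (of_int (teich L (int (snd (snd (snd y)))) ^ (p - 1 - a4))) * EE ^ snd (snd (snd y)))))
    = fps_const (of_int (char4 L (a1, a2, a3, a4) y)) * EE ^ sum4 y"
    unfolding y fst_conv snd_conv char4.simps sum4.simps of_int_mult fps_const_mult[symmetric] power_add
    by (simp only: ac_simps)
qed

text \<open>Groups the product by the sum of the four arguments modulo \<open>p\<close>. By
  \<open>charsum_scale\<close> the nonzero sums assemble into one Gauss sum, of the product
  character.\<close>

lemma prod_gauss_series_feq:
  assumes a: "a1 < p - 1" "a2 < p - 1" "a3 < p - 1" "a4 < p - 1" and M: "M \<le> int (Suc L)"
  shows "feq M (gauss_series L a1 * (gauss_series L a2 * (gauss_series L a3 * gauss_series L a4)))
    (fps_const (of_int (charsum L (a1, a2, a3, a4) 0))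
     + fps_const (of_int (charsum L (a1, a2, a3, a4) 1)) * gauss_series L ((a1 + a2 + a3 + a4) mod (p - 1)))"
proof -
  define A where "A = charsum L (a1, a2, a3, a4)"
  define c where "c = (a1 + a2 + a3 + a4) mod (p - 1)"
  have "feq M (gauss_series L a1 * (gauss_series L a2 * (gauss_series L a3 * gauss_series L a4)))
     (\<Sum>y\<in>units4. fps_const (of_int (char4 L (a1, a2, a3, a4) y)) * EE ^ (sum4 y mod p))"
    unfolding prod_gauss_series by (intro feq_sum feq_mult_left EE_power_mod nice_const V_of_int)
  also have "(\<Sum>y\<in>units4. fps_const (of_int (char4 L (a1, a2, a3, a4) y)) * EE ^ (sum4 y mod p))
     = (\<Sum>s<p. fps_const (of_int (A s)) * EE ^ s)"
  proof -
    have "(\<Sum>s<p. fps_const (of_int (A s)) * EE ^ s)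
        = (\<Sum>s<p. \<Sum>y\<in>units4. if sum4 y mod p = s then fps_const (of_int (char4 L (a1, a2, a3, a4) y)) * EE ^ s else 0)"
    proof (intro sum.cong refl)
      fix s
      have A: "fps_const (of_int (A s)) = (\<Sum>y\<in>units4. fps_const (of_int (if sum4 y mod p = s then char4 L (a1, a2, a3, a4) y else 0)))"
        unfolding A_def charsum_def of_int_sum fps_const_sum ..
      show "fps_const (of_int (A s)) * EE ^ s = (\<Sum>y\<in>units4. if sum4 y mod p = s then fps_const (of_int (char4 L (a1, a2, a3, a4) y)) * EE ^ s else 0)"
        unfolding A sum_distrib_right by (rule sum.cong) simp_all
    qed
    also have "\<dots> = (\<Sum>y\<in>units4. \<Sum>s<p. if sum4 y mod p = s then fps_const (of_int (char4 L (a1, a2, a3, a4) y)) * EE ^ s else 0)"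
      by (rule sum.swap)
    also have "\<dots> = (\<Sum>y\<in>units4. fps_const (of_int (char4 L (a1, a2, a3, a4) y)) * EE ^ (sum4 y mod p))"
      by (intro sum.cong refl) simp
    finally show ?thesis by simp
  qed
  also have "(\<Sum>s<p. fps_const (of_int (A s)) * EE ^ s) = fps_const (of_int (A 0)) + (\<Sum>s\<in>{1..<p}. fps_const (of_int (A s)) * EE ^ s)"
  proof -
    have "{..<p} = insert 0 {1..<p}" by auto
    then show ?thesis by simp
  qed
  also have "feq M \<dots> (fps_const (of_int (A 0)) + (\<Sum>s\<in>{1..<p}. fps_const (of_int (A 1)) * (fps_const (of_int (teich L (int s) ^ (p - 1 - c))) * EE ^ s)))"
  proof (intro feq_add feq_refl feq_sum)
    fix s assume s: "s \<in> {1..<p}"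
    define d where "d = (of_int (A s - teich L (int s) ^ (p - 1 - c) * A 1) :: rat)"
    have "int p ^ Suc L dvd A s - teich L (int s) ^ (p - 1 - c) * A 1"
      using charsum_scale[OF unit_range(1)[OF s] a, of L 1] s by (simp add: A_def c_def cong_iff_dvd_diff)
    then have "V (int (Suc L)) d" unfolding d_def V_of_int_iff .
    then have d: "V M d" using M by (rule V_mono)
    have e: "fps_const (of_int (A s)) * EE ^ s - fps_const (of_int (A 1)) * (fps_const (of_int (teich L (int s) ^ (p - 1 - c))) * EE ^ s) = fps_const d * EE ^ s"
      unfolding d_def of_int_diff of_int_mult fps_const_sub[symmetric] fps_const_mult[symmetric] by (simp only: algebra_simps)
    have n: "nice (EE ^ s)" by (intro nice_power nice_EE)
    show "feq M (fps_const (of_int (A s)) * EE ^ s) (fps_const (of_int (A 1)) * (fps_const (of_int (teich L (int s) ^ (p - 1 - c))) * EE ^ s))"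
      using smallc_mult[OF smallc_const[OF d], of 0 "EE ^ s"] growth_mult[OF growth_const[OF d], of "EE ^ s"] n
      by (intro feq_small) (simp_all only: e nice_def add_0_right)
  qed
  also have "(\<Sum>s\<in>{1..<p}. fps_const (of_int (A 1)) * (fps_const (of_int (teich L (int s) ^ (p - 1 - c))) * EE ^ s)) = fps_const (of_int (A 1)) * gauss_series L c"
    unfolding gauss_series_def sum_distrib_left ..
  finally show ?thesis unfolding A_def c_def .
qed

text \<open>Each carry of the index sum over \<open>p - 1\<close> turns a factor
  \<open>y^(p-1)\<close> into \<open>- p\<close>; this is where the exponent \<open>e\<close> comes
  from.\<close>

lemma charsum_gamma_feq:
  assumes a: "a1 < p - 1" "a2 < p - 1" "a3 < p - 1" "a4 < p - 1" and M: "M > 0" and L: "M \<le> L"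
    and r1: "padic_eq (int M) (of_nat a1 / (of_nat p - 1)) (of_nat r1)"
    and r2: "padic_eq (int M) (of_nat a2 / (of_nat p - 1)) (of_nat r2)"
    and r3: "padic_eq (int M) (of_nat a3 / (of_nat p - 1)) (of_nat r3)"
    and r4: "padic_eq (int M) (of_nat a4 / (of_nat p - 1)) (of_nat r4)"
    and c: "c = (a1 + a2 + a3 + a4) mod (p - 1)" and e: "e = (a1 + a2 + a3 + a4) div (p - 1)"
    and rc: "padic_eq (int M) (of_nat c / (of_nat p - 1)) (of_nat rc)"
  shows "feq (int M) (fps_const (of_int ((- int p) ^ e * (gam r1 * gam r2 * gam r3 * gam r4))) * fps_X ^ c)
    (fps_const (of_int (charsum L (a1, a2, a3, a4) 0)) + fps_const (of_int (- (charsum L (a1, a2, a3, a4) 1 * gam rc))) * fps_X ^ c)"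
proof -
  define A where "A = charsum L (a1, a2, a3, a4)"
  define g where "g r = fps_const (- of_int (gam r) :: rat)" for r
  have cq: "c < p - 1" unfolding c using gt2 by simp
  have ng: "nice (g r * fps_X ^ i)" for r i
    unfolding g_def by (intro nice_mult nice_const nice_X_power V_minus V_of_int)
  note gse = gauss_series_eval[OF _ M L, folded g_def]
  obtain h where h: "growth h" "fps_X ^ ((p - 1) * e) - fps_const ((- of_nat p) ^ e) = DD * h"
    using X_power_reduce by blast
  define P where "P = (of_int (gam r1 * gam r2 * gam r3 * gam r4) :: rat)"
  have gP: "g r1 * (g r2 * (g r3 * g r4)) = fps_const P" by (simp add: g_def P_def mult.assoc)
  have "a1 + a2 + a3 + a4 = (p - 1) * e + c" by (simp add: c e)
  then have Xs: "fps_X ^ a1 * (fps_X ^ a2 * (fps_X ^ a3 * fps_X ^ a4)) = fps_X ^ ((p - 1) * e) * (fps_X ^ c :: rat fps)"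
    by (simp flip: power_add add: add.assoc)
  have "feq (int M) (fps_const P * fps_X ^ c * fps_const ((- of_nat p) ^ e)) (fps_const P * fps_X ^ c * fps_X ^ ((p - 1) * e))"
    by (intro feq_mult_left feq_sym[OF feq_DD[OF h(2,1)]] nice_mult nice_const nice_X_power) (simp add: P_def del: of_int_mult)
  also have "fps_const P * fps_X ^ c * fps_X ^ ((p - 1) * e) = (g r1 * fps_X ^ a1) * ((g r2 * fps_X ^ a2) * ((g r3 * fps_X ^ a3) * (g r4 * fps_X ^ a4)))"
  proof -
    have "(g r1 * fps_X ^ a1) * ((g r2 * fps_X ^ a2) * ((g r3 * fps_X ^ a3) * (g r4 * fps_X ^ a4)))
       = (g r1 * (g r2 * (g r3 * g r4))) * (fps_X ^ a1 * (fps_X ^ a2 * (fps_X ^ a3 * fps_X ^ a4)))"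
      by (simp only: ac_simps)
    then show ?thesis unfolding gP Xs by (simp only: ac_simps)
  qed
  also have "feq (int M) \<dots> (gauss_series L a1 * (gauss_series L a2 * (gauss_series L a3 * gauss_series L a4)))"
    by (intro feq_mult feq_sym[OF gse] r1 r2 r3 r4 a ng nice_mult nice_gauss_series)
  also have "feq (int M) \<dots> (fps_const (of_int (A 0)) + fps_const (of_int (A 1)) * gauss_series L c)"
    unfolding A_def c using L by (intro prod_gauss_series_feq a) simp
  also have "feq (int M) \<dots> (fps_const (of_int (A 0)) + fps_const (of_int (A 1)) * (g rc * fps_X ^ c))"
    by (intro feq_add feq_refl feq_mult_left gse cq rc nice_const V_of_int)
  finally have "feq (int M) (fps_const P * fps_X ^ c * fps_const ((- of_nat p) ^ e))
    (fps_const (of_int (A 0)) + fps_const (of_int (A 1)) * (g rc * fps_X ^ c))" .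
  moreover have "fps_const P * fps_X ^ c * fps_const ((- of_nat p) ^ e)
      = fps_const (of_int ((- int p) ^ e * (gam r1 * gam r2 * gam r3 * gam r4))) * fps_X ^ c"
  proof -
    have "of_int ((- int p) ^ e * (gam r1 * gam r2 * gam r3 * gam r4)) = (- of_nat p) ^ e * P"
      unfolding P_def by simp
    then show ?thesis by (simp only: fps_const_mult[symmetric] ac_simps)
  qed
  moreover have "fps_const (of_int (A 1)) * (g rc * fps_X ^ c) = fps_const (of_int (- (A 1 * gam rc))) * fps_X ^ c"
    by (simp add: g_def mult.assoc[symmetric])
  ultimately show ?thesis unfolding A_def by (simp only:)
qed

text \<open>A nontrivial product character makes the sum for \<open>s = 0\<close> vanish by scaling,
  which leaves a single unknown.\<close>

theorem charsum_nontrivial: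
  assumes a: "a1 < p - 1" "a2 < p - 1" "a3 < p - 1" "a4 < p - 1" and L: "Suc M \<le> L"
    and r1: "padic_eq (int (Suc M)) (of_nat a1 / (of_nat p - 1)) (of_nat r1)"
    and r2: "padic_eq (int (Suc M)) (of_nat a2 / (of_nat p - 1)) (of_nat r2)"
    and r3: "padic_eq (int (Suc M)) (of_nat a3 / (of_nat p - 1)) (of_nat r3)"
    and r4: "padic_eq (int (Suc M)) (of_nat a4 / (of_nat p - 1)) (of_nat r4)"
    and c: "c = (a1 + a2 + a3 + a4) mod (p - 1)" and e: "e = (a1 + a2 + a3 + a4) div (p - 1)"
    and rc: "padic_eq (int (Suc M)) (of_nat c / (of_nat p - 1)) (of_nat rc)"
    and c0: "c \<noteq> 0"
  shows "padic_eq (int M) (of_int ((- int p) ^ e * (gam r1 * gam r2 * gam r3 * gam r4)))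
     (of_int (- (charsum L (a1, a2, a3, a4) 1 * gam rc)))"
proof -
  define A where "A = charsum L (a1, a2, a3, a4)"
  define P where "P = (of_int ((- int p) ^ e * (gam r1 * gam r2 * gam r3 * gam r4)) :: rat)"
  define Q where "Q = (of_int (- (A 1 * gam rc)) :: rat)"
  have cq: "c < p - 1" unfolding c using gt2 by simp
  have "\<not> (p - 1) dvd (p - 1 - c)" using c0 cq by (auto dest: dvd_imp_le)
  then obtain g where g: "\<not> p dvd g" "coprime (int p ^ Suc L) (1 - teich L (int g) ^ (p - 1 - c))"
    using teich_power_nontrivial by blast
  have "[A 0 = teich L (int g) ^ (p - 1 - c) * A 0] (mod int p ^ Suc L)"
    using charsum_scale[OF g(1) a, of L 0] by (simp add: A_def c)
  then have "int p ^ Suc L dvd (1 - teich L (int g) ^ (p - 1 - c)) * A 0"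
    by (simp add: cong_iff_dvd_diff left_diff_distrib)
  then have "int p ^ Suc L dvd A 0" using g(2) coprime_dvd_mult_right_iff by blast
  then have "V (int (Suc L)) (of_int (A 0))" unfolding V_of_int_iff .
  then have A0: "V (int (Suc M)) (of_int (A 0))" by (rule V_mono) (use L in simp)
  have "feq (int (Suc M)) (fps_const P * fps_X ^ c) (fps_const (of_int (A 0)) + fps_const Q * fps_X ^ c)"
    unfolding P_def Q_def A_def using L by (intro charsum_gamma_feq a r1 r2 r3 r4 c e rc) simp_all
  also have "feq (int (Suc M)) (fps_const (of_int (A 0)) + fps_const Q * fps_X ^ c) (0 + fps_const Q * fps_X ^ c)"
    using smallc_const[OF A0] growth_const[OF A0] by (intro feq_add feq_refl feq_small) simp_all
  \<comment> \<open>The extra power of \<open>y\<close> turns both sides into multiples of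
    \<open>y^(p-1)\<close>, hence into constants, which \<open>feq_const_dest\<close> compares. The
    factor \<open>- p\<close> is divided out afterwards; therefore the precision is
    \<open>Suc M\<close>.\<close>
  finally have "feq (int (Suc M)) (fps_X ^ (p - 1 - c) * (fps_const P * fps_X ^ c)) (fps_X ^ (p - 1 - c) * (fps_const Q * fps_X ^ c))"
    by (intro feq_mult_left nice_X_power) simp
  moreover have "fps_X ^ (p - 1 - c) * (fps_const x * fps_X ^ c) = fps_const x * fps_X ^ (p - 1)" for x :: rat
  proof -
    have "fps_X ^ (p - 1 - c) * (fps_const x * fps_X ^ c) = fps_const x * (fps_X ^ (p - 1 - c) * fps_X ^ c)"
      by (simp only: ac_simps)
    also have "fps_X ^ (p - 1 - c) * fps_X ^ c = (fps_X ^ (p - 1) :: rat fps)"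
      unfolding power_add[symmetric] using cq by simp
    finally show ?thesis .
  qed
  ultimately have 1: "feq (int (Suc M)) (fps_const P * fps_X ^ (p - 1)) (fps_const Q * fps_X ^ (p - 1))" by (simp only:)
  obtain h where h: "growth h" "fps_X ^ (p - 1) - fps_const (- of_nat p) = DD * h"
    using X_power_reduce[of 1] by auto
  have 2: "feq (int (Suc M)) (fps_const x * fps_X ^ (p - 1)) (fps_const (x * - of_nat p))" if "V 0 x" for x
    unfolding fps_const_mult[symmetric] by (intro feq_mult_left feq_DD[OF h(2,1)] nice_const that)
  have "feq (int (Suc M)) (fps_const (P * - of_nat p)) (fps_const (Q * - of_nat p))"
    using feq_trans[OF feq_sym[OF 2] feq_trans[OF 1 2]] unfolding P_def Q_def by (simp only: V_of_int)
  then have "padic_eq (int (Suc M)) (P * - of_nat p) (Q * - of_nat p)" by (rule feq_const_dest)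
  moreover have "P * - of_nat p - Q * - of_nat p = of_nat p * (Q - P)" by (simp add: algebra_simps)
  ultimately have "V (int M + 1) (of_nat p * (Q - P))" by (simp add: padic_eq_def add.commute)
  then have "padic_eq (int M) Q P" unfolding V_p_mult_iff padic_eq_def .
  then show ?thesis unfolding P_def Q_def A_def by (rule peq_sym)
qed

text \<open>With \<open>c = 0\<close> the Gauss sum of the product character is \<open>- 1\<close>,
  so only the difference of the two sums is obtained; \<open>charsum_total\<close> supplies the
  second relation.\<close>

theorem charsum_trivial:
  assumes a: "a1 < p - 1" "a2 < p - 1" "a3 < p - 1" "a4 < p - 1" and M: "M > 0" and L: "M \<le> L"
    and r1: "padic_eq (int M) (of_nat a1 / (of_nat p - 1)) (of_nat r1)"
    and r2: "padic_eq (int M) (of_nat a2 / (of_nat p - 1)) (of_nat r2)"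
    and r3: "padic_eq (int M) (of_nat a3 / (of_nat p - 1)) (of_nat r3)"
    and r4: "padic_eq (int M) (of_nat a4 / (of_nat p - 1)) (of_nat r4)"
    and e: "a1 + a2 + a3 + a4 = e * (p - 1)"
  shows "padic_eq (int M) (of_int ((- int p) ^ e * (gam r1 * gam r2 * gam r3 * gam r4)))
     (of_int (charsum L (a1, a2, a3, a4) 0 - charsum L (a1, a2, a3, a4) 1))"
proof -
  have 1: "0 = (a1 + a2 + a3 + a4) mod (p - 1)" "e = (a1 + a2 + a3 + a4) div (p - 1)"
    unfolding e using gt2 by simp_all
  have "feq (int M) (fps_const (of_int ((- int p) ^ e * (gam r1 * gam r2 * gam r3 * gam r4))) * fps_X ^ 0)
    (fps_const (of_int (charsum L (a1, a2, a3, a4) 0)) + fps_const (of_int (- (charsum L (a1, a2, a3, a4) 1 * gam 0))) * fps_X ^ 0)"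
    by (rule charsum_gamma_feq[OF a M L r1 r2 r3 r4 1]) simp
  also have "(fps_const (of_int (charsum L (a1, a2, a3, a4) 0)) + fps_const (of_int (- (charsum L (a1, a2, a3, a4) 1 * gam 0))) * fps_X ^ 0)
     = fps_const (of_int (charsum L (a1, a2, a3, a4) 0 - charsum L (a1, a2, a3, a4) 1))" by simp
  finally show ?thesis by (intro feq_const_dest) simp
qed

text \<open>Adding over all \<open>s\<close> removes the condition on the sum, and the product of
  four full character sums remains; by scaling all nonzero \<open>s\<close> contribute
  equally.\<close>

lemma charsum_total:
  assumes a: "a1 < p - 1" "a2 < p - 1" "a3 < p - 1" "a4 < p - 1" and e: "a1 + a2 + a3 + a4 = e * (p - 1)"
  shows "[charsum L (a1, a2, a3, a4) 0 + (int p - 1) * charsum L (a1, a2, a3, a4) 1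
     = (if a1 = 0 then int p - 1 else 0) * ((if a2 = 0 then int p - 1 else 0) * ((if a3 = 0 then int p - 1 else 0) * (if a4 = 0 then int p - 1 else 0)))] (mod int p ^ Suc L)"
proof -
  define A where "A = charsum L (a1, a2, a3, a4)"
  have c: "(a1 + a2 + a3 + a4) mod (p - 1) = 0" unfolding e by simp
  have As: "[A s = A 1] (mod int p ^ Suc L)" if "s \<in> {1..<p}" for s
  proof -
    have "[A s = teich L (int s) ^ (p - 1) * A 1] (mod int p ^ Suc L)"
      using charsum_scale[OF unit_range(1)[OF that] a, of L 1, unfolded c] that by (simp add: A_def)
    also have "[teich L (int s) ^ (p - 1) * A 1 = 1 * A 1] (mod int p ^ Suc L)"
      by (intro cong_mult cong_refl teich_fermat unit_range that)
    finally show ?thesis by simp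
  qed
  have "(\<Sum>s<p. A s) = (\<Sum>y\<in>units4. \<Sum>s<p. if sum4 y mod p = s then char4 L (a1, a2, a3, a4) y else 0)"
    unfolding A_def charsum_def by (rule sum.swap)
  also have "\<dots> = (\<Sum>y\<in>units4. char4 L (a1, a2, a3, a4) y)" by (intro sum.cong refl) simp
  also have "\<dots> = (\<Sum>x\<in>{1..<p}. teich L (int x) ^ (p - 1 - a1)) * ((\<Sum>x\<in>{1..<p}. teich L (int x) ^ (p - 1 - a2))
     * ((\<Sum>x\<in>{1..<p}. teich L (int x) ^ (p - 1 - a3)) * (\<Sum>x\<in>{1..<p}. teich L (int x) ^ (p - 1 - a4))))"
    unfolding sum_times_sum by (intro sum.cong refl) (auto simp: case_prod_unfold)
  also have "[\<dots> = (if a1 = 0 then int p - 1 else 0) * ((if a2 = 0 then int p - 1 else 0) * ((if a3 = 0 then int p - 1 else 0) * (if a4 = 0 then int p - 1 else 0)))] (mod int p ^ Suc L)"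
  proof (intro cong_mult)
    have iff: "(p - 1) dvd (p - 1 - b) \<longleftrightarrow> b = 0" if "b < p - 1" for b using that by (auto dest: dvd_imp_le)
    have *: "[(\<Sum>x\<in>{1..<p}. teich L (int x) ^ (p - 1 - b)) = (if b = 0 then int p - 1 else 0)] (mod int p ^ Suc L)" if "b < p - 1" for b
      using teich_sum[of L "p - 1 - b"] unfolding iff[OF that] .
    show "[(\<Sum>x\<in>{1..<p}. teich L (int x) ^ (p - 1 - a1)) = (if a1 = 0 then int p - 1 else 0)] (mod int p ^ Suc L)" by (rule *[OF a(1)])
    show "[(\<Sum>x\<in>{1..<p}. teich L (int x) ^ (p - 1 - a2)) = (if a2 = 0 then int p - 1 else 0)] (mod int p ^ Suc L)" by (rule *[OF a(2)])
    show "[(\<Sum>x\<in>{1..<p}. teich L (int x) ^ (p - 1 - a3)) = (if a3 = 0 then int p - 1 else 0)] (mod int p ^ Suc L)" by (rule *[OF a(3)])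
    show "[(\<Sum>x\<in>{1..<p}. teich L (int x) ^ (p - 1 - a4)) = (if a4 = 0 then int p - 1 else 0)] (mod int p ^ Suc L)" by (rule *[OF a(4)])
  qed
  finally have 1: "[(\<Sum>s<p. A s) = (if a1 = 0 then int p - 1 else 0) * ((if a2 = 0 then int p - 1 else 0) * ((if a3 = 0 then int p - 1 else 0) * (if a4 = 0 then int p - 1 else 0)))] (mod int p ^ Suc L)" .
  have "{..<p} = insert 0 {1..<p}" by auto
  then have "(\<Sum>s<p. A s) = A 0 + (\<Sum>s\<in>{1..<p}. A s)" by simp
  also have "[\<dots> = A 0 + (\<Sum>s\<in>{1..<p}. A 1)] (mod int p ^ Suc L)"
    by (intro cong_add cong_refl cong_sum As)
  also have "(\<Sum>s\<in>{1..<p}. A 1) = (int p - 1) * A 1" using gt2 by (simp add: of_nat_diff)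
  finally show ?thesis using cong_trans[OF cong_sym 1] unfolding A_def by blast
qed

section \<open>Functional equations of Morita's function\<close>

lemma gamma_p_approx_0 [simp]: "gamma_p_approx p m 0 = 1"
proof -
  have "padic_residue p m 0 = 0"
    unfolding padic_residue_def
  proof (rule the_equality)
    fix r assume "r < p ^ m \<and> [fst (quotient_of 0) = snd (quotient_of 0) * int r] (mod int (p ^ m))"
    then have "[int 0 = int r] (mod int (p ^ m))" "r < p ^ m" by simp_all
    then have "[0 = r] (mod p ^ m)" by (simp only: cong_int_iff)
    then show "r = 0" using \<open>r < p ^ m\<close> by (simp add: cong_def)
  qed simp
  then show ?thesis by (simp add: gamma_p_approx_def)
qed

text \<open>In lowest terms a p-integral number has denominator prime to \<open>p\<close>, so the
  congruence in the definition has exactly one solution in the range.\<close>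

lemma padic_residue_spec:
  assumes "V 0 x" shows "padic_eq (int m) x (of_nat (padic_residue p m x))"
proof -
  define a b where "a = fst (quotient_of x)" and "b = snd (quotient_of x)"
  have q: "quotient_of x = (a, b)" by (simp add: a_def b_def)
  have b0: "b > 0" using quotient_of_denom_pos[OF q] .
  have x: "x = of_int a / of_int b" using quotient_of_div[OF q] .
  have cop: "coprime a b" using quotient_of_coprime[OF q] .
  have nb: "\<not> int p dvd b"
  proof
    assume pb: "int p dvd b"
    obtain c d where cd: "\<not> int p dvd d" "x = of_int c / of_int d"
      using assms by (auto simp: V_0_iff p_integral_def)
    have "d \<noteq> 0" using cd by auto
    have "of_int (a * d) = (of_int (c * b) :: rat)" using x cd(2) b0 \<open>d \<noteq> 0\<close> by (simp add: field_simps)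
    then have "a * d = c * b" by (simp only: of_int_eq_iff)
    then have "int p dvd a * d" using pb by simp
    then have "int p dvd a" using cd(1) prime_dvd_mult_iff[OF prime_int] by blast
    then have "is_unit (int p)" using pb cop by (rule coprime_common_divisor[rotated])
    then show False using gt2 by simp
  qed
  define P where "P r \<longleftrightarrow> r < p ^ m \<and> [a = b * int r] (mod int (p ^ m))" for r
  have copm: "coprime b (int (p ^ m))"
    using prime_imp_coprime[OF prime_int nb] by (simp add: coprime_commute)
  obtain r where r: "padic_eq (int m) x (of_nat r)" using p_integral_approx_nat[OF assms] by blast
  have Pr: "P (r mod p ^ m)" unfolding P_def
  proof
    have "padic_eq (int m) (of_int b * x) (of_int b * of_nat r)" by (intro peq_mult_left r V_of_int)
    then have "padic_eq (int m) (of_int a) (of_int (b * int r))" using b0 by (simp add: x)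
    then have "[a = b * int r] (mod int (p ^ m))" unfolding peq_of_int by simp
    also have "[b * int r = b * int (r mod p ^ m)] (mod int (p ^ m))"
      by (intro cong_mult cong_refl) (simp add: cong_def zmod_int)
    finally show "[a = b * int (r mod p ^ m)] (mod int (p ^ m))" .
  qed simp
  have "P (padic_residue p m x)"
    unfolding padic_residue_def a_def[symmetric] b_def[symmetric] P_def[symmetric]
  proof (rule theI[of P, OF Pr])
    fix s assume "P s"
    with Pr have "[b * int s = b * int (r mod p ^ m)] (mod int (p ^ m))" "s < p ^ m"
      unfolding P_def by (auto simp: cong_def)
    then have "[int s = int (r mod p ^ m)] (mod int (p ^ m))" using cong_mult_lcancel[OF copm] by blast
    then have "[s = r mod p ^ m] (mod p ^ m)" by (simp only: cong_int_iff)
    then show "s = r mod p ^ m" using \<open>s < p ^ m\<close> by (simp add: cong_def)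
  qed
  then have "padic_eq (int m) (of_int a) (of_int (b * int (padic_residue p m x)))"
    unfolding P_def peq_of_int by simp
  then have "padic_eq (int m) (of_int b * x) (of_int b * of_nat (padic_residue p m x))"
    using b0 by (simp add: x)
  then show ?thesis by (rule peq_cancel_left) (rule punit_of_int[OF nb])
qed

lemma gamma_p_approx_gam:
  assumes "V 0 x" "0 < m" "padic_eq (int m) x (of_nat r)"
  shows "padic_eq (int m) (gamma_p_approx p m x) (of_int (gam r))"
proof -
  have "padic_eq (int m) (of_int (int (padic_residue p m x))) (of_int (int r))"
    using peq_trans[OF peq_sym[OF padic_residue_spec[OF assms(1)]] assms(3)] by simp
  then have "[int (padic_residue p m x) = int r] (mod int (p ^ m))" unfolding peq_of_int by simp
  then have "[padic_residue p m x = r] (mod p ^ m)" by (simp only: cong_int_iff)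
  then have "[gam (padic_residue p m x) = gam r] (mod int p ^ m)" by (rule gam_cong[OF assms(2)])
  then show ?thesis unfolding gamma_p_approx_def peq_of_int .
qed

lemma punit_gamma_p_approx [simp]: "punit (gamma_p_approx p m x)"
  by (simp add: gamma_p_approx_def)

lemma V_p_minus_1: "V 0 (of_nat c / (of_nat p - 1))"
  using punit_p_minus_1 unfolding divide_inverse by (intro V_mult_integral V_of_nat) (simp add: punit_def)

text \<open>Modulo \<open>p\<close> the number \<open>c / (p - 1)\<close> is \<open>- c\<close>, so
  its residue is \<open>p - c\<close>, and \<open>p\<close> odd gives the sign.\<close>

lemma gamma_p_approx_reflection:
  assumes "0 < c" "c < p - 1" "0 < m"
  shows "padic_eq (int m) (gamma_p_approx p m (of_nat c / (of_nat p - 1)) * gamma_p_approx p m (of_nat (p - 1 - c) / (of_nat p - 1))) (- ((- 1) ^ c))"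
proof -
  define x y where "x = (of_nat c / (of_nat p - 1) :: rat)" and "y = (of_nat (p - 1 - c) / (of_nat p - 1) :: rat)"
  define r s where "r = padic_residue p m x" and "s = padic_residue p m y"
  have V: "V 0 x" "V 0 y" unfolding x_def y_def by (rule V_p_minus_1)+
  have pn: "(of_nat p :: rat) - 1 \<noteq> 0" using punit_p_minus_1 by (simp add: punit_def)
  have "of_nat (p - 1 - c) = (of_nat p - 1 - of_nat c :: rat)" using assms by (simp add: of_nat_diff)
  then have xy: "x + y = 1" using pn by (simp add: x_def y_def add_divide_distrib[symmetric])
  have r: "padic_eq (int m) x (of_nat r)" and s: "padic_eq (int m) y (of_nat s)"
    unfolding r_def s_def by (intro padic_residue_spec V)+
  from peq_add[OF r s] have "padic_eq (int m) (of_int 1) (of_int (int (r + s)))" unfolding xy by simp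
  then have "[int (r + s) = int 1] (mod int (p ^ m))" unfolding peq_of_int by (simp add: cong_sym_eq)
  then have "[r + s = 1] (mod p ^ m)" by (simp only: cong_int_iff)
  then have g: "[gam r * gam s = refl_sign r] (mod int p ^ m)" by (rule gam_reflection[OF assms(3)])
  have "padic_eq (int m) ((of_nat p - 1) * x) ((of_nat p - 1) * of_nat r)"
    using punit_p_minus_1 by (intro peq_mult_left r) (simp add: punit_def)
  then have "padic_eq (int m) (of_int (int c)) (of_int ((int p - 1) * int r))" using pn by (simp add: x_def)
  then have "[int c = (int p - 1) * int r] (mod int p ^ m)" unfolding peq_of_int .
  then have "int p ^ m dvd int c - (int p - 1) * int r" by (simp add: cong_iff_dvd_diff)
  then have "int p dvd int c - (int p - 1) * int r" using assms(3) by (meson dvd_power dvd_trans)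
  then have "int p dvd (int c - (int p - 1) * int r) + int p * int r" by simp
  then have "int p dvd int (c + r)" by (simp add: algebra_simps)
  then have pcr: "p dvd c + r" by (simp only: int_dvd_int_iff)
  have "\<not> p dvd c" using assms by (auto dest: dvd_imp_le)
  then have "\<not> p dvd r" using pcr by (metis dvd_add_left_iff)
  moreover have "r mod p = p - c"
  proof -
    have "p dvd c + r mod p" using pcr by (simp add: dvd_eq_mod_eq_0 mod_add_right_eq)
    then obtain k where k: "c + r mod p = p * k" ..
    have "r mod p < p" by simp
    then have "p * k < p * 2" using assms unfolding k[symmetric] by linarith
    then have "k < 2" by simp
    moreover have "k \<noteq> 0" using k assms by (cases k) auto
    ultimately have "k = 1" by simp
    then show ?thesis using k by simp
  qed
  ultimately have "refl_sign r = (- 1) ^ (p - c)" by (simp add: refl_sign_def)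
  also have "\<dots> = - ((- 1) ^ c)" using odd_p assms by (cases "even c") simp_all
  finally have "[gam r * gam s = - ((- 1) ^ c)] (mod int p ^ m)" using g by simp
  then have "padic_eq (int m) (of_int (gam r * gam s)) (of_int (- ((- 1) ^ c)))" unfolding peq_of_int .
  then show ?thesis unfolding x_def[symmetric] y_def[symmetric] gamma_p_approx_def r_def[symmetric] s_def[symmetric] by simp
qed

text \<open>The power of 2 in the duplication formula for \<open>gam\<close>: one factor for each
  index prime to \<open>p\<close>, as multiples of \<open>p\<close> do not enter Morita's
  product.\<close>

definition two_units :: "nat \<Rightarrow> int" where
  "two_units k = (\<Prod>i<k. if p dvd i then 1 else 2)"

lemma two_units_power: "two_units k * 2 ^ ((k + p - 1) div p) = 2 ^ k"
proof (induction k)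
  case (Suc k)
  have s: "two_units (Suc k) = two_units k * (if p dvd k then 1 else 2)" by (simp add: two_units_def)
  have d: "(Suc k + p - 1) div p = (k + p - 1) div p + (if p dvd k then 1 else 0)"
  proof -
    define Z where "Z = k + p - 1"
    have e: "Suc k + p - 1 = Suc Z" using p_pos(1) unfolding Z_def by linarith
    have "Suc Z = k + p" using p_pos(1) unfolding Z_def by linarith
    then have "Suc Z mod p = 0 \<longleftrightarrow> p dvd k" by (simp add: dvd_eq_mod_eq_0)
    then show ?thesis unfolding e Z_def[symmetric] using div_Suc[of Z p] by simp
  qed
  show ?case using Suc unfolding s d by (simp add: power_add)
next
  case 0
  have "(p - 1) div p = 0" by simp
  then show ?case by (simp add: two_units_def)
qed

lemma dvd_double_iff: "p dvd 2 * n \<longleftrightarrow> p dvd n"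
proof -
  have "\<not> p dvd 2" using gt2 by (auto dest: dvd_imp_le)
  then show ?thesis using prime_dvd_mult_iff[OF prime] by blast
qed

text \<open>\<open>H\<close> represents one half. Raising \<open>n\<close> by one, the recursion
  factors at \<open>n\<close> and \<open>n + H\<close>, doubled when prime to \<open>p\<close>,
  become those at \<open>2 * n\<close> and \<open>2 * n + 1\<close>, since
  \<open>2 * (n + H)\<close> is \<open>2 * n + 1 + p ^ m\<close>.\<close>

lemma gam_duplication:
  assumes H: "2 * H = p ^ m + 1" and m: "0 < m"
  shows "[gam n * gam (n + H) * two_units (2 * n) = gam H * gam (2 * n)] (mod int p ^ m)"
proof (induction n)
  case (Suc n)
  define h where "h n = (if p dvd n then - 1 else - int n)" for n
  have g: "gam (Suc n) = h n * gam n" for n by (simp add: gam_Suc h_def)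
  define \<tau> where "\<tau> i = (if p dvd i then 1 else 2 :: int)" for i
  have tw: "two_units (2 * Suc n) = two_units (2 * n) * \<tau> (2 * n) * \<tau> (Suc (2 * n))"
    by (simp add: two_units_def \<tau>_def)
  have 1: "h n * \<tau> (2 * n) = h (2 * n)" unfolding h_def \<tau>_def dvd_double_iff by simp
  have 2: "[h (n + H) * \<tau> (Suc (2 * n)) = h (Suc (2 * n))] (mod int p ^ m)"
  proof -
    have e: "2 * (n + H) = Suc (2 * n) + p ^ m" using H by simp
    have "p dvd n + H \<longleftrightarrow> p dvd Suc (2 * n)"
      unfolding dvd_double_iff[of "n + H", symmetric] e using m by (intro dvd_add_left_iff) (simp add: dvd_power)
    moreover have "[- int (n + H) * 2 = - int (Suc (2 * n))] (mod int p ^ m)"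
    proof -
      have "- int (n + H) * 2 = - int (Suc (2 * n)) - int p ^ m"
        using arg_cong[OF e, of int] by simp
      then show ?thesis by (simp add: cong_iff_dvd_diff)
    qed
    ultimately show ?thesis by (auto simp: h_def \<tau>_def)
  qed
  have "gam (Suc n) * gam (Suc n + H) * two_units (2 * Suc n)
     = (h n * \<tau> (2 * n)) * (h (n + H) * \<tau> (Suc (2 * n))) * (gam n * gam (n + H) * two_units (2 * n))"
    unfolding tw add_Suc g by (simp only: ac_simps)
  also have "[\<dots> = h (2 * n) * h (Suc (2 * n)) * (gam H * gam (2 * n))] (mod int p ^ m)"
    unfolding 1 by (intro cong_mult 2 Suc cong_refl)
  also have "h (2 * n) * h (Suc (2 * n)) * (gam H * gam (2 * n)) = gam H * gam (2 * Suc n)"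
    by (simp add: g ac_simps)
  finally show ?case .
qed (simp add: two_units_def)

text \<open>A well-chosen natural number \<open>n\<close> near half of \<open>c / (p - 1)\<close>
  makes the exponent of 2 in \<open>two_units (2 * n)\<close> a multiple of
  \<open>p ^ (m - 1)\<close>, so the power of 2 is a Teichmueller value.\<close>

lemma gamma_p_approx_duplication:
  assumes c: "c < p - 1" and m: "0 < m"
  shows "padic_eq (int m) (gamma_p_approx p m (of_nat c / (of_nat p - 1) / 2) * gamma_p_approx p m (of_nat c / (of_nat p - 1) / 2 + 1 / 2))
    (gamma_p_approx p m (1 / 2) * gamma_p_approx p m (of_nat c / (of_nat p - 1)) * of_int (teich m 2 ^ c))"
proof -
  define x where "x = (of_nat c / (of_nat p - 1) :: rat)"
  have pn: "(of_nat p :: rat) - 1 \<noteq> 0" using punit_p_minus_1 by (simp add: punit_def)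
  have p2: "\<not> int p dvd 2" using gt2 by (auto dest: zdvd_imp_le)
  have Vh: "V 0 (1 / 2)" using V_inverse_int[OF p2] by simp
  have Vx: "V 0 x" unfolding x_def by (rule V_p_minus_1)
  have Vx2: "V 0 (x / 2)" using V_mult_integral(1)[OF Vx Vh] by simp
  obtain m' where m': "m = Suc m'" using m by (cases m) auto
  define S where "S = (\<Sum>i<m'. p ^ i)"
  have S: "(p - 1) * S + 1 = p ^ m'"
  proof -
    have "(int p - 1) * int S = int p ^ m' - 1"
      unfolding S_def using power_diff_1_eq[of "int p" m'] by simp
    moreover have "int (p - 1) = int p - 1" using gt2 by (simp add: of_nat_diff)
    ultimately have "int ((p - 1) * S + 1) = int (p ^ m')" by simp
    then show ?thesis by (simp only: of_nat_eq_iff)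
  qed
  have SS: "(p - 1) * (1 + p * S) + 1 = p ^ m"
  proof -
    have "(p - 1) * (1 + p * S) + 1 = p * ((p - 1) * S + 1)" using p_pos(1) by (simp add: algebra_simps)
    then show ?thesis unfolding S m' by simp
  qed
  \<comment> \<open>As \<open>(p - 1) * (1 + p * S)\<close> is \<open>- 1\<close> modulo
    \<open>p ^ m\<close>, the number \<open>- c * (1 + p * S)\<close> represents
    \<open>c / (p - 1)\<close>; adding \<open>k * p ^ m\<close> makes it nonnegative and
    even.\<close>
  define k where "k = (if even (c * (1 + p * S)) then 2 else 1 :: nat)"
  have cS: "c * (1 + p * S) \<le> p ^ m"
  proof -
    have "c * (1 + p * S) \<le> (p - 1) * (1 + p * S)" using c by (intro mult_le_mono1) simp
    then show ?thesis using SS by simp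
  qed
  have cSk: "c * (1 + p * S) \<le> k * p ^ m" using cS by (simp add: k_def)
  have ev: "even (k * p ^ m - c * (1 + p * S))" using odd_p cSk by (simp add: k_def)
  define n where "n = (k * p ^ m - c * (1 + p * S)) div 2"
  have n: "2 * n + c * (1 + p * S) = k * p ^ m" using ev cSk by (simp add: n_def)
  have nx: "padic_eq (int m) x (of_nat (2 * n))"
  proof -
    have "(of_nat p - 1) * (of_nat (2 * n)) - of_nat c = (of_int (int p ^ m * ((int p - 1) * int k - int c)) :: rat)"
    proof -
      have f1: "(int p - 1) * int (2 * n) + int c * ((int p - 1) * (1 + int p * int S)) = (int p - 1) * (int k * int p ^ m)"
        using arg_cong[OF n, of "\<lambda>z. (int p - 1) * int z"] by (simp add: algebra_simps)
      have f2: "(int p - 1) * (1 + int p * int S) = int p ^ m - 1"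
      proof -
        have p1: "int (p - 1) = int p - 1" using gt2 by (simp add: of_nat_diff)
        show ?thesis using arg_cong[OF SS, of int]
          unfolding of_nat_add of_nat_mult p1 of_nat_1 of_nat_power by linarith
      qed
      have "(int p - 1) * int (2 * n) - int c = int p ^ m * ((int p - 1) * int k - int c)"
        using f1 unfolding f2 by (simp add: algebra_simps)
      from arg_cong[OF this, of "of_int :: int \<Rightarrow> rat"] show ?thesis by simp
    qed
    then have "V (int m) ((of_nat p - 1) * of_nat (2 * n) - of_nat c)"
      by (simp only: V_of_int_iff) simp
    then have "padic_eq (int m) ((of_nat p - 1) * of_nat (2 * n)) ((of_nat p - 1) * x)"
      using pn by (simp add: padic_eq_def x_def)
    then show ?thesis using peq_sym peq_cancel_left[OF _ punit_p_minus_1] by blast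
  qed
  have half: "padic_eq (int m) (x / 2) (of_nat n)"
    using peq_mult_right[OF nx Vh] by simp
  define H where "H = (p ^ m + 1) div 2"
  have H: "2 * H = p ^ m + 1" using odd_p by (simp add: H_def)
  have Hh: "padic_eq (int m) (1 / 2) (of_nat H)"
  proof -
    have "of_nat H = (of_nat (2 * H) / 2 :: rat)" by simp
    then have "(1 / 2 - of_nat H :: rat) = of_nat p ^ m * - (1 / 2)" unfolding H by simp
    then show ?thesis unfolding padic_eq_def using Vh by (simp only:) (intro V_mult_integral V_p_power V_minus)
  qed
  have xH: "padic_eq (int m) (x / 2 + 1 / 2) (of_nat (n + H))" using peq_add[OF half Hh] by simp
  define e where "e = k * (p - 1) - c"
  have ck: "c \<le> k * (p - 1)" using c by (simp add: k_def)
  \<comment> \<open>Of the indices below \<open>2 * n\<close> exactly \<open>R\<close> are multiples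
    of \<open>p\<close>, and \<open>2 * n - R = e * p ^ m'\<close>. Modulo \<open>p - 1\<close> the
    exponent \<open>e\<close> is \<open>- c\<close>.\<close>
  have tw: "two_units (2 * n) = teich m' 2 ^ e"
  proof -
    define R where "R = k * p ^ m' - c * S"
    have cSm: "c * S \<le> k * p ^ m'"
    proof -
      have "c * S \<le> (p - 1) * S" using c by (intro mult_le_mono1) simp
      also have "\<dots> \<le> k * p ^ m'" using S by (simp add: k_def)
      finally show ?thesis .
    qed
    have R: "R + c * S = k * p ^ m'" using cSm by (simp add: R_def)
    have pR: "p * R + c * p * S = k * p ^ m" using arg_cong[OF R, of "\<lambda>z. p * z"] by (simp add: m' algebra_simps)
    have 1: "2 * n + p - 1 = p * R + (p - 1 - c)"
      using n pR c gt2 by (simp add: algebra_simps)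
    then have 2: "(2 * n + p - 1) div p = R" by simp
    have "e * p ^ m' + R = 2 * n"
    proof -
      have "e + c = k * (p - 1)" using ck by (simp add: e_def)
      then have "e * p ^ m' + c * p ^ m' + k * p ^ m' = k * (p - 1) * p ^ m' + k * p ^ m'"
        by (metis add_mult_distrib)
      also have "\<dots> = k * p ^ m" using p_pos(1) by (cases p) (simp_all add: m' algebra_simps)
      finally have 3: "e * p ^ m' + c * p ^ m' + k * p ^ m' = k * p ^ m" .
      have 4: "c * p ^ m' = c * (p - 1) * S + c" using arg_cong[OF S, of "\<lambda>z. c * z"] by (simp add: algebra_simps)
      have 5: "c * p * S = c * (p - 1) * S + c * S"
        using p_pos(1) by (cases p) (simp_all add: algebra_simps)
      show ?thesis using 3 4 5 R n by (simp add: algebra_simps)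
    qed
    then have "two_units (2 * n) * 2 ^ R = 2 ^ (e * p ^ m') * 2 ^ R"
      using two_units_power[of "2 * n"] unfolding 2 by (simp flip: power_add)
    then show ?thesis by (simp add: teich_def power_mult[symmetric] mult.commute)
  qed
  have "[gam n * gam (n + H) * teich m' 2 ^ e * teich m' 2 ^ c = gam H * gam (2 * n) * teich m' 2 ^ c] (mod int p ^ m)"
    using gam_duplication[OF H m, of n] unfolding tw by (rule cong_mult[OF _ cong_refl])
  moreover have "[gam n * gam (n + H) * teich m' 2 ^ e * teich m' 2 ^ c = gam n * gam (n + H) * 1] (mod int p ^ m)"
  proof -
    have "[teich m' 2 ^ (e + c) = teich m' 2 ^ 0] (mod int p ^ Suc m')"
      using ck by (intro teich_pow_cong p2) (simp add: e_def cong_0_iff)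
    then have "[teich m' 2 ^ (e + c) = 1] (mod int p ^ m)" unfolding m' by (simp only: power_0)
    then have "[gam n * gam (n + H) * teich m' 2 ^ (e + c) = gam n * gam (n + H) * 1] (mod int p ^ m)"
      by (rule cong_mult[OF cong_refl])
    then show ?thesis by (simp only: power_add mult.assoc)
  qed
  moreover have "[gam H * gam (2 * n) * teich m' 2 ^ c = gam H * gam (2 * n) * teich m 2 ^ c] (mod int p ^ m)"
  proof -
    have "[teich m' 2 = teich m 2] (mod int p ^ Suc m')" using teich_teich[of m' m 2] by (simp add: m' cong_sym_eq)
    then show ?thesis unfolding m' by (intro cong_mult cong_refl cong_pow)
  qed
  ultimately have "[gam n * gam (n + H) = gam H * gam (2 * n) * teich m 2 ^ c] (mod int p ^ m)"
    by (simp add: cong_def)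
  then have 1: "padic_eq (int m) (of_int (gam n) * of_int (gam (n + H))) (of_int (gam H) * of_int (gam (2 * n)) * of_int (teich m 2 ^ c))"
    unfolding of_int_mult[symmetric] peq_of_int .
  have Vg: "V 0 (gamma_p_approx p m z)" for z using punit_gamma_p_approx[of m z] by (simp only: punit_def)
  have V2: "V 0 (x / 2 + 1 / 2)" by (intro V_add Vx2 Vh)
  have "padic_eq (int m) (gamma_p_approx p m (x / 2) * gamma_p_approx p m (x / 2 + 1 / 2)) (of_int (gam n) * of_int (gam (n + H)))"
    by (intro peq_mult gamma_p_approx_gam Vx2 V2 m half xH Vg V_of_int)
  also note 1
  also have "padic_eq (int m) (of_int (gam H) * of_int (gam (2 * n)) * of_int (teich m 2 ^ c)) (gamma_p_approx p m (1 / 2) * gamma_p_approx p m x * of_int (teich m 2 ^ c))"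
    by (intro peq_mult_right peq_mult peq_sym[OF gamma_p_approx_gam] Vh Vx m Hh nx Vg V_of_int)
  finally show ?thesis unfolding x_def .
qed

end

section \<open>Points on the torus\<close>

locale prime_3_mod_4 = odd_prime +
  assumes mod4: "p mod 4 = 3"
begin

section \<open>The Legendre symbol when \<open>- 1\<close> is not a square\<close>

abbreviation lg :: "int \<Rightarrow> int" where "lg a \<equiv> Legendre a (int p)"

lemma half_p_odd: "odd ((p - 1) div 2)"
  using mod4 by presburger

lemma p_minus_1_half: "p - 1 = 2 * ((p - 1) div 2)"
  using odd_p by presburger

lemma not_dvd_2: "\<not> int p dvd 2"
  using gt2 by (auto dest: zdvd_imp_le)

lemma lg_euler: "[lg a = a ^ ((p - 1) div 2)] (mod int p)"
  using euler_criterion[OF prime gt2, of a] by simp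

lemma lg_range: "lg a \<in> {- 1, 0, 1}"
  by (auto simp: Legendre_def)

lemma lg_unique: assumes "[lg a = c] (mod int p)" "c \<in> {- 1, 0, 1}" shows "lg a = c"
proof -
  have "int p dvd lg a - c" using assms(1) by (simp add: cong_iff_dvd_diff)
  moreover have "\<bar>lg a - c\<bar> < int p" using assms(2) lg_range[of a] gt2 by auto
  ultimately show ?thesis by (metis dvd_imp_le_int linorder_not_less abs_of_nat eq_iff_diff_eq_0)
qed

lemma lg_unit: "\<not> int p dvd a \<Longrightarrow> lg a = 1 \<or> lg a = - 1"
  by (auto simp: Legendre_def cong_0_iff)

lemma lg_mult: "lg (a * b) = lg a * lg b"
proof (rule lg_unique)
  have "[lg a * lg b = a ^ ((p - 1) div 2) * b ^ ((p - 1) div 2)] (mod int p)"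
    by (intro cong_mult lg_euler)
  then have "[a ^ ((p - 1) div 2) * b ^ ((p - 1) div 2) = lg a * lg b] (mod int p)" by (rule cong_sym)
  from cong_trans[OF lg_euler[of "a * b", unfolded power_mult_distrib] this]
  show "[lg (a * b) = lg a * lg b] (mod int p)" .
  show "lg a * lg b \<in> {- 1, 0, 1}" using lg_range[of a] lg_range[of b] by auto
qed

lemma lg_cong: assumes "[a = b] (mod int p)" shows "lg a = lg b"
proof (rule lg_unique)
  have "[a ^ ((p - 1) div 2) = b ^ ((p - 1) div 2)] (mod int p)" using assms by (rule cong_pow)
  from cong_trans[OF lg_euler cong_trans[OF this cong_sym[OF lg_euler]]]
  show "[lg a = lg b] (mod int p)" .
qed (rule lg_range)

lemma lg_minus: "lg (- a) = - lg a"
proof (rule lg_unique)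
  have "[lg (- a) = (- a) ^ ((p - 1) div 2)] (mod int p)" by (rule lg_euler)
  also have "(- a) ^ ((p - 1) div 2) = - (a ^ ((p - 1) div 2))" using half_p_odd by simp
  also have "[- (a ^ ((p - 1) div 2)) = - lg a] (mod int p)"
    unfolding cong_minus_minus_iff by (rule cong_sym[OF lg_euler])
  finally show "[lg (- a) = - lg a] (mod int p)" .
qed (use lg_range[of a] in auto)

lemma lg_square: "\<not> int p dvd a \<Longrightarrow> lg (a * a) = 1"
  using lg_unit[of a] by (auto simp: lg_mult)

lemma not_dvd_mult: "\<not> int p dvd a * b \<longleftrightarrow> \<not> int p dvd a \<and> \<not> int p dvd b"
  using prime_dvd_mult_iff[OF prime_int] by auto

lemma not_dvd_power: "\<not> int p dvd a \<Longrightarrow> \<not> int p dvd a ^ n"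
  using prime_dvd_power[OF prime_int] by blast

text \<open>Since \<open>- 1\<close> is not a square modulo \<open>p\<close>, fourth powers determine their roots up to sign.\<close>
lemma fourth_power_cong_iff:
  assumes "\<not> int p dvd b"
  shows "[a ^ 4 = b ^ 4] (mod int p) \<longleftrightarrow> [a = b] (mod int p) \<or> [a = - b] (mod int p)"
proof
  assume "[a ^ 4 = b ^ 4] (mod int p)"
  then have "int p dvd a ^ 4 - b ^ 4" by (simp add: cong_iff_dvd_diff)
  moreover have "a ^ 4 - b ^ 4 = (a - b) * (a + b) * (a * a + b * b)"
    by (simp add: power4_eq_xxxx algebra_simps)
  ultimately have d: "int p dvd a - b \<or> int p dvd a + b \<or> int p dvd a * a + b * b"
    by (simp add: prime_dvd_mult_iff[OF prime_int])
  have "\<not> int p dvd a * a + b * b"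
  proof
    assume "int p dvd a * a + b * b"
    then have c: "[a * a = - (b * b)] (mod int p)" by (simp add: cong_iff_dvd_diff)
    then have "lg (a * a) = lg (- (b * b))" by (rule lg_cong)
    then have "lg a * lg a = - 1" using lg_square[OF assms] by (simp add: lg_minus lg_mult)
    then show False using lg_range[of a] by auto
  qed
  then show "[a = b] (mod int p) \<or> [a = - b] (mod int p)" using d by (auto simp: cong_iff_dvd_diff)
next
  assume "[a = b] (mod int p) \<or> [a = - b] (mod int p)"
  then show "[a ^ 4 = b ^ 4] (mod int p)"
  proof
    assume "[a = - b] (mod int p)"
    from cong_pow[OF this, of 4] show ?thesis by simp
  qed (rule cong_pow)
qed

text \<open>Every square is already a fourth power, because one of its two square roots is again a
  square; its fourth roots then form one pair of opposite signs.\<close>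

lemma card_fourth_roots:
  assumes y: "y \<in> {1..<p}"
  shows "int (card {x \<in> {1..<p}. x ^ 4 mod p = y}) = 1 + lg (int y)"
proof -
  have iff: "x ^ 4 mod p = y \<longleftrightarrow> [int x ^ 4 = int y] (mod int p)" for x
    using y by (simp add: cong_def flip: of_nat_power of_nat_mod)
  have ny: "\<not> int p dvd int y" using unit_range(2)[OF y] .
  show ?thesis
  proof (cases "lg (int y) = 1")
    case False
    have "\<not> [int x ^ 4 = int y] (mod int p)" for x
    proof
      assume *: "[int x ^ 4 = int y] (mod int p)"
      then have "\<not> int p dvd int x ^ 4" using ny by (simp add: cong_dvd_iff)
      then have "\<not> int p dvd int x * int x" by (auto simp: power4_eq_xxxx)
      then have "lg (int x * int x * (int x * int x)) = 1" by (rule lg_square)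
      moreover have "lg (int x * int x * (int x * int x)) = lg (int y)"
        using * by (intro lg_cong) (simp add: power4_eq_xxxx mult.assoc)
      ultimately show False using False by simp
    qed
    then have "{x \<in> {1..<p}. x ^ 4 mod p = y} = {}" unfolding iff by blast
    then show ?thesis using False lg_unit[OF ny] by (simp only: card.empty) auto
  next
    case True
    then have "QuadRes (int p) (int y)" by (auto simp: Legendre_def split: if_splits)
    then obtain z where z: "[z ^ 2 = int y] (mod int p)" by (auto simp: QuadRes_def)
    have nz2: "\<not> int p dvd z ^ 2" using cong_dvd_iff[OF z] ny by simp
    then have nz: "\<not> int p dvd z" by (auto simp: power2_eq_square)
    \<comment> \<open>Of the two roots \<open>z\<close> and \<open>- z\<close> exactly one is a
      square.\<close>
    have "\<exists>v. \<not> int p dvd v \<and> [v ^ 2 = int y] (mod int p) \<and> lg v = 1"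
    proof (cases "lg z = 1")
      case True
      then show ?thesis using nz z by blast
    next
      case False
      then have "lg (- z) = 1" using lg_unit[OF nz] by (simp add: lg_minus)
      then show ?thesis using nz z by (intro exI[of _ "- z"]) simp
    qed
    then obtain v where v: "\<not> int p dvd v" "[v ^ 2 = int y] (mod int p)" "lg v = 1" by blast
    then have "QuadRes (int p) v" by (auto simp: Legendre_def split: if_splits)
    then obtain w0 where w0: "[w0 ^ 2 = v] (mod int p)" by (auto simp: QuadRes_def)
    define w where "w = nat (w0 mod int p)"
    have w: "int w = w0 mod int p" using gt2 by (simp add: w_def)
    have nw0: "\<not> int p dvd w0"
      using cong_dvd_iff[OF w0] v(1) by (auto simp: power2_eq_square)
    have "w < p" using w gt2 by (metis of_nat_less_iff pos_mod_bound of_nat_0_less_iff p_pos(1))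
    moreover have "w \<noteq> 0" using nw0 w by (auto simp: dvd_eq_mod_eq_0)
    ultimately have wr: "w \<in> {1..<p}" by simp
    have nw: "\<not> int p dvd int w" using unit_range(2)[OF wr] .
    have "[int w ^ 4 = int y] (mod int p)"
    proof -
      have "[int w ^ 4 = w0 ^ 4] (mod int p)" unfolding w by (intro cong_pow) simp
      also have "w0 ^ 4 = (w0 ^ 2) ^ 2" by simp
      also have "[(w0 ^ 2) ^ 2 = v ^ 2] (mod int p)" by (intro cong_pow w0)
      also note v(2)
      finally show ?thesis .
    qed
    then have "[int x ^ 4 = int y] (mod int p) \<longleftrightarrow> [int x ^ 4 = int w ^ 4] (mod int p)" for x
      by (simp add: cong_def)
    then have iff2: "x ^ 4 mod p = y \<longleftrightarrow> [int x = int w] (mod int p) \<or> [int x = - int w] (mod int p)" for x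
      unfolding iff by (simp only: fourth_power_cong_iff[OF nw])
    have i1: "[int x = int w] (mod int p) \<longleftrightarrow> x = w" if "x \<in> {1..<p}" for x
      unfolding cong_int_iff using that wr by (simp add: cong_def)
    have i2: "[int x = - int w] (mod int p) \<longleftrightarrow> x = p - w" if "x \<in> {1..<p}" for x
    proof -
      have "[int x = - int w] (mod int p) \<longleftrightarrow> [int x = int (p - w)] (mod int p)"
        using wr by (simp add: cong_def of_nat_diff)
      also have "\<dots> \<longleftrightarrow> x = p - w" unfolding cong_int_iff using that wr by (simp add: cong_def)
      finally show ?thesis .
    qed
    have "{x \<in> {1..<p}. x ^ 4 mod p = y} = {w, p - w}"
      using wr by (auto simp: iff2 i1 i2 cong_iff_dvd_diff[of "int p - int w" "- int w"])
    moreover have "w \<noteq> p - w" using odd_p wr by presburger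
    ultimately show ?thesis using True by simp
  qed
qed

lemma sum_pow4:
  fixes g :: "nat \<Rightarrow> int"
  shows "(\<Sum>x\<in>{1..<p}. g (x ^ 4 mod p)) = (\<Sum>y\<in>{1..<p}. (1 + lg (int y)) * g y)"
proof -
  have im: "x ^ 4 mod p \<in> {1..<p}" if "x \<in> {1..<p}" for x
  proof -
    have "\<not> p dvd x ^ 4" using unit_range(1)[OF that] prime_dvd_power[OF prime] by blast
    then show ?thesis by (auto simp: dvd_eq_mod_eq_0 Suc_le_eq)
  qed
  have "(\<Sum>x\<in>{1..<p}. g (x ^ 4 mod p)) = (\<Sum>y\<in>{1..<p}. \<Sum>x\<in>{x \<in> {1..<p}. x ^ 4 mod p = y}. g (x ^ 4 mod p))"
    using im by (intro sum.group[symmetric]) auto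
  also have "\<dots> = (\<Sum>y\<in>{1..<p}. (1 + lg (int y)) * g y)"
  proof (intro sum.cong refl)
    fix y assume y: "y \<in> {1..<p}"
    have "(\<Sum>x\<in>{x \<in> {1..<p}. x ^ 4 mod p = y}. g (x ^ 4 mod p)) = (\<Sum>x\<in>{x \<in> {1..<p}. x ^ 4 mod p = y}. g y)"
      by (intro sum.cong) auto
    then show "(\<Sum>x\<in>{x \<in> {1..<p}. x ^ 4 mod p = y}. g (x ^ 4 mod p)) = (1 + lg (int y)) * g y"
      using card_fourth_roots[OF y] by simp
  qed
  finally show ?thesis .
qed

lemma sum_units4:
  fixes G :: "nat \<times> nat \<times> nat \<times> nat \<Rightarrow> 'a :: comm_monoid_add"
  shows "(\<Sum>y\<in>units4. G y) = (\<Sum>y1\<in>{1..<p}. \<Sum>y2\<in>{1..<p}. \<Sum>y3\<in>{1..<p}. \<Sum>y4\<in>{1..<p}. G (y1, y2, y3, y4))"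
  by (simp add: sum.cartesian_product case_prod_unfold)

lemma card_filter_of_bool: "finite A \<Longrightarrow> int (card {x \<in> A. P x}) = (\<Sum>x\<in>A. of_bool (P x))"
  unfolding of_bool_def sum.inter_filter[symmetric] by simp

fun pow4 :: "nat \<times> nat \<times> nat \<times> nat \<Rightarrow> nat \<times> nat \<times> nat \<times> nat" where
  "pow4 (x1, x2, x3, x4) = (x1 ^ 4 mod p, x2 ^ 4 mod p, x3 ^ 4 mod p, x4 ^ 4 mod p)"

fun prod4 :: "nat \<times> nat \<times> nat \<times> nat \<Rightarrow> nat" where
  "prod4 (y1, y2, y3, y4) = y1 * y2 * y3 * y4"

fun lgw :: "nat \<times> nat \<times> nat \<times> nat \<Rightarrow> int" where
  "lgw (y1, y2, y3, y4) = (1 + lg (int y1)) * ((1 + lg (int y2)) * ((1 + lg (int y3)) * (1 + lg (int y4))))"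

lemma sum_pow4_units4:
  fixes G :: "nat \<times> nat \<times> nat \<times> nat \<Rightarrow> int"
  shows "(\<Sum>x\<in>units4. G (pow4 x)) = (\<Sum>y\<in>units4. lgw y * G y)"
proof -
  have "(\<Sum>x\<in>units4. G (pow4 x)) = (\<Sum>x1\<in>{1..<p}. \<Sum>x2\<in>{1..<p}. \<Sum>x3\<in>{1..<p}. \<Sum>x4\<in>{1..<p}. G (x1 ^ 4 mod p, x2 ^ 4 mod p, x3 ^ 4 mod p, x4 ^ 4 mod p))"
    by (simp only: sum_units4 pow4.simps)
  also have "\<dots> = (\<Sum>y1\<in>{1..<p}. (1 + lg (int y1)) * (\<Sum>y2\<in>{1..<p}. (1 + lg (int y2)) * (\<Sum>y3\<in>{1..<p}. (1 + lg (int y3)) * (\<Sum>y4\<in>{1..<p}. (1 + lg (int y4)) * G (y1, y2, y3, y4)))))"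
    unfolding sum_pow4[of "\<lambda>x4. G (_, _, _, x4)"]
    unfolding sum_pow4[of "\<lambda>x3. \<Sum>y4\<in>{1..<p}. (1 + lg (int y4)) * G (_, _, x3, y4)"]
    unfolding sum_pow4[of "\<lambda>x2. \<Sum>y3\<in>{1..<p}. (1 + lg (int y3)) * (\<Sum>y4\<in>{1..<p}. (1 + lg (int y4)) * G (_, x2, y3, y4))"]
    by (rule sum_pow4[of "\<lambda>x1. \<Sum>y2\<in>{1..<p}. (1 + lg (int y2)) * (\<Sum>y3\<in>{1..<p}. (1 + lg (int y3)) * (\<Sum>y4\<in>{1..<p}. (1 + lg (int y4)) * G (x1, y2, y3, y4)))"])
  also have "\<dots> = (\<Sum>y\<in>units4. lgw y * G y)"
    by (simp only: sum_units4 lgw.simps sum_distrib_left mult.assoc)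
  finally show ?thesis .
qed

end

locale dwork_setting = prime_3_mod_4 +
  fixes lam :: int
  assumes lam: "\<not> int p dvd lam"
begin

fun quartic :: "int \<Rightarrow> nat \<times> nat \<times> nat \<times> nat \<Rightarrow> int" where
  "quartic l (x1, x2, x3, x4) = int x1 ^ 4 + int x2 ^ 4 + int x3 ^ 4 + int x4 ^ 4 - 4 * l * int x1 * int x2 * int x3 * int x4"

text \<open>If \<open>y\<close> consists of the fourth powers of the coordinates of \<open>x\<close>, then \<open>onW y\<close> means that \<open>x\<close> lies on the
  surface with parameter \<open>lam\<close> or \<open>- lam\<close>; changing the sign of one coordinate exchanges the two.\<close>
definition onW :: "nat \<times> nat \<times> nat \<times> nat \<Rightarrow> bool" where
  "onW y \<longleftrightarrow> [int (sum4 y) ^ 4 = 256 * lam ^ 4 * int (prod4 y)] (mod int p)"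

fun neg_first :: "nat \<times> nat \<times> nat \<times> nat \<Rightarrow> nat \<times> nat \<times> nat \<times> nat" where
  "neg_first (x1, x2, x3, x4) = (p - x1, x2, x3, x4)"

lemma not_dvd_256: "\<not> int p dvd 256" and not_dvd_4: "\<not> int p dvd 4"
  using not_dvd_power[OF not_dvd_2, of 8] not_dvd_power[OF not_dvd_2, of 2] by simp_all

text \<open>With \<open>a\<close> the sum of fourth powers and \<open>b\<close> the product term,
  the condition is \<open>a ^ 4 = b ^ 4\<close>, that is \<open>a = b\<close> or
  \<open>a = - b\<close>; both cannot hold since \<open>2 * b\<close> is a unit.\<close>

lemma onW_pow4:
  assumes "x \<in> units4"
  shows "of_bool (onW (pow4 x)) = (of_bool (int p dvd quartic lam x) + of_bool (int p dvd quartic (- lam) x) :: int)"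
proof -
  obtain x1 x2 x3 x4 where x: "x = (x1, x2, x3, x4)" by (cases x)
  define a where "a = int x1 ^ 4 + int x2 ^ 4 + int x3 ^ 4 + int x4 ^ 4"
  define b where "b = 4 * lam * int x1 * int x2 * int x3 * int x4"
  have nx: "\<not> int p dvd int x1" "\<not> int p dvd int x2" "\<not> int p dvd int x3" "\<not> int p dvd int x4"
    using assms unfolding x by (auto intro!: unit_range(2))
  then have nb: "\<not> int p dvd b"
    unfolding b_def by (simp only: not_dvd_mult) (simp add: lam not_dvd_4)
  have red: "[int (z ^ 4 mod p) = int z ^ 4] (mod int p)" for z by (simp add: cong_def zmod_int)
  have s: "[int (sum4 (pow4 x)) ^ 4 = a ^ 4] (mod int p)"
    unfolding x pow4.simps sum4.simps of_nat_add a_def by (intro cong_pow cong_add red)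
  have "[256 * lam ^ 4 * int (prod4 (pow4 x)) = 256 * lam ^ 4 * (int x1 ^ 4 * int x2 ^ 4 * int x3 ^ 4 * int x4 ^ 4)] (mod int p)"
    unfolding x pow4.simps prod4.simps of_nat_mult by (intro cong_mult cong_refl red)
  also have "256 * lam ^ 4 * (int x1 ^ 4 * int x2 ^ 4 * int x3 ^ 4 * int x4 ^ 4) = b ^ 4"
    unfolding b_def by (simp add: power_mult_distrib algebra_simps)
  finally have "onW (pow4 x) \<longleftrightarrow> [a ^ 4 = b ^ 4] (mod int p)"
    unfolding onW_def using s by (simp add: cong_def)
  also have "\<dots> \<longleftrightarrow> int p dvd a - b \<or> int p dvd a + b"
    unfolding fourth_power_cong_iff[OF nb] by (simp add: cong_iff_dvd_diff)
  finally have iff: "onW (pow4 x) \<longleftrightarrow> int p dvd a - b \<or> int p dvd a + b" .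
  have ex: "\<not> (int p dvd a - b \<and> int p dvd a + b)"
  proof
    assume "int p dvd a - b \<and> int p dvd a + b"
    then have "int p dvd (a + b) - (a - b)" by (blast intro: dvd_diff)
    then have "int p dvd 2 * b" by (simp add: algebra_simps)
    then show False using nb not_dvd_2 not_dvd_mult by blast
  qed
  have q: "quartic lam x = a - b" "quartic (- lam) x = a + b" by (simp_all add: x a_def b_def)
  have "of_bool (P \<or> Q) = (of_bool P + of_bool Q :: int)" if "\<not> (P \<and> Q)" for P Q
    using that by (cases P; cases Q) simp_all
  from this[OF ex] show ?thesis unfolding iff q .
qed

text \<open>Negating the first coordinate exchanges the surfaces for \<open>lam\<close> and
  \<open>- lam\<close>, so both have equally many torus points.\<close>

lemma torus_double:
  "2 * int (card {x \<in> units4. int p dvd quartic lam x}) = (\<Sum>x\<in>units4. of_bool (onW (pow4 x)))"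
proof -
  have card: "int (card {x \<in> units4. int p dvd quartic l x}) = (\<Sum>x\<in>units4. of_bool (int p dvd quartic l x))" for l
    by (rule card_filter_of_bool) simp
  have inv: "neg_first (neg_first x) = x" if "x \<in> units4" for x using that by (cases x) auto
  have mem: "neg_first x \<in> units4" if "x \<in> units4" for x using that by (cases x) auto
  have q: "int p dvd quartic (- lam) (neg_first x) \<longleftrightarrow> int p dvd quartic lam x" if "x \<in> units4" for x
  proof -
    obtain x1 x2 x3 x4 where x: "x = (x1, x2, x3, x4)" by (cases x)
    have "[int (p - x1) = - int x1] (mod int p)" using that unfolding x by (simp add: of_nat_diff cong_iff_dvd_diff)
    then have "[quartic (- lam) (neg_first x) = (- int x1) ^ 4 + int x2 ^ 4 + int x3 ^ 4 + int x4 ^ 4 - 4 * (- lam) * (- int x1) * int x2 * int x3 * int x4] (mod int p)"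
      unfolding x neg_first.simps quartic.simps by (intro cong_diff cong_add cong_mult cong_pow cong_refl)
    also have "(- int x1) ^ 4 + int x2 ^ 4 + int x3 ^ 4 + int x4 ^ 4 - 4 * (- lam) * (- int x1) * int x2 * int x3 * int x4 = quartic lam x"
      unfolding x by simp
    finally show ?thesis by (rule cong_dvd_iff)
  qed
  have "(\<Sum>x\<in>units4. of_bool (int p dvd quartic lam x) :: int) = (\<Sum>x\<in>units4. of_bool (int p dvd quartic (- lam) x))"
    by (rule sum.reindex_bij_witness[of _ neg_first neg_first]) (simp_all only: inv mem q)
  moreover have "(\<Sum>x\<in>units4. of_bool (onW (pow4 x)) :: int)
     = (\<Sum>x\<in>units4. of_bool (int p dvd quartic lam x) + of_bool (int p dvd quartic (- lam) x))"
    by (rule sum.cong[OF refl onW_pow4])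
  ultimately show ?thesis unfolding card sum.distrib by simp
qed

text \<open>Both the fourth power of the sum and \<open>256 * lam ^ 4\<close> are squares, so the
  product of the coordinates is one.\<close>

lemma onW_lg: assumes "y \<in> units4" "onW y" shows "lg (int (prod4 y)) = 1"
proof -
  obtain y1 y2 y3 y4 where y: "y = (y1, y2, y3, y4)" by (cases y)
  have ny: "\<not> int p dvd int (prod4 y)"
    using assms(1) unfolding y prod4.simps of_nat_mult not_dvd_mult by (auto intro!: unit_range(2))
  have n: "\<not> int p dvd 16 * lam ^ 2"
    using not_dvd_power[OF not_dvd_2, of 4] not_dvd_power[OF lam, of 2] by (simp add: not_dvd_mult)
  have e: "256 * lam ^ 4 = (16 * lam ^ 2) * (16 * lam ^ 2)" by (simp add: power4_eq_xxxx power2_eq_square)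
  have "[int (sum4 y) ^ 4 = (16 * lam ^ 2) * (16 * lam ^ 2) * int (prod4 y)] (mod int p)"
    using assms(2) unfolding onW_def e .
  from lg_cong[OF this] have "lg (int (sum4 y) ^ 4) = lg ((16 * lam ^ 2) * (16 * lam ^ 2)) * lg (int (prod4 y))"
    by (simp only: lg_mult)
  then have "lg (int (prod4 y)) = lg (int (sum4 y) ^ 4)" using lg_square[OF n] by simp
  also have "\<dots> = (lg (int (sum4 y)) * lg (int (sum4 y))) * (lg (int (sum4 y)) * lg (int (sum4 y)))"
    by (simp only: power4_eq_xxxx lg_mult mult.assoc)
  finally show ?thesis using lg_unit[OF ny] lg_range[of "int (sum4 y)"] by auto
qed

lemma onW_scale: assumes "\<not> p dvd s" shows "onW (scale4 s y) \<longleftrightarrow> onW y"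
proof -
  obtain y1 y2 y3 y4 where y: "y = (y1, y2, y3, y4)" by (cases y)
  have red: "[int (s * z mod p) = int s * int z] (mod int p)" for z by (simp add: cong_def zmod_int)
  have 1: "[int (sum4 (scale4 s y)) ^ 4 = (int s * int y1 + int s * int y2 + int s * int y3 + int s * int y4) ^ 4] (mod int p)"
    unfolding y scale4.simps sum4.simps of_nat_add by (intro cong_pow cong_add red)
  have 2: "(int s * int y1 + int s * int y2 + int s * int y3 + int s * int y4) ^ 4 = int s ^ 4 * int (sum4 y) ^ 4"
    unfolding y sum4.simps by (simp flip: distrib_left power_mult_distrib)
  have 3: "[256 * lam ^ 4 * int (prod4 (scale4 s y)) = 256 * lam ^ 4 * ((int s * int y1) * (int s * int y2) * (int s * int y3) * (int s * int y4))] (mod int p)"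
    unfolding y scale4.simps prod4.simps of_nat_mult by (intro cong_mult cong_refl red)
  have 4: "256 * lam ^ 4 * ((int s * int y1) * (int s * int y2) * (int s * int y3) * (int s * int y4)) = int s ^ 4 * (256 * lam ^ 4 * int (prod4 y))"
    unfolding y prod4.simps by (simp add: power4_eq_xxxx)
  have "onW (scale4 s y) \<longleftrightarrow> [int s ^ 4 * int (sum4 y) ^ 4 = int s ^ 4 * (256 * lam ^ 4 * int (prod4 y))] (mod int p)"
    unfolding onW_def using 1 3 unfolding 2 4 by (simp add: cong_def)
  also have "\<dots> \<longleftrightarrow> onW y" unfolding onW_def
  proof (rule cong_mult_lcancel)
    have "\<not> int p dvd int s ^ 4" using assms by (intro not_dvd_power) simp
    from prime_imp_coprime[OF prime_int this] show "coprime (int s ^ 4) (int p)" by (simp only: coprime_commute)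
  qed
  finally show ?thesis .
qed

fun lg12 :: "nat \<times> nat \<times> nat \<times> nat \<Rightarrow> int" where
  "lg12 (y1, y2, y3, y4) = lg (int y1) * lg (int y2)"

lemma lg_scale: "lg (int (s * z mod p)) = lg (int s) * lg (int z)"
proof -
  have "lg (int (s * z mod p)) = lg (int s * int z)" by (rule lg_cong) (simp add: cong_def zmod_int)
  then show ?thesis by (simp only: lg_mult)
qed

text \<open>Scaling by \<open>- 1\<close> preserves \<open>onW\<close>, so a weight that is odd
  under it sums to zero.\<close>

lemma sum_onW_lg_single:
  assumes g: "\<And>y. y \<in> units4 \<Longrightarrow> g (scale4 (p - 1) y) = - g y"
  shows "(\<Sum>y\<in>units4. of_bool (onW y) * g y) = (0 :: int)"
proof -
  have n: "\<not> p dvd p - 1" using gt2 by (auto dest: dvd_imp_le)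
  have "(\<Sum>y\<in>units4. of_bool (onW y) * g y) = (\<Sum>y\<in>units4. of_bool (onW (scale4 (p - 1) y)) * g (scale4 (p - 1) y))"
    by (rule sum.reindex_bij_betw[OF bij_scale4[OF n], symmetric])
  also have "\<dots> = (\<Sum>y\<in>units4. - (of_bool (onW y) * g y))"
    by (intro sum.cong refl) (simp only: onW_scale[OF n] g mult_minus_right)
  finally show ?thesis by (simp add: sum_negf)
qed

lemma lg_p_minus_1: "lg (int (p - 1)) = - 1"
proof -
  have "int (p - 1) = int p - 1" using gt2 by (simp add: of_nat_diff)
  then have "lg (int (p - 1)) = lg (- 1)" by (intro lg_cong) (simp only: cong_iff_dvd_diff, simp)
  also have "\<dots> = - 1" using lg_minus[of 1] lg_square[of 1] gt2 by (simp add: zdvd_not_zless)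
  finally show ?thesis .
qed

fun swap23 :: "nat \<times> nat \<times> nat \<times> nat \<Rightarrow> nat \<times> nat \<times> nat \<times> nat" where
  "swap23 (y1, y2, y3, y4) = (y1, y3, y2, y4)"

fun swap24 :: "nat \<times> nat \<times> nat \<times> nat \<Rightarrow> nat \<times> nat \<times> nat \<times> nat" where
  "swap24 (y1, y2, y3, y4) = (y1, y4, y3, y2)"

text \<open>The linear terms vanish by oddness, permuting coordinates identifies the three remaining
  pairs, and the 2 cancels against the pair \<open>lam\<close>, \<open>- lam\<close>.\<close>

lemma torus_count_aux:
  "int (card {x \<in> units4. int p dvd quartic lam x}) = (\<Sum>y\<in>units4. of_bool (onW y) * (1 + 3 * lg12 y))"
proof -
  define S where "S g = (\<Sum>y\<in>units4. of_bool (onW y) * g y)" for g :: "nat \<times> nat \<times> nat \<times> nat \<Rightarrow> int"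
  have S_add: "S (\<lambda>y. g y + h y) = S g + S h" for g h by (simp only: S_def distrib_left sum.distrib)
  have S_mult: "S (\<lambda>y. c * g y) = c * S g" for g c by (simp only: S_def sum_distrib_left mult.left_commute[of c])
  define g1 where "g1 y = (case y of (y1, y2, y3, y4) \<Rightarrow> lg (int y1))" for y :: "nat \<times> nat \<times> nat \<times> nat"
  define g2 where "g2 y = (case y of (y1, y2, y3, y4) \<Rightarrow> lg (int y2))" for y :: "nat \<times> nat \<times> nat \<times> nat"
  define g3 where "g3 y = (case y of (y1, y2, y3, y4) \<Rightarrow> lg (int y3))" for y :: "nat \<times> nat \<times> nat \<times> nat"
  define g4 where "g4 y = (case y of (y1, y2, y3, y4) \<Rightarrow> lg (int y4))" for y :: "nat \<times> nat \<times> nat \<times> nat"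
  note g_defs = g1_def g2_def g3_def g4_def
  \<comment> \<open>Expansion of the product of the \<open>1 + lg y_i\<close> when all four symbols
    multiply to 1: degree 4 joins degree 0, each cubic term equals a linear one, and complementary
    pairs coincide.\<close>
  define w where "w y = 2 * 1 + (2 * g1 y + (2 * g2 y + (2 * g3 y + (2 * g4 y + (2 * lg12 y + (2 * lg12 (swap23 y) + 2 * lg12 (swap24 y)))))))" for y
  have exp: "lgw y * of_bool (onW y) = of_bool (onW y) * w y"
    if "y \<in> units4" for y
  proof (cases "onW y")
    case True
    obtain y1 y2 y3 y4 where y: "y = (y1, y2, y3, y4)" by (cases y)
    have "lg (int y1) = 1 \<or> lg (int y1) = - 1" "lg (int y2) = 1 \<or> lg (int y2) = - 1"
      "lg (int y3) = 1 \<or> lg (int y3) = - 1" "lg (int y4) = 1 \<or> lg (int y4) = - 1"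
      using that unfolding y by (auto intro!: lg_unit unit_range(2))
    moreover have "lg (int y1) * lg (int y2) * lg (int y3) * lg (int y4) = 1"
      using onW_lg[OF that True] unfolding y prod4.simps of_nat_mult lg_mult .
    ultimately show ?thesis using True unfolding y by (auto simp: g_defs w_def)
  qed simp
  have "2 * int (card {x \<in> units4. int p dvd quartic lam x}) = (\<Sum>y\<in>units4. lgw y * of_bool (onW y))"
    unfolding torus_double by (rule sum_pow4_units4[of "\<lambda>y. of_bool (onW y)"])
  also have "\<dots> = S w"
    unfolding S_def by (rule sum.cong[OF refl exp])
  also have "S w = 2 * S (\<lambda>_. 1) + (2 * S g1 + (2 * S g2 + (2 * S g3 + (2 * S g4 + (2 * S lg12 + (2 * S (\<lambda>y. lg12 (swap23 y)) + 2 * S (\<lambda>y. lg12 (swap24 y))))))))"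
    unfolding w_def[abs_def] by (simp only: S_add S_mult)
  also have "S g1 = 0" unfolding S_def g1_def
    by (rule sum_onW_lg_single) (auto simp only: scale4.simps prod.case lg_scale lg_p_minus_1 mult_minus1)
  also have "S g2 = 0" unfolding S_def g2_def
    by (rule sum_onW_lg_single) (auto simp only: scale4.simps prod.case lg_scale lg_p_minus_1 mult_minus1)
  also have "S g3 = 0" unfolding S_def g3_def
    by (rule sum_onW_lg_single) (auto simp only: scale4.simps prod.case lg_scale lg_p_minus_1 mult_minus1)
  also have "S g4 = 0" unfolding S_def g4_def
    by (rule sum_onW_lg_single) (auto simp only: scale4.simps prod.case lg_scale lg_p_minus_1 mult_minus1)
  also have "S (\<lambda>y. lg12 (swap23 y)) = S lg12" unfolding S_def
    by (rule sum.reindex_bij_witness[of _ swap23 swap23]) (auto simp: onW_def ac_simps)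
  also have "S (\<lambda>y. lg12 (swap24 y)) = S lg12" unfolding S_def
    by (rule sum.reindex_bij_witness[of _ swap24 swap24]) (auto simp: onW_def ac_simps)
  finally have "int (card {x \<in> units4. int p dvd quartic lam x}) = S (\<lambda>_. 1) + 3 * S lg12" by simp
  also have "\<dots> = S (\<lambda>y. 1 + 3 * lg12 y)" by (simp only: S_add S_mult)
  finally show ?thesis unfolding S_def .
qed

definition onW1 :: "nat \<times> nat \<times> nat \<times> nat \<Rightarrow> bool" where
  "onW1 y \<longleftrightarrow> sum4 y mod p = 1 \<and> [256 * lam ^ 4 * int (prod4 y) = 1] (mod int p)"

lemma onW1_iff: "onW1 y \<longleftrightarrow> sum4 y mod p = 1 \<and> onW y"
proof -
  have "[int (sum4 y) ^ 4 = 1] (mod int p)" if "sum4 y mod p = 1"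
  proof -
    have "[int (sum4 y) = 1] (mod int p)" using that gt2 by (simp add: cong_def flip: of_nat_mod)
    from cong_pow[OF this, of 4] show ?thesis by simp
  qed
  then show ?thesis unfolding onW1_def onW_def by (auto simp: cong_def)
qed

text \<open>On \<open>onW\<close> the coordinate sum is nonzero, because the other side is a unit.
  Scaling moves every nonzero sum to 1, and the weight has even degree, so \<open>p - 1\<close>
  equal slices arise.\<close>

lemma torus_count:
  "int (card {x \<in> units4. int p dvd quartic lam x}) = (int p - 1) * (\<Sum>y\<in>units4. of_bool (onW1 y) * (1 + 3 * lg12 y))"
proof -
  define v where "v y = (1 + 3 * lg12 y)" for y
  have v: "v (scale4 s y) = v y" if "s \<in> {1..<p}" for s y
  proof -
    obtain y1 y2 y3 y4 where y: "y = (y1, y2, y3, y4)" by (cases y)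
    have "lg (int s) * lg (int s) = 1" using lg_square[OF unit_range(2)[OF that]] by (simp add: lg_mult)
    then have "lg (int s) * lg (int y1) * (lg (int s) * lg (int y2)) = lg (int y1) * lg (int y2)"
      by (simp add: algebra_simps)
    then show ?thesis unfolding y v_def scale4.simps lg12.simps lg_scale by simp
  qed
  have nz: "sum4 y mod p \<noteq> 0" if "y \<in> units4" "onW y" for y
  proof
    assume "sum4 y mod p = 0"
    then have "int p dvd int (sum4 y)" by (simp add: mod_eq_0_iff_dvd)
    then have "int p dvd int (sum4 y) ^ 4" unfolding power4_eq_xxxx by (intro dvd_mult2)
    then have "int p dvd 256 * lam ^ 4 * int (prod4 y)" using that(2) by (simp add: onW_def cong_dvd_iff)
    moreover obtain y1 y2 y3 y4 where y: "y = (y1, y2, y3, y4)" by (cases y)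
    have "\<not> int p dvd 256 * lam ^ 4 * int (prod4 y)"
      using that(1) not_dvd_256 not_dvd_power[OF lam, of 4] unfolding y prod4.simps of_nat_mult not_dvd_mult by (auto intro!: unit_range(2))
    ultimately show False by simp
  qed
  have "(\<Sum>y\<in>units4. of_bool (onW y) * v y) = (\<Sum>y\<in>units4. \<Sum>s\<in>{1..<p}. of_bool (sum4 y mod p = s) * (of_bool (onW y) * v y))"
  proof (rule sum.cong[OF refl])
    fix y assume y: "y \<in> units4"
    show "of_bool (onW y) * v y = (\<Sum>s\<in>{1..<p}. of_bool (sum4 y mod p = s) * (of_bool (onW y) * v y))"
    proof (cases "onW y")
      case True
      then have m: "sum4 y mod p \<in> {1..<p}" using nz[OF y] by (simp add: Suc_le_eq)
      have "(\<Sum>s\<in>{1..<p}. of_bool (sum4 y mod p = s) * v y) = (\<Sum>s\<in>{1..<p}. if sum4 y mod p = s then v y else 0)"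
        by (rule sum.cong) auto
      then show ?thesis using True m by simp
    qed simp
  qed
  also have "\<dots> = (\<Sum>s\<in>{1..<p}. \<Sum>y\<in>units4. of_bool (sum4 y mod p = s) * (of_bool (onW y) * v y))"
    by (rule sum.swap)
  also have "\<dots> = (\<Sum>s\<in>{1..<p}. \<Sum>y\<in>units4. of_bool (onW1 y) * v y)"
  proof (rule sum.cong[OF refl])
    fix s assume s: "s \<in> {1..<p}"
    note ns = unit_range(1)[OF s]
    have iff: "sum4 (scale4 s y) mod p = s \<longleftrightarrow> sum4 y mod p = 1" for y
    proof -
      have "coprime s p" using prime_imp_coprime[OF prime ns] by (simp only: coprime_commute)
      then have "[s * sum4 y = s * 1] (mod p) \<longleftrightarrow> [sum4 y = 1] (mod p)" by (rule cong_mult_lcancel_nat)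
      moreover have "s mod p = s" "1 mod p = 1" using s by simp_all
      ultimately show ?thesis using sum4_scale4[of s y] unfolding cong_def by simp
    qed
    have "(\<Sum>y\<in>units4. of_bool (sum4 y mod p = s) * (of_bool (onW y) * v y))
      = (\<Sum>y\<in>units4. of_bool (sum4 (scale4 s y) mod p = s) * (of_bool (onW (scale4 s y)) * v (scale4 s y)))"
      by (rule sum.reindex_bij_betw[OF bij_scale4[OF ns], symmetric])
    also have "\<dots> = (\<Sum>y\<in>units4. of_bool (onW1 y) * v y)"
      unfolding iff onW_scale[OF ns] v[OF s] onW1_iff by (rule sum.cong) auto
    finally show "(\<Sum>y\<in>units4. of_bool (sum4 y mod p = s) * (of_bool (onW y) * v y)) = (\<Sum>y\<in>units4. of_bool (onW1 y) * v y)" .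
  qed
  also have "\<dots> = (int p - 1) * (\<Sum>y\<in>units4. of_bool (onW1 y) * v y)"
    using gt2 by (simp only: sum_constant card_atLeastLessThan of_nat_diff) (simp add: of_nat_diff)
  finally show ?thesis unfolding torus_count_aux v_def .
qed

end

context prime_3_mod_4
begin

section \<open>Counting projective points\<close>

abbreviation units3 :: "(nat \<times> nat \<times> nat) set" where
  "units3 \<equiv> {1..<p} \<times> {1..<p} \<times> {1..<p}"

lemma lg_p_diff: "y \<le> p \<Longrightarrow> lg (int (p - y)) = - lg (int y)"
proof -
  assume "y \<le> p"
  then have "lg (int (p - y)) = lg (- int y)" by (intro lg_cong) (simp add: of_nat_diff cong_iff_dvd_diff)
  then show ?thesis by (simp add: lg_minus)
qed

lemma sum_lg: "(\<Sum>y\<in>{1..<p}. lg (int y)) = 0"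
proof -
  have "(\<Sum>y\<in>{1..<p}. lg (int y)) = (\<Sum>y\<in>{1..<p}. lg (int (p - y)))"
    by (rule sum.reindex_bij_witness[of _ "\<lambda>y. p - y" "\<lambda>y. p - y"]) auto
  also have "\<dots> = (\<Sum>y\<in>{1..<p}. - lg (int y))" by (rule sum.cong[OF refl], rule lg_p_diff) simp
  finally show ?thesis by (simp add: sum_negf)
qed

lemma sum_dvd_complement:
  fixes g :: "nat \<Rightarrow> int"
  assumes "b \<in> {1..<p}"
  shows "(\<Sum>a\<in>{1..<p}. of_bool (p dvd b + a) * g a) = g (p - b)"
proof -
  have "(\<Sum>a\<in>{1..<p}. of_bool (p dvd b + a) * g a) = (\<Sum>a\<in>{1..<p}. if a = p - b then g a else 0)"
  proof (rule sum.cong[OF refl])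
    fix a assume a: "a \<in> {1..<p}"
    have "p dvd b + a \<longleftrightarrow> a = p - b"
    proof
      assume "p dvd b + a"
      then obtain k where k: "b + a = p * k" ..
      have "p * k < p * 2" using a assms unfolding k[symmetric] by simp
      then have "k < 2" by simp
      moreover have "k \<noteq> 0" using k a by (cases k) auto
      ultimately have "k = 1" by simp
      then show "a = p - b" using k by simp
    qed (use assms in simp)
    then show "of_bool (p dvd b + a) * g a = (if a = p - b then g a else 0)" by simp
  qed
  also have "\<dots> = g (p - b)" using assms by auto
  finally show ?thesis .
qed

text \<open>Two coordinates determine the third, which is a unit unless the two are
  opposite.\<close>

lemma sum_units3_plane:
  fixes g :: "nat \<Rightarrow> nat \<Rightarrow> int"
  shows "(\<Sum>(y1, y2, y3)\<in>units3. of_bool (p dvd y1 + y2 + y3) * g y1 y2)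
    = (\<Sum>y1\<in>{1..<p}. \<Sum>y2\<in>{1..<p}. g y1 y2) - (\<Sum>y1\<in>{1..<p}. g y1 (p - y1))"
proof -
  have third: "(\<Sum>y3\<in>{1..<p}. of_bool (p dvd y1 + y2 + y3) :: int) = 1 - of_bool (p dvd y1 + y2)" for y1 y2
  proof (cases "p dvd y1 + y2")
    case True
    then have "\<not> p dvd y1 + y2 + y3" if "y3 \<in> {1..<p}" for y3
      using unit_range(1)[OF that] by (simp add: dvd_add_right_iff)
    then show ?thesis using True by (simp add: sum.neutral)
  next
    case False
    define b where "b = (y1 + y2) mod p"
    have b: "b \<in> {1..<p}" using False by (auto simp: b_def dvd_eq_mod_eq_0 Suc_le_eq)
    have "p dvd y1 + y2 + y3 \<longleftrightarrow> p dvd b + y3" for y3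
      unfolding b_def by (simp add: dvd_eq_mod_eq_0 mod_add_left_eq)
    then show ?thesis using sum_dvd_complement[OF b, of "\<lambda>_. 1"] False by simp
  qed
  have "(\<Sum>(y1, y2, y3)\<in>units3. of_bool (p dvd y1 + y2 + y3) * g y1 y2)
     = (\<Sum>y1\<in>{1..<p}. \<Sum>y2\<in>{1..<p}. \<Sum>y3\<in>{1..<p}. of_bool (p dvd y1 + y2 + y3) * g y1 y2)"
    by (simp only: sum.cartesian_product case_prod_unfold fst_conv snd_conv)
  also have "\<dots> = (\<Sum>y1\<in>{1..<p}. \<Sum>y2\<in>{1..<p}. g y1 y2 - of_bool (p dvd y1 + y2) * g y1 y2)"
    by (simp only: sum_distrib_right[symmetric] third left_diff_distrib mult_1_left)
  also have "\<dots> = (\<Sum>y1\<in>{1..<p}. \<Sum>y2\<in>{1..<p}. g y1 y2) - (\<Sum>y1\<in>{1..<p}. \<Sum>y2\<in>{1..<p}. of_bool (p dvd y1 + y2) * g y1 y2)"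
    by (simp only: sum_subtractf)
  also have "(\<Sum>y1\<in>{1..<p}. \<Sum>y2\<in>{1..<p}. of_bool (p dvd y1 + y2) * g y1 y2) = (\<Sum>y1\<in>{1..<p}. g y1 (p - y1))"
    by (rule sum.cong[OF refl sum_dvd_complement])
  finally show ?thesis .
qed

lemma sum_pow4_units3:
  fixes G :: "nat \<Rightarrow> nat \<Rightarrow> nat \<Rightarrow> int"
  shows "(\<Sum>(x1, x2, x3)\<in>units3. G (x1 ^ 4 mod p) (x2 ^ 4 mod p) (x3 ^ 4 mod p))
    = (\<Sum>(y1, y2, y3)\<in>units3. (1 + lg (int y1)) * ((1 + lg (int y2)) * ((1 + lg (int y3)) * G y1 y2 y3)))"
proof -
  have nest: "(\<Sum>(y1, y2, y3)\<in>units3. H y1 y2 y3) = (\<Sum>y1\<in>{1..<p}. \<Sum>y2\<in>{1..<p}. \<Sum>y3\<in>{1..<p}. H y1 y2 y3)" for H :: "nat \<Rightarrow> nat \<Rightarrow> nat \<Rightarrow> int"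
    by (simp only: sum.cartesian_product case_prod_unfold fst_conv snd_conv)
  show ?thesis unfolding nest
    unfolding sum_pow4[of "\<lambda>x3. G _ _ x3"]
    unfolding sum_pow4[of "\<lambda>x2. \<Sum>y3\<in>{1..<p}. (1 + lg (int y3)) * G _ x2 y3"]
    unfolding sum_pow4[of "\<lambda>x1. \<Sum>y2\<in>{1..<p}. (1 + lg (int y2)) * (\<Sum>y3\<in>{1..<p}. (1 + lg (int y3)) * G x1 y2 y3)"]
    by (simp only: sum_distrib_left mult.assoc)
qed

definition fermat3 :: "(nat \<times> nat \<times> nat) set" where
  "fermat3 = {(x1, x2, x3). (x1, x2, x3) \<in> units3 \<and> int p dvd int x1 ^ 4 + int x2 ^ 4 + int x3 ^ 4}"

text \<open>In the expansion of the product of the \<open>1 + lg y_i\<close> the odd degrees cancel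
  under negation; the constant gives \<open>(p - 1) * (p - 2)\<close> and each of the three pairs
  gives \<open>p - 1\<close>.\<close>

lemma card_fermat3: "int (card fermat3) = (int p - 1) * (int p + 1)"
proof -
  define S where "S g = (\<Sum>(y1, y2, y3)\<in>units3. of_bool (p dvd y1 + y2 + y3) * g y1 y2 y3)" for g :: "nat \<Rightarrow> nat \<Rightarrow> nat \<Rightarrow> int"
  have S_add: "S (\<lambda>y1 y2 y3. g y1 y2 y3 + h y1 y2 y3) = S g + S h" for g h
    by (simp only: S_def distrib_left sum.distrib case_prod_unfold)
  define f where "f y = lg (int y)" for y
  have f_neg: "f (p - y) = - f y" if "y \<le> p" for y unfolding f_def by (rule lg_p_diff[OF that])
  have odd: "S g = 0" if g: "\<And>y1 y2 y3. y1 \<le> p \<Longrightarrow> y2 \<le> p \<Longrightarrow> y3 \<le> p \<Longrightarrow> g (p - y1) (p - y2) (p - y3) = - g y1 y2 y3" for g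
  proof -
    have dv: "p dvd (p - y1) + (p - y2) + (p - y3) \<longleftrightarrow> p dvd y1 + y2 + y3" if "y1 \<le> p" "y2 \<le> p" "y3 \<le> p" for y1 y2 y3
    proof -
      have "(p - y1) + (p - y2) + (p - y3) + (y1 + y2 + y3) = 3 * p" using that by simp
      then show ?thesis by (metis dvd_add_left_iff dvd_add_right_iff dvd_triv_right)
    qed
    have "S g = (\<Sum>(y1, y2, y3)\<in>units3. of_bool (p dvd (p - y1) + (p - y2) + (p - y3)) * g (p - y1) (p - y2) (p - y3))"
      unfolding S_def
      by (rule sum.reindex_bij_witness[of _ "\<lambda>(y1, y2, y3). (p - y1, p - y2, p - y3)" "\<lambda>(y1, y2, y3). (p - y1, p - y2, p - y3)"]) auto
    also have "\<dots> = (\<Sum>(y1, y2, y3)\<in>units3. - (of_bool (p dvd y1 + y2 + y3) * g y1 y2 y3))"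
    proof (rule sum.cong[OF refl])
      fix y assume y: "y \<in> units3"
      obtain y1 y2 y3 where e: "y = (y1, y2, y3)" by (cases y)
      have le: "y1 \<le> p" "y2 \<le> p" "y3 \<le> p" using y unfolding e by auto
      show "(case y of (y1, y2, y3) \<Rightarrow> of_bool (p dvd (p - y1) + (p - y2) + (p - y3)) * g (p - y1) (p - y2) (p - y3))
          = (case y of (y1, y2, y3) \<Rightarrow> - (of_bool (p dvd y1 + y2 + y3) * g y1 y2 y3))"
        unfolding e prod.case by (simp only: dv[OF le] g[OF le] mult_minus_right)
    qed
    also have "\<dots> = - S g" by (simp add: S_def case_prod_unfold sum_negf)
    finally show ?thesis by simp
  qed
  have p1: "int (p - 1) = int p - 1" using gt2 by (simp add: of_nat_diff)
  have S1: "S (\<lambda>_ _ _. 1) = (int p - 1) * (int p - 1) - (int p - 1)"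
    unfolding S_def sum_units3_plane[of "\<lambda>_ _. 1"] by (simp only: sum_constant card_atLeastLessThan p1 mult_1_right)
  have S12: "S (\<lambda>y1 y2 y3. f y1 * f y2) = int p - 1"
  proof -
    have "(\<Sum>y1\<in>{1..<p}. \<Sum>y2\<in>{1..<p}. f y1 * f y2) = 0"
      using sum_lg by (simp only: f_def sum_distrib_left[symmetric] mult_zero_right sum.neutral_const)
    moreover have "(\<Sum>y1\<in>{1..<p}. f y1 * f (p - y1)) = (\<Sum>y1\<in>{1..<p}. - 1)"
    proof (rule sum.cong[OF refl])
      fix y assume y: "y \<in> {1..<p}"
      have "f (p - y) = - f y" using y by (simp add: f_neg)
      then show "f y * f (p - y) = - 1" using lg_unit[OF unit_range(2)[OF y]] by (auto simp: f_def)
    qed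
    ultimately show ?thesis unfolding S_def sum_units3_plane[of "\<lambda>y1 y2. f y1 * f y2"]
      by (simp only: sum_constant card_atLeastLessThan p1) simp
  qed
  have S13: "S (\<lambda>y1 y2 y3. f y1 * f y3) = int p - 1"
    unfolding S12[symmetric] S_def
    by (rule sum.reindex_bij_witness[of _ "\<lambda>(y1, y2, y3). (y1, y3, y2)" "\<lambda>(y1, y2, y3). (y1, y3, y2)"]) (auto simp: add_ac)
  have S23: "S (\<lambda>y1 y2 y3. f y2 * f y3) = int p - 1"
    unfolding S12[symmetric] S_def
    by (rule sum.reindex_bij_witness[of _ "\<lambda>(y1, y2, y3). (y3, y1, y2)" "\<lambda>(y1, y2, y3). (y2, y3, y1)"]) (auto simp: add_ac)
  have dv: "int p dvd int x1 ^ 4 + int x2 ^ 4 + int x3 ^ 4 \<longleftrightarrow> p dvd x1 ^ 4 mod p + x2 ^ 4 mod p + x3 ^ 4 mod p" for x1 x2 x3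
  proof -
    have "int p dvd int x1 ^ 4 + int x2 ^ 4 + int x3 ^ 4 \<longleftrightarrow> p dvd x1 ^ 4 + x2 ^ 4 + x3 ^ 4"
      by (simp flip: of_nat_power of_nat_add)
    also have "\<dots> \<longleftrightarrow> p dvd x1 ^ 4 mod p + x2 ^ 4 mod p + x3 ^ 4 mod p"
    proof (rule cong_dvd_iff)
      have "[z = z mod p] (mod p)" for z by (simp add: cong_def)
      then show "[x1 ^ 4 + x2 ^ 4 + x3 ^ 4 = x1 ^ 4 mod p + x2 ^ 4 mod p + x3 ^ 4 mod p] (mod p)" by (intro cong_add)
    qed
    finally show ?thesis .
  qed
  have "fermat3 = {x \<in> units3. case x of (x1, x2, x3) \<Rightarrow> p dvd x1 ^ 4 mod p + x2 ^ 4 mod p + x3 ^ 4 mod p}"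
    unfolding fermat3_def dv by auto
  then have "int (card fermat3) = (\<Sum>x\<in>units3. of_bool (case x of (x1, x2, x3) \<Rightarrow> p dvd x1 ^ 4 mod p + x2 ^ 4 mod p + x3 ^ 4 mod p))"
    by (simp only: card_filter_of_bool finite_cartesian_product finite_atLeastLessThan)
  also have "\<dots> = (\<Sum>(x1, x2, x3)\<in>units3. of_bool (p dvd x1 ^ 4 mod p + x2 ^ 4 mod p + x3 ^ 4 mod p))"
    by (simp only: case_prod_unfold)
  also have "\<dots> = (\<Sum>(y1, y2, y3)\<in>units3. (1 + lg (int y1)) * ((1 + lg (int y2)) * ((1 + lg (int y3)) * of_bool (p dvd y1 + y2 + y3))))"
    by (rule sum_pow4_units3[of "\<lambda>y1 y2 y3. of_bool (p dvd y1 + y2 + y3)"])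
  also have "\<dots> = S (\<lambda>y1 y2 y3. 1 + (f y1 * f y2 + (f y1 * f y3 + (f y2 * f y3 + (f y1 + f y2 + f y3 + f y1 * f y2 * f y3)))))"
    unfolding S_def f_def by (rule sum.cong[OF refl]) (auto simp: algebra_simps)
  also have "\<dots> = (int p - 1) * (int p - 1) - (int p - 1) + (int p - 1 + (int p - 1 + (int p - 1 + 0)))"
    unfolding S_add[of "\<lambda>_ _ _. 1"] S_add[of "\<lambda>y1 y2 y3. f y1 * f y2"] S_add[of "\<lambda>y1 y2 y3. f y1 * f y3"] S_add[of "\<lambda>y1 y2 y3. f y2 * f y3"] S1 S12 S13 S23
    by (subst odd) (simp_all add: f_neg)
  also have "\<dots> = (int p - 1) * (int p + 1)" by (simp add: algebra_simps)
  finally show ?thesis .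
qed

text \<open>A nontrivial zero would make \<open>- 1\<close> a square. Hence no point of the surface
  has two or more vanishing coordinates.\<close>

lemma sum_two_fourth_powers: "int p dvd a ^ 4 + b ^ 4 \<longleftrightarrow> int p dvd a \<and> int p dvd b"
proof
  assume d: "int p dvd a ^ 4 + b ^ 4"
  have "int p dvd b"
  proof (rule ccontr)
    assume b: "\<not> int p dvd b"
    have "[a ^ 4 = - (b ^ 4)] (mod int p)" using d by (simp add: cong_iff_dvd_diff)
    then have "lg (a ^ 4) = - lg (b ^ 4)" by (simp add: lg_cong flip: lg_minus)
    moreover have "lg (b ^ 4) = 1"
      using lg_square[of "b * b"] b by (simp add: power4_eq_xxxx not_dvd_mult mult.assoc)
    ultimately have "lg a * lg a * (lg a * lg a) = - 1" by (simp add: power4_eq_xxxx lg_mult mult.assoc)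
    then show False using lg_range[of a] by auto
  qed
  moreover from this have "int p dvd b ^ 4" by (simp add: power4_eq_xxxx)
  then have "int p dvd a ^ 4" using d by (simp add: dvd_add_left_iff)
  then have "int p dvd a" using prime_dvd_power[OF prime_int] by blast
  ultimately show "int p dvd a \<and> int p dvd b" by simp
next
  assume "int p dvd a \<and> int p dvd b"
  then show "int p dvd a ^ 4 + b ^ 4" by (simp add: power4_eq_xxxx)
qed

end

context dwork_setting
begin

section \<open>Solutions with and without a zero coordinate\<close>

definition affine_nat :: "(nat \<times> nat \<times> nat \<times> nat) set" where
  "affine_nat = {x \<in> {..<p} \<times> {..<p} \<times> {..<p} \<times> {..<p}. x \<noteq> (0, 0, 0, 0) \<and> int p dvd quartic lam x}"

lemma affine_nat_decomp:
  "affine_nat = {x \<in> units4. int p dvd quartic lam x} \<union> ((\<lambda>(a, b, c). (0, a, b, c)) ` fermat3 \<union> ((\<lambda>(a, b, c). (a, 0, b, c)) ` fermat3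
     \<union> ((\<lambda>(a, b, c). (a, b, 0, c)) ` fermat3 \<union> (\<lambda>(a, b, c). (a, b, c, 0)) ` fermat3)))" (is "_ = ?R")
proof (intro equalityI subsetI)
  fix x assume x: "x \<in> affine_nat"
  obtain x1 x2 x3 x4 where e: "x = (x1, x2, x3, x4)" by (cases x)
  have r: "x1 < p" "x2 < p" "x3 < p" "x4 < p" "\<not> (x1 = 0 \<and> x2 = 0 \<and> x3 = 0 \<and> x4 = 0)"
    "int p dvd int x1 ^ 4 + int x2 ^ 4 + int x3 ^ 4 + int x4 ^ 4 - 4 * lam * int x1 * int x2 * int x3 * int x4"
    using x unfolding e affine_nat_def by auto
  have z: "int p dvd int a \<longleftrightarrow> a = 0" if "a < p" for a using that by (auto dest: dvd_imp_le)
  have two: "a = 0 \<and> b = 0" if "int p dvd int a ^ 4 + int b ^ 4" "a < p" "b < p" for a b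
    using that sum_two_fourth_powers[of "int a" "int b"] z by simp
  have f: "(a, b, c) \<in> fermat3" if "int p dvd int a ^ 4 + int b ^ 4 + int c ^ 4" "a < p" "b < p" "c < p" "a \<noteq> 0 \<or> b \<noteq> 0 \<or> c \<noteq> 0" for a b c
  proof -
    have "a \<noteq> 0" using two[of b c] that by (cases "a = 0") simp_all
    moreover have "b \<noteq> 0" using two[of a c] that by (cases "b = 0") simp_all
    moreover have "c \<noteq> 0" using two[of a b] that by (cases "c = 0") simp_all
    ultimately show ?thesis using that unfolding fermat3_def by simp
  qed
  show "x \<in> ?R"
  proof (cases "x1 = 0 \<or> x2 = 0 \<or> x3 = 0 \<or> x4 = 0")
    case False
    then show ?thesis using x r unfolding e affine_nat_def by auto
  next
    case True
    then consider "x1 = 0" | "x2 = 0" | "x3 = 0" | "x4 = 0" by blast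
    then show ?thesis
    proof cases
      case 1
      then have "(x2, x3, x4) \<in> fermat3" using r by (intro f) auto
      then show ?thesis unfolding e 1 by force
    next
      case 2
      then have "(x1, x3, x4) \<in> fermat3" using r by (intro f) auto
      then show ?thesis unfolding e 2 by force
    next
      case 3
      then have "(x1, x2, x4) \<in> fermat3" using r by (intro f) auto
      then show ?thesis unfolding e 3 by force
    next
      case 4
      then have "(x1, x2, x3) \<in> fermat3" using r by (intro f) auto
      then show ?thesis unfolding e 4 by force
    qed
  qed
next
  fix x assume "x \<in> ?R"
  then show "x \<in> affine_nat" unfolding affine_nat_def fermat3_def by auto
qed

lemma card_affine_nat:
  "int (card affine_nat) = (int p - 1) * ((\<Sum>y\<in>units4. of_bool (onW1 y) * (1 + 3 * lg12 y)) + 4 * (int p + 1))"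
proof -
  have "finite fermat3" by (rule finite_subset[of _ units3]) (auto simp: fermat3_def)
  note fin = this
  have pos: "a \<noteq> 0 \<and> b \<noteq> 0 \<and> c \<noteq> 0" if "(a, b, c) \<in> fermat3" for a b c
    using that by (auto simp: fermat3_def)
  define T where "T = {x \<in> units4. int p dvd quartic lam x}"
  have posT: "a \<noteq> 0 \<and> b \<noteq> 0 \<and> c \<noteq> 0 \<and> d \<noteq> 0" if "(a, b, c, d) \<in> T" for a b c d
    using that by (auto simp: T_def)
  have finT: "finite T" by (simp add: T_def)
  define A where "A = (\<lambda>(a, b, c). (0 :: nat, a, b, c)) ` fermat3"
  define B where "B = (\<lambda>(a, b, c). (a, 0 :: nat, b, c)) ` fermat3"
  define C where "C = (\<lambda>(a, b, c). (a, b, 0 :: nat, c)) ` fermat3"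
  define D where "D = (\<lambda>(a, b, c). (a, b, c, 0 :: nat)) ` fermat3"
  have finABCD: "finite A" "finite B" "finite C" "finite D" by (simp_all add: A_def B_def C_def D_def fin)
  have "C \<inter> D = {}" "B \<inter> (C \<union> D) = {}" "A \<inter> (B \<union> (C \<union> D)) = {}" "T \<inter> (A \<union> (B \<union> (C \<union> D))) = {}"
    unfolding A_def B_def C_def D_def using pos posT by fastforce+
  then have "card affine_nat = card T + (card A + (card B + (card C + card D)))"
    unfolding affine_nat_decomp T_def[symmetric] A_def[symmetric] B_def[symmetric] C_def[symmetric] D_def[symmetric]
    by (simp add: card_Un_disjoint finT finABCD)
  moreover have "card ((\<lambda>(a, b, c). (0 :: nat, a, b, c)) ` fermat3) = card fermat3" by (rule card_image) (auto simp: inj_on_def)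
  moreover have "card ((\<lambda>(a, b, c). (a, 0 :: nat, b, c)) ` fermat3) = card fermat3" by (rule card_image) (auto simp: inj_on_def)
  moreover have "card ((\<lambda>(a, b, c). (a, b, 0 :: nat, c)) ` fermat3) = card fermat3" by (rule card_image) (auto simp: inj_on_def)
  moreover have "card ((\<lambda>(a, b, c). (a, b, c, 0 :: nat)) ` fermat3) = card fermat3" by (rule card_image) (auto simp: inj_on_def)
  ultimately have "int (card affine_nat) = int (card {x \<in> units4. int p dvd quartic lam x}) + 4 * int (card fermat3)"
    by (simp add: T_def A_def B_def C_def D_def)
  then show ?thesis unfolding torus_count card_fermat3 by (simp add: algebra_simps)
qed

lemma card_affine_sols: "card (dwork_affine_sols p lam) = card affine_nat"
proof -
  have "bij_betw (\<lambda>(x1, x2, x3, x4). (int x1, int x2, int x3, int x4)) affine_nat (dwork_affine_sols p lam)"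
  proof (rule bij_betw_byWitness[where f' = "\<lambda>(x1, x2, x3, x4). (nat x1, nat x2, nat x3, nat x4)"])
    show "(\<lambda>(x1, x2, x3, x4). (int x1, int x2, int x3, int x4)) ` affine_nat \<subseteq> dwork_affine_sols p lam"
      by (auto simp: affine_nat_def dwork_affine_sols_def mod_eq_0_iff_dvd)
    show "(\<lambda>(x1, x2, x3, x4). (nat x1, nat x2, nat x3, nat x4)) ` dwork_affine_sols p lam \<subseteq> affine_nat"
      by (auto simp: affine_nat_def dwork_affine_sols_def mod_eq_0_iff_dvd)
  qed (auto simp: affine_nat_def dwork_affine_sols_def)
  then show ?thesis by (simp add: bij_betw_same_card)
qed

section \<open>Projective points as orbits of the scalars\<close>

fun zscale :: "int \<Rightarrow> int \<times> int \<times> int \<times> int \<Rightarrow> int \<times> int \<times> int \<times> int" where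
  "zscale c (x1, x2, x3, x4) = (c * x1 mod int p, c * x2 mod int p, c * x3 mod int p, c * x4 mod int p)"

lemma proj_class_image: "proj_class p x = (\<lambda>c. zscale c x) ` {1..<int p}"
  by (cases x) (auto simp: proj_class_def)

lemma unit_int: "c \<in> {1..<int p} \<Longrightarrow> \<not> int p dvd c"
  by (auto dest: zdvd_imp_le)

lemma proj_class_subset:
  assumes "x \<in> dwork_affine_sols p lam" shows "proj_class p x \<subseteq> dwork_affine_sols p lam"
proof
  fix z assume "z \<in> proj_class p x"
  then obtain c where c: "c \<in> {1..<int p}" "z = zscale c x" by (auto simp: proj_class_image)
  obtain x1 x2 x3 x4 where x: "x = (x1, x2, x3, x4)" by (cases x)
  have nc: "\<not> int p dvd c" using unit_int[OF c(1)] .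
  have sol: "int p dvd x1 ^ 4 + x2 ^ 4 + x3 ^ 4 + x4 ^ 4 - 4 * lam * x1 * x2 * x3 * x4"
    using assms by (simp add: x dwork_affine_sols_def mod_eq_0_iff_dvd)
  have red: "[c * t mod int p = c * t] (mod int p)" for t by (simp add: cong_def)
  have "[(c * x1 mod int p) ^ 4 + (c * x2 mod int p) ^ 4 + (c * x3 mod int p) ^ 4 + (c * x4 mod int p) ^ 4 - 4 * lam * (c * x1 mod int p) * (c * x2 mod int p) * (c * x3 mod int p) * (c * x4 mod int p)
     = (c * x1) ^ 4 + (c * x2) ^ 4 + (c * x3) ^ 4 + (c * x4) ^ 4 - 4 * lam * (c * x1) * (c * x2) * (c * x3) * (c * x4)] (mod int p)"
    by (intro cong_diff cong_add cong_mult cong_pow cong_refl red)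
  also have "(c * x1) ^ 4 + (c * x2) ^ 4 + (c * x3) ^ 4 + (c * x4) ^ 4 - 4 * lam * (c * x1) * (c * x2) * (c * x3) * (c * x4)
     = c ^ 4 * (x1 ^ 4 + x2 ^ 4 + x3 ^ 4 + x4 ^ 4 - 4 * lam * x1 * x2 * x3 * x4)"
    by (simp add: power4_eq_xxxx algebra_simps)
  finally have d: "int p dvd (c * x1 mod int p) ^ 4 + (c * x2 mod int p) ^ 4 + (c * x3 mod int p) ^ 4 + (c * x4 mod int p) ^ 4 - 4 * lam * (c * x1 mod int p) * (c * x2 mod int p) * (c * x3 mod int p) * (c * x4 mod int p)"
    using sol by (simp only: cong_dvd_iff) simp
  have zero: "t = 0" if "c * t mod int p = 0" "t \<in> {0..<int p}" for t
  proof -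
    have "int p dvd c * t" using that by (simp add: mod_eq_0_iff_dvd)
    then have "int p dvd t" using nc prime_dvd_mult_iff[OF prime_int] by blast
    then show ?thesis using that(2) zdvd_imp_le[of "int p" t] by (cases "t = 0") auto
  qed
  have rx: "x1 \<in> {0..<int p}" "x2 \<in> {0..<int p}" "x3 \<in> {0..<int p}" "x4 \<in> {0..<int p}" "(x1, x2, x3, x4) \<noteq> (0, 0, 0, 0)"
    using assms by (simp_all add: x dwork_affine_sols_def)
  have "z \<noteq> (0, 0, 0, 0)"
  proof
    assume "z = (0, 0, 0, 0)"
    then have "c * x1 mod int p = 0" "c * x2 mod int p = 0" "c * x3 mod int p = 0" "c * x4 mod int p = 0"
      by (simp_all add: c x)
    then show False using zero[OF _ rx(1)] zero[OF _ rx(2)] zero[OF _ rx(3)] zero[OF _ rx(4)] rx(5) by simp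
  qed
  then show "z \<in> dwork_affine_sols p lam" using d by (simp add: c x dwork_affine_sols_def mod_eq_0_iff_dvd)
qed

lemma card_proj_class:
  assumes "x \<in> dwork_affine_sols p lam" shows "card (proj_class p x) = p - 1"
proof -
  obtain x1 x2 x3 x4 where x: "x = (x1, x2, x3, x4)" by (cases x)
  have "inj_on (\<lambda>c. zscale c x) {1..<int p}"
  proof (rule inj_onI)
    fix c d assume cd: "c \<in> {1..<int p}" "d \<in> {1..<int p}" "zscale c x = zscale d x"
    have "\<exists>t. t \<in> {1..<int p} \<and> c * t mod int p = d * t mod int p"
    proof -
      have "t \<in> {1..<int p} \<and> c * t mod int p = d * t mod int p" if "t \<in> {x1, x2, x3, x4}" "t \<noteq> 0" for t
        using that assms cd(3) by (auto simp: x dwork_affine_sols_def)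
      moreover have "x1 \<noteq> 0 \<or> x2 \<noteq> 0 \<or> x3 \<noteq> 0 \<or> x4 \<noteq> 0"
        using assms by (auto simp: x dwork_affine_sols_def)
      ultimately show ?thesis by blast
    qed
    then obtain t where t: "t \<in> {1..<int p}" "c * t mod int p = d * t mod int p" by blast
    have "coprime t (int p)" using prime_imp_coprime[OF prime_int unit_int[OF t(1)]] by (simp only: coprime_commute)
    then have "[c = d] (mod int p)" using t(2) cong_mult_rcancel[of t "int p" c d] by (simp add: cong_def)
    then show "c = d" using cd by (simp add: cong_def)
  qed
  then show ?thesis unfolding proj_class_image by (simp add: card_image nat_diff_distrib)
qed

lemma proj_class_self:
  "x \<in> dwork_affine_sols p lam \<Longrightarrow> x \<in> proj_class p x"
  unfolding proj_class_image using gt2 by (intro image_eqI[of _ _ 1]) (auto simp: dwork_affine_sols_def)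

lemma proj_class_eq:
  assumes "x \<in> dwork_affine_sols p lam" "z \<in> proj_class p x"
  shows "proj_class p z = proj_class p x"
proof -
  obtain c where c: "c \<in> {1..<int p}" "z = zscale c x" using assms(2) by (auto simp: proj_class_image)
  have "proj_class p z \<subseteq> proj_class p x"
  proof
    fix w assume "w \<in> proj_class p z"
    then obtain d where d: "d \<in> {1..<int p}" "w = zscale d z" by (auto simp: proj_class_image)
    have "\<not> int p dvd d * c" using unit_int c(1) d(1) not_dvd_mult by blast
    then have "d * c mod int p \<noteq> 0" by (simp add: mod_eq_0_iff_dvd)
    moreover have "0 \<le> d * c mod int p" "d * c mod int p < int p" by simp_all
    ultimately have "d * c mod int p \<in> {1..<int p}" unfolding atLeastLessThan_iff by linarith
    moreover have "w = zscale (d * c mod int p) x" unfolding d c by (cases x) (simp add: mod_simps mult.assoc)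
    ultimately show "w \<in> proj_class p x" unfolding proj_class_image by blast
  qed
  moreover have "card (proj_class p z) = card (proj_class p x)"
    using card_proj_class assms proj_class_subset by (metis subsetD)
  moreover have "finite (proj_class p x)" by (simp add: proj_class_image)
  ultimately show ?thesis by (simp add: card_subset_eq)
qed

lemma finite_affine_sols: "finite (dwork_affine_sols p lam)"
  by (rule finite_subset[of _ "{0..<int p} \<times> {0..<int p} \<times> {0..<int p} \<times> {0..<int p}"]) (auto simp: dwork_affine_sols_def)

text \<open>The scalars act freely on nonzero solutions, so the classes partition them into sets of
  size \<open>p - 1\<close>.\<close>

lemma dwork_count_classes: "(p - 1) * dwork_count p lam = card (dwork_affine_sols p lam)"
proof -
  have U: "\<Union> (proj_class p ` dwork_affine_sols p lam) = dwork_affine_sols p lam"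
    using proj_class_subset proj_class_self by blast
  have "(p - 1) * card (proj_class p ` dwork_affine_sols p lam) = card (\<Union> (proj_class p ` dwork_affine_sols p lam))"
  proof (rule card_partition)
    show "finite (proj_class p ` dwork_affine_sols p lam)" using finite_affine_sols by simp
    show "finite (\<Union> (proj_class p ` dwork_affine_sols p lam))" unfolding U by (rule finite_affine_sols)
    show "card c = p - 1" if "c \<in> proj_class p ` dwork_affine_sols p lam" for c
      using that card_proj_class by blast
    show "c1 \<inter> c2 = {}" if "c1 \<in> proj_class p ` dwork_affine_sols p lam" "c2 \<in> proj_class p ` dwork_affine_sols p lam" "c1 \<noteq> c2" for c1 c2
      using that proj_class_eq by blast
  qed
  then show ?thesis unfolding U dwork_count_def .
qed

theorem dwork_count_formula:
  "int (dwork_count p lam) = (\<Sum>y\<in>units4. of_bool (onW1 y) * (1 + 3 * lg12 y)) + 4 * (int p + 1)"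
proof -
  have "int (p - 1) = int p - 1" using gt2 by (simp add: of_nat_diff)
  then have "(int p - 1) * int (dwork_count p lam) = int (card (dwork_affine_sols p lam))"
    unfolding dwork_count_classes[symmetric] of_nat_mult by simp
  also have "\<dots> = (int p - 1) * ((\<Sum>y\<in>units4. of_bool (onW1 y) * (1 + 3 * lg12 y)) + 4 * (int p + 1))"
    unfolding card_affine_sols card_affine_nat ..
  finally show ?thesis using gt2 by simp
qed

end

section \<open>Comparison of character sums and hypergeometric terms\<close>

text \<open>\<open>M\<close> is the precision of the comparison and \<open>m\<close> the level of
  the approximations. One power of \<open>p\<close> is lost when the Jacobi sums are solved for,
  hence \<open>M < m\<close>.\<close>

locale dwork_approx = dwork_setting +
  fixes M m :: nat
  assumes M_pos: "0 < M" and M_less: "M < m"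
begin

definition q :: nat where "q = p - 1"
definition h :: nat where "h = (p - 1) div 2"
abbreviation F :: "rat \<Rightarrow> rat" where "F \<equiv> gamma_p_approx p m"
abbreviation T :: "int \<Rightarrow> rat" where "T z \<equiv> of_int (teich m z)"

definition g :: "nat \<Rightarrow> rat" where "g c = F (of_nat c / (of_nat p - 1))"

text \<open>A multiplicative group: comparing unit factors by quotients in it turns every functional
  equation into a step of a product, without tracking errors.\<close>

definition U1 :: "rat \<Rightarrow> bool" where "U1 x \<longleftrightarrow> punit x \<and> padic_eq (int M) x 1"

lemma q_pos: "0 < q" and h_less: "h < q" and h_pos: "0 < h" and q_h: "q = 2 * h" and odd_h: "odd h"
proof -
  show "q = 2 * h" unfolding q_def h_def by (rule p_minus_1_half)
  show "odd h" unfolding h_def by (rule half_p_odd)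
  then show "0 < h" by (rule odd_pos)
  with \<open>q = 2 * h\<close> show "0 < q" "h < q" by simp_all
qed

lemma of_nat_q: "of_nat q = (of_nat p - 1 :: rat)"
  using gt2 by (simp add: q_def of_nat_diff)

lemmas teich_pow_cong_q = teich_pow_cong[folded q_def]
lemmas char4_q = char4.simps[folded q_def]

lemma U1_1: "U1 1"
  by (simp add: U1_def)

lemma U1_mult: assumes "U1 x" "U1 y" shows "U1 (x * y)"
proof -
  have "padic_eq (int M) (x * y) (1 * 1)"
    using assms by (intro peq_mult) (auto simp: U1_def punit_def)
  then show ?thesis using assms by (auto simp: U1_def intro: punit_mult)
qed

lemma U1_inverse: assumes "U1 x" shows "U1 (inverse x)"
  using peq_inverse[of "int M" x 1] assms by (auto simp: U1_def intro: punit_inverse)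

lemma U1_divide: "U1 x \<Longrightarrow> U1 y \<Longrightarrow> U1 (x / y)"
  by (simp add: divide_inverse U1_mult U1_inverse)

lemma U1_power: "U1 x \<Longrightarrow> U1 (x ^ n)"
  by (induction n) (auto intro: U1_1 U1_mult)

lemma U1_I: assumes "padic_eq (int M) x y" "punit x" "punit y" shows "U1 (x / y)"
proof -
  have "padic_eq (int M) (x * inverse y) (y * inverse y)"
    using assms by (intro peq_mult_right) (auto simp: punit_def)
  moreover have "y * inverse y = 1" using assms(3) by (simp add: punit_def)
  ultimately show ?thesis using assms by (simp add: U1_def divide_inverse punit_mult punit_inverse)
qed

lemma U1_D: assumes "U1 (x / y)" "punit y" shows "padic_eq (int M) x y"
proof -
  have "padic_eq (int M) (y * (x / y)) (y * 1)" using assms by (intro peq_mult_left) (auto simp: U1_def punit_def)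
  then show ?thesis using assms(2) by (simp add: punit_def)
qed

lemma punit_g [simp]: "punit (g c)"
  by (simp add: g_def)

lemma punit_T: "\<not> int p dvd z \<Longrightarrow> punit (T z)"
  by (intro punit_of_int teich_not_dvd)

lemma cong_padic: assumes "[a = b] (mod int p ^ Suc m)" shows "padic_eq (int M) (of_int a) (of_int b)"
proof -
  have "padic_eq (int (Suc m)) (of_int a) (of_int b)" unfolding peq_of_int by (rule assms)
  then show ?thesis by (rule peq_mono) (use M_less in simp)
qed

lemma U1_T_power: assumes "\<not> int p dvd z" "[a = b] (mod q)" shows "U1 (T z ^ a / T z ^ b)"
  using cong_padic[OF teich_pow_cong_q[OF assms, of m]] punit_T[OF assms(1)]
  by (intro U1_I punit_power) simp_all

lemma U1_T_q: "\<not> int p dvd z \<Longrightarrow> U1 (T z ^ (q * n))"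
  using U1_T_power[of z "q * n" 0] by (simp add: cong_0_iff)

lemma g_0: "g 0 = 1"
  by (simp add: g_def)

lemma g_h: "g h = F (1 / 2)"
proof -
  have "of_nat q = (2 * of_nat h :: rat)" by (subst q_h) simp
  moreover have "(of_nat h :: rat) \<noteq> 0" using h_pos by simp
  ultimately have e: "of_nat h / (of_nat p - 1) = (1 / 2 :: rat)" unfolding of_nat_q using h_pos by simp
  show ?thesis unfolding g_def e ..
qed

lemma U1_reflection: assumes "0 < c" "c < q" shows "U1 (g c * g (q - c) / - ((- 1) ^ c))"
proof -
  have "0 < m" using M_pos M_less by simp
  from gamma_p_approx_reflection[folded q_def, OF assms this]
  have "padic_eq (int M) (g c * g (q - c)) (- ((- 1) ^ c))"
    unfolding g_def by (rule peq_mono) (use M_less in simp)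
  then show ?thesis by (rule U1_I) (intro punit_mult punit_g punit_minus punit_power punit_1)+
qed

lemma U1_duplication: assumes "c < q"
  shows "U1 (F (of_nat c / (of_nat p - 1) / 2) * F (of_nat c / (of_nat p - 1) / 2 + 1 / 2) / (g h * g c * T 2 ^ c))"
proof -
  have "0 < m" using M_pos M_less by simp
  from gamma_p_approx_duplication[folded q_def, OF assms this]
  have "padic_eq (int M) (F (of_nat c / (of_nat p - 1) / 2) * F (of_nat c / (of_nat p - 1) / 2 + 1 / 2)) (g h * g c * T 2 ^ c)"
    unfolding g_h unfolding g_def of_int_power[symmetric] by (rule peq_mono) (use M_less in simp)
  then show ?thesis
    by (rule U1_I) (intro punit_mult punit_g punit_power punit_gamma_p_approx punit_T not_dvd_2)+
qed

lemma U1_gh_square: "U1 (g h * g h)"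
proof -
  have "q - h = h" using q_h by linarith
  then show ?thesis using U1_reflection[OF h_pos h_less] odd_h by simp
qed

lemma double_div: "of_nat (2 * j) / y / 2 = (of_nat j / y :: rat)"
  by simp

text \<open>The duplication formula starts from the smaller of two arguments differing by one half;
  for \<open>j\<close> at least \<open>h\<close> the two factors trade places.\<close>

lemma U1_duplication_index: assumes j: "j < q"
  shows "U1 (g j * g ((j + h) mod q) / (g h * g (2 * j mod q) * T 2 ^ (2 * j)))"
proof -
  have q0: "(of_nat p - 1 :: rat) \<noteq> 0" using punit_p_minus_1 by (simp add: punit_def)
  have qh: "(of_nat p - 1 :: rat) = 2 * of_nat h" unfolding of_nat_q[symmetric] by (subst q_h) simp
  show ?thesis
  proof (cases "j < h")
    case True
    have m1: "2 * j mod q = 2 * j" "(j + h) mod q = j + h" using True q_h by simp_all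
    have a: "of_nat (2 * j) / (of_nat p - 1) / 2 = (of_nat j / (of_nat p - 1) :: rat)" by (rule double_div)
    have b: "of_nat (2 * j) / (of_nat p - 1) / 2 + 1 / 2 = (of_nat (j + h) / (of_nat p - 1) :: rat)"
      using q0 unfolding qh by (simp add: field_simps)
    have "2 * j < q" using True q_h by simp
    from U1_duplication[OF this] show ?thesis unfolding m1 b unfolding a g_def[symmetric] by simp
  next
    case False
    define c where "c = j - h"
    have jc: "j = c + h" using False by (simp add: c_def)
    have c: "c < h" using j q_h unfolding jc by simp
    have m1: "2 * j mod q = 2 * c" "(j + h) mod q = c"
    proof -
      have e: "2 * j = 2 * c + q" "j + h = c + q" using q_h unfolding jc by simp_all
      have l: "2 * c < q" "c < q" using c q_h by simp_all
      show "2 * j mod q = 2 * c" "(j + h) mod q = c" unfolding e by (simp_all only: mod_add_self2 mod_less l)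
    qed
    have a: "of_nat (2 * c) / (of_nat p - 1) / 2 = (of_nat c / (of_nat p - 1) :: rat)" by (rule double_div)
    have b: "of_nat (2 * c) / (of_nat p - 1) / 2 + 1 / 2 = (of_nat (c + h) / (of_nat p - 1) :: rat)"
      using q0 unfolding qh by (simp add: field_simps)
    have "2 * c < q" using c q_h by simp
    from U1_duplication[OF this] have 1: "U1 (g c * g j / (g h * g (2 * c) * T 2 ^ (2 * c)))"
      unfolding b unfolding a g_def[symmetric] jc by simp
    have 2: "U1 (T 2 ^ (2 * c) / T 2 ^ (2 * j))"
    proof (rule U1_T_power[OF not_dvd_2])
      have "2 * j = 2 * c + q" using q_h unfolding jc by simp
      then show "[2 * c = 2 * j] (mod q)" by (simp add: cong_def)
    qed
    have nz: "T 2 \<noteq> 0" using punit_T[OF not_dvd_2] by (simp add: punit_def)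
    have "g j * g c / (g h * g (2 * c) * T 2 ^ (2 * j)) = (g c * g j / (g h * g (2 * c) * T 2 ^ (2 * c))) * (T 2 ^ (2 * c) / T 2 ^ (2 * j))"
      using nz by simp
    then show ?thesis unfolding m1 using U1_mult[OF 1 2] by simp
  qed
qed

lemma frac_eqI: "x = a + of_int z \<Longrightarrow> 0 \<le> a \<Longrightarrow> a < 1 \<Longrightarrow> frac x = (a :: rat)"
  by (simp add: frac_unique_iff)

lemma less_quarter_iff: "of_nat j / (of_nat p - 1) < (of_nat a / 4 :: rat) \<longleftrightarrow> 4 * j < a * q"
proof -
  have "of_nat j / (of_nat p - 1) < (of_nat a / 4 :: rat) \<longleftrightarrow> of_nat (4 * j) < (of_nat (a * q) :: rat)"
    using q_pos unfolding of_nat_q[symmetric] by (simp add: field_simps)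
  then show ?thesis by (simp only: of_nat_less_iff)
qed

lemma quarter_neq: "4 * j \<noteq> q" "4 * j \<noteq> 3 * q"
  using odd_h q_h by presburger+

text \<open>The two arguments differ by one half modulo 1, so duplication applies once the smaller
  fractional part is known. It is \<open>1/4 - t\<close>, \<open>3/4 - t\<close> or
  \<open>5/4 - t\<close>, according to the position of \<open>t\<close> relative to the
  quarters.\<close>

lemma U1_quarters: assumes j: "j < q"
  defines "t \<equiv> of_nat j / (of_nat p - 1) :: rat"
  shows "U1 (F (frac (1 / 4 - t)) * F (frac (3 / 4 - t)) / (g h * g ((h + 2 * (q - j)) mod q) * T 2 ^ (h + 2 * (q - j))))"
proof -
  have qh: "(of_nat p - 1 :: rat) = 2 * of_nat h" unfolding of_nat_q[symmetric] by (subst q_h) simp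
  have t01: "0 \<le> t" "t < 1" unfolding t_def using j q_pos unfolding of_nat_q[symmetric] by (simp_all add: divide_simps)
  have lt1: "t < 1 / 4 \<longleftrightarrow> 4 * j < q" and lt3: "t < 3 / 4 \<longleftrightarrow> 4 * j < 3 * q"
    using less_quarter_iff[of j 1] less_quarter_iff[of j 3] by (simp_all add: t_def)
  have neq: "t \<noteq> 1 / 4" "t \<noteq> 3 / 4"
  proof -
    have "of_nat j / (of_nat p - 1) = (of_nat a / 4 :: rat) \<longleftrightarrow> of_nat (4 * j) = (of_nat (a * q) :: rat)" for a
      using q_pos unfolding of_nat_q[symmetric] by (simp add: field_simps)
    from this[of 1] this[of 3] show "t \<noteq> 1 / 4" "t \<noteq> 3 / 4"
      using quarter_neq[of j] unfolding of_nat_eq_iff by (simp_all add: t_def)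
  qed
  have main: ?thesis if c: "c < q" "[c = h + 2 * (q - j)] (mod q)"
    and FF: "F (frac (1 / 4 - t)) * F (frac (3 / 4 - t)) = F (of_nat c / (of_nat p - 1) / 2) * F (of_nat c / (of_nat p - 1) / 2 + 1 / 2)" for c
  proof -
    have cm: "(h + 2 * (q - j)) mod q = c" using c by (simp add: cong_def)
    have 2: "U1 (T 2 ^ c / T 2 ^ (h + 2 * (q - j)))" by (rule U1_T_power[OF not_dvd_2 c(2)])
    have nz: "T 2 \<noteq> 0" using punit_T[OF not_dvd_2] by (simp add: punit_def)
    show ?thesis unfolding cm FF using U1_mult[OF U1_duplication[OF c(1)] 2] nz by simp
  qed
  consider "4 * j < q" | "q < 4 * j" "4 * j < 3 * q" | "3 * q < 4 * j"
    using quarter_neq[of j] by linarith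
  then show ?thesis
  proof cases
    case 1
    define c where "c = h - 2 * j"
    have hc: "h = c + 2 * j" using 1 q_h by (simp add: c_def)
    have s: "of_nat c / (of_nat p - 1) / 2 = (1 / 4 - t :: rat)"
    proof -
      have "of_nat c = (of_nat h - 2 * of_nat j :: rat)" using arg_cong[OF hc, of "of_nat :: nat \<Rightarrow> rat"] by simp
      then show ?thesis unfolding t_def qh using h_pos by (simp add: field_simps)
    qed
    show ?thesis
    proof (rule main[of c])
      show "c < q" using h_less unfolding c_def by simp
      have "h + 2 * (q - j) = c + 2 * q" using hc j by simp
      then show "[c = h + 2 * (q - j)] (mod q)" by (simp add: cong_def)
      have a: "frac (1 / 4 - t) = 1 / 4 - t"
        by (rule frac_eqI[of _ _ 0]) (use 1 lt1 t01 in auto)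
      have b: "frac (3 / 4 - t) = 1 / 4 - t + 1 / 2"
        by (rule frac_eqI[of _ _ 0]) (use 1 lt1 t01 in auto)
      show "F (frac (1 / 4 - t)) * F (frac (3 / 4 - t)) = F (of_nat c / (of_nat p - 1) / 2) * F (of_nat c / (of_nat p - 1) / 2 + 1 / 2)"
        unfolding s a b ..
    qed
  next
    case 2
    define c where "c = h + q - 2 * j"
    have hc: "h + q = c + 2 * j" using 2 q_h by (simp add: c_def)
    have s: "of_nat c / (of_nat p - 1) / 2 = (3 / 4 - t :: rat)"
    proof -
      have "of_nat c = (of_nat h + of_nat q - 2 * of_nat j :: rat)" using arg_cong[OF hc, of "of_nat :: nat \<Rightarrow> rat"] by simp
      then show ?thesis unfolding t_def of_nat_q qh using h_pos by (simp add: field_simps)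
    qed
    show ?thesis
    proof (rule main[of c])
      show "c < q" using 2 hc q_h by linarith
      have "h + 2 * (q - j) = c + q" using hc j by simp
      then show "[c = h + 2 * (q - j)] (mod q)" by (simp add: cong_def)
      have a: "frac (1 / 4 - t) = 3 / 4 - t + 1 / 2"
        by (rule frac_eqI[of _ _ "- 1"]) (use 2 lt1 lt3 neq t01 in auto)
      have b: "frac (3 / 4 - t) = 3 / 4 - t"
        by (rule frac_eqI[of _ _ 0]) (use 2 lt1 lt3 t01 in auto)
      show "F (frac (1 / 4 - t)) * F (frac (3 / 4 - t)) = F (of_nat c / (of_nat p - 1) / 2) * F (of_nat c / (of_nat p - 1) / 2 + 1 / 2)"
        unfolding s a b by (rule mult.commute)
    qed
  next
    case 3
    define c where "c = h + 2 * q - 2 * j"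
    have hc: "h + 2 * q = c + 2 * j" using j by (simp add: c_def)
    have s: "of_nat c / (of_nat p - 1) / 2 = (5 / 4 - t :: rat)"
    proof -
      have "of_nat c = (of_nat h + 2 * of_nat q - 2 * of_nat j :: rat)" using arg_cong[OF hc, of "of_nat :: nat \<Rightarrow> rat"] by simp
      then show ?thesis unfolding t_def of_nat_q qh using h_pos by (simp add: field_simps)
    qed
    show ?thesis
    proof (rule main[of c])
      show "c < q" using 3 hc q_h by linarith
      have "h + 2 * (q - j) = c" using hc j by simp
      then show "[c = h + 2 * (q - j)] (mod q)" by simp
      have t3: "3 / 4 < t" using 3 lt3 neq by (metis linorder_less_linear not_less_iff_gr_or_eq)
      have a: "frac (1 / 4 - t) = 5 / 4 - t"
        by (rule frac_eqI[of _ _ "- 1"]) (use t3 t01 in auto)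
      have b: "frac (3 / 4 - t) = 5 / 4 - t + 1 / 2"
        by (rule frac_eqI[of _ _ "- 1"]) (use t3 t01 in auto)
      show "F (frac (1 / 4 - t)) * F (frac (3 / 4 - t)) = F (of_nat c / (of_nat p - 1) / 2) * F (of_nat c / (of_nat p - 1) / 2 + 1 / 2)"
        unfolding s a b ..
    qed
  qed
qed

text \<open>Duplication at \<open>c = h\<close>, where the two values of \<open>g\<close> on the
  right are \<open>g h\<close> and cancel by \<open>U1_gh_square\<close>.\<close>

lemma U1_quarters_norm: "U1 (F (1 / 4) * F (3 / 4) / T 2 ^ h)"
proof -
  have qh: "(of_nat p - 1 :: rat) = 2 * of_nat h" unfolding of_nat_q[symmetric] by (subst q_h) simp
  have s: "of_nat h / (of_nat p - 1) / 2 = (1 / 4 :: rat)" unfolding qh using h_pos by simp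
  have "1 / 4 + 1 / 2 = (3 / 4 :: rat)" by simp
  then have "U1 (F (1 / 4) * F (3 / 4) / (g h * g h * T 2 ^ h))" using U1_duplication[OF h_less] unfolding s by simp
  from U1_mult[OF this U1_gh_square] show ?thesis using punit_g[of h] by (simp add: punit_def)
qed

section \<open>Character expansions of the point count\<close>

text \<open>Orthogonality in the other variable: the exponents \<open>q - j\<close> run through a
  full cycle from 1 to \<open>q\<close>.\<close>

lemma sum_teich_powers:
  assumes "\<not> int p dvd z"
  shows "[(\<Sum>j<q. teich m z ^ (q - j)) = (if [z = 1] (mod int p) then int q else 0)] (mod int p ^ Suc m)"
proof -
  have "(\<Sum>j<q. teich m z ^ (q - j)) = (\<Sum>j<q. teich m z ^ Suc (q - Suc j))"
    by (rule sum.cong) (auto simp: Suc_diff_Suc)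
  also have "\<dots> = (\<Sum>i<q. teich m z ^ Suc i)" by (rule sum.nat_diff_reindex)
  finally have e: "(\<Sum>j<q. teich m z ^ (q - j)) = teich m z * (\<Sum>i<q. teich m z ^ i)"
    by (simp add: sum_distrib_left)
  show ?thesis
  proof (cases "[z = 1] (mod int p)")
    case True
    have t1: "[teich m z = 1] (mod int p ^ Suc m)" using teich_cong[OF True, of m] by simp
    have "[teich m z ^ (q - j) = 1] (mod int p ^ Suc m)" for j using cong_pow[OF t1, of "q - j"] by simp
    then have "[(\<Sum>j<q. teich m z ^ (q - j)) = (\<Sum>j<q. 1)] (mod int p ^ Suc m)" by (intro cong_sum)
    then show ?thesis using True by simp
  next
    case False
    have "int p ^ Suc m dvd teich m z ^ q - 1" using teich_fermat[OF assms, of m, folded q_def] by (simp add: cong_iff_dvd_diff)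
    then have d: "int p ^ Suc m dvd (teich m z - 1) * (\<Sum>i<q. teich m z ^ i)" by (simp only: power_diff_1_eq)
    have "\<not> int p dvd teich m z - 1"
    proof
      assume "int p dvd teich m z - 1"
      then have "[1 = teich m z] (mod int p)" by (simp add: cong_iff_dvd_diff dvd_diff_commute)
      then have "[1 = z] (mod int p)" using teich_id cong_trans by blast
      then show False using False cong_sym by blast
    qed
    then have "coprime (int p ^ Suc m) (teich m z - 1)" by (simp add: prime_imp_coprime[OF prime_int] del: power_Suc)
    then have "int p ^ Suc m dvd (\<Sum>i<q. teich m z ^ i)" using d coprime_dvd_mult_right_iff by blast
    then show ?thesis using False unfolding e by (simp add: cong_0_iff del: power_Suc)
  qed
qed

lemma char4_diag: "char4 m (j, j, j, j) y = teich m (int (prod4 y)) ^ (q - j)"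
  by (cases y) (simp add: q_def teich_mult power_mult_distrib mult.assoc)

text \<open>The condition involves the coordinates only through their product, so detecting it by
  characters produces the same index \<open>j\<close> in all four places.\<close>

lemma weighted_sum_onW1:
  fixes w :: "nat \<times> nat \<times> nat \<times> nat \<Rightarrow> int"
  shows "[(\<Sum>j<q. teich m (256 * lam ^ 4) ^ (q - j) * (\<Sum>y\<in>units4. if sum4 y mod p = 1 then w y * char4 m (j, j, j, j) y else 0))
     = int q * (\<Sum>y\<in>units4. of_bool (onW1 y) * w y)] (mod int p ^ Suc m)"
proof -
  define z where "z y = 256 * lam ^ 4 * int (prod4 y)" for y
  have nz: "\<not> int p dvd z y" if "y \<in> units4" for y
  proof -
    obtain y1 y2 y3 y4 where y: "y = (y1, y2, y3, y4)" by (cases y)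
    show ?thesis unfolding z_def
      using that not_dvd_256 not_dvd_power[OF lam, of 4] unfolding y prod4.simps of_nat_mult not_dvd_mult by (auto intro!: unit_range(2))
  qed
  have tz: "teich m (256 * lam ^ 4) ^ (q - j) * char4 m (j, j, j, j) y = teich m (z y) ^ (q - j)" for j y
    unfolding char4_diag z_def teich_mult by (simp only: power_mult_distrib)
  have if_mult: "t * (if b then v * c else 0) = (if b then v else 0) * (t * c)" for t v c :: int and b by simp
  have "(\<Sum>j<q. teich m (256 * lam ^ 4) ^ (q - j) * (\<Sum>y\<in>units4. if sum4 y mod p = 1 then w y * char4 m (j, j, j, j) y else 0))
     = (\<Sum>j<q. \<Sum>y\<in>units4. (if sum4 y mod p = 1 then w y else 0) * teich m (z y) ^ (q - j))"
    unfolding sum_distrib_left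
  proof (intro sum.cong refl)
    fix j y
    show "teich m (256 * lam ^ 4) ^ (q - j) * (if sum4 y mod p = 1 then w y * char4 m (j, j, j, j) y else 0)
       = (if sum4 y mod p = 1 then w y else 0) * teich m (z y) ^ (q - j)"
      unfolding tz[symmetric] by (rule if_mult)
  qed
  also have "\<dots> = (\<Sum>y\<in>units4. \<Sum>j<q. (if sum4 y mod p = 1 then w y else 0) * teich m (z y) ^ (q - j))"
    by (rule sum.swap)
  finally have 1: "(\<Sum>j<q. teich m (256 * lam ^ 4) ^ (q - j) * (\<Sum>y\<in>units4. if sum4 y mod p = 1 then w y * char4 m (j, j, j, j) y else 0))
     = (\<Sum>y\<in>units4. (if sum4 y mod p = 1 then w y else 0) * (\<Sum>j<q. teich m (z y) ^ (q - j)))"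
    by (simp only: sum_distrib_left)
  have 2: "[(\<Sum>y\<in>units4. (if sum4 y mod p = 1 then w y else 0) * (\<Sum>j<q. teich m (z y) ^ (q - j)))
    = (\<Sum>y\<in>units4. (if sum4 y mod p = 1 then w y else 0) * (if [z y = 1] (mod int p) then int q else 0))] (mod int p ^ Suc m)"
    by (intro cong_sum cong_mult cong_refl sum_teich_powers nz)
  have 3: "(\<Sum>y\<in>units4. (if sum4 y mod p = 1 then w y else 0) * (if [z y = 1] (mod int p) then int q else 0))
     = int q * (\<Sum>y\<in>units4. of_bool (onW1 y) * w y)"
    unfolding sum_distrib_left
  proof (intro sum.cong refl)
    fix y
    show "(if sum4 y mod p = 1 then w y else 0) * (if [z y = 1] (mod int p) then int q else 0) = int q * (of_bool (onW1 y) * w y)"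
      unfolding onW1_def z_def by simp
  qed
  show ?thesis unfolding 1 using 2 unfolding 3 .
qed

lemma sum_onW1_char:
  "[(\<Sum>j<q. teich m (256 * lam ^ 4) ^ (q - j) * charsum m (j, j, j, j) 1) = int q * (\<Sum>y\<in>units4. of_bool (onW1 y))] (mod int p ^ Suc m)"
  using weighted_sum_onW1[of "\<lambda>_. 1"] unfolding charsum_def mult_1_left mult_1_right .

lemma cong_if: "[x = y] (mod n) \<Longrightarrow> [(if b then x else 0) = (if b then y else 0 :: int)] (mod n)"
  by (cases b) simp_all

lemma lg_teich: "[lg a = teich m a ^ h] (mod int p ^ Suc m)"
proof -
  have "teich m (lg a) = lg a"
    using lg_range[of a] odd_p by (auto simp: teich_def)
  moreover have "[teich m (lg a) = teich m (a ^ h)] (mod int p ^ Suc m)" unfolding h_def by (rule teich_cong[OF lg_euler])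
  ultimately show ?thesis by (simp only: teich_power)
qed

text \<open>The Legendre symbol is the Teichmueller character to the power \<open>h\<close>, so a
  factor \<open>lg\<close> shifts the index by half the period.\<close>

lemma teich_shift:
  assumes "x \<in> {1..<p}" "j < q"
  shows "[teich m (int x) ^ (q - (j + h) mod q) = lg (int x) * teich m (int x) ^ (q - j)] (mod int p ^ Suc m)"
proof -
  have "[lg (int x) * teich m (int x) ^ (q - j) = teich m (int x) ^ h * teich m (int x) ^ (q - j)] (mod int p ^ Suc m)"
    by (intro cong_mult lg_teich cong_refl)
  then have 1: "[lg (int x) * teich m (int x) ^ (q - j) = teich m (int x) ^ (h + (q - j))] (mod int p ^ Suc m)"
    by (simp only: power_add)
  have "[q - (j + h) mod q = h + (q - j)] (mod q)"
  proof (cases "j < h")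
    case True
    then have "(j + h) mod q = j + h" "h + (q - j) = q - (j + h) + q" using q_h by simp_all
    then show ?thesis by (simp add: cong_def)
  next
    case False
    then have e: "j + h = (j - h) + q" using q_h by simp
    have "j - h < q" using assms(2) by simp
    then have "(j + h) mod q = j - h" unfolding e by (simp only: mod_add_self2 mod_less)
    moreover have "q - (j - h) = h + (q - j)" using False assms(2) by simp
    ultimately show ?thesis by simp
  qed
  then have "[teich m (int x) ^ (q - (j + h) mod q) = teich m (int x) ^ (h + (q - j))] (mod int p ^ Suc m)"
    by (intro teich_pow_cong_q unit_range assms)
  then show ?thesis using cong_trans[OF _ cong_sym[OF 1]] by blast
qed

lemma sum_onW1_lg12_char:
  "[(\<Sum>j<q. teich m (256 * lam ^ 4) ^ (q - j) * charsum m ((j + h) mod q, (j + h) mod q, j, j) 1)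
     = int q * (\<Sum>y\<in>units4. of_bool (onW1 y) * lg12 y)] (mod int p ^ Suc m)"
proof -
  have "[charsum m ((j + h) mod q, (j + h) mod q, j, j) 1 = (\<Sum>y\<in>units4. if sum4 y mod p = 1 then lg12 y * char4 m (j, j, j, j) y else 0)] (mod int p ^ Suc m)"
    if j: "j < q" for j
    unfolding charsum_def
  proof (rule cong_sum)
    fix y assume y: "y \<in> units4"
    obtain y1 y2 y3 y4 where e: "y = (y1, y2, y3, y4)" by (cases y)
    have r: "y1 \<in> {1..<p}" "y2 \<in> {1..<p}" using y unfolding e by simp_all
    have "[char4 m ((j + h) mod q, (j + h) mod q, j, j) y = lg (int y1) * teich m (int y1) ^ (q - j) * (lg (int y2) * teich m (int y2) ^ (q - j)
       * (teich m (int y3) ^ (q - j) * teich m (int y4) ^ (q - j)))] (mod int p ^ Suc m)"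
      unfolding e char4_q by (intro cong_mult teich_shift r j cong_refl)
    also have "lg (int y1) * teich m (int y1) ^ (q - j) * (lg (int y2) * teich m (int y2) ^ (q - j)
       * (teich m (int y3) ^ (q - j) * teich m (int y4) ^ (q - j))) = lg12 y * char4 m (j, j, j, j) y"
      unfolding e char4_q lg12.simps by (simp only: ac_simps)
    finally show "[(if sum4 y mod p = 1 then char4 m ((j + h) mod q, (j + h) mod q, j, j) y else 0)
       = (if sum4 y mod p = 1 then lg12 y * char4 m (j, j, j, j) y else 0)] (mod int p ^ Suc m)"
      by (rule cong_if)
  qed
  then have "[(\<Sum>j<q. teich m (256 * lam ^ 4) ^ (q - j) * charsum m ((j + h) mod q, (j + h) mod q, j, j) 1)
    = (\<Sum>j<q. teich m (256 * lam ^ 4) ^ (q - j) * (\<Sum>y\<in>units4. if sum4 y mod p = 1 then lg12 y * char4 m (j, j, j, j) y else 0))] (mod int p ^ Suc m)"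
    by (intro cong_sum cong_mult cong_refl) simp
  from cong_trans[OF this weighted_sum_onW1[of lg12]] show ?thesis .
qed

section \<open>Summands of the hypergeometric functions\<close>

text \<open>Periodic extension of \<open>g\<close>, so that functional equations apply to indices
  known only modulo \<open>q\<close>.\<close>

definition G :: "nat \<Rightarrow> rat" where "G n = g (n mod q)"

lemma G_eq_g: "n < q \<Longrightarrow> G n = g n"
  by (simp add: G_def)

lemma punit_G [simp]: "punit (G n)"
  by (simp add: G_def)

lemma G_cong: "[a = b] (mod q) \<Longrightarrow> G a = G b"
  by (simp add: G_def cong_def)

lemma G_nonzero [simp]: "G n \<noteq> 0"
  using punit_G[of n] by (simp add: punit_def)

lemma G_h: "G h = F (1 / 2)"
  using G_eq_g[OF h_less] g_h by simp

lemma U1_G_duplication: "U1 (G n * G (n + h) / (G h * G (2 * n) * T 2 ^ (2 * n)))"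
proof -
  have 1: "U1 (g (n mod q) * g ((n mod q + h) mod q) / (g h * g (2 * (n mod q) mod q) * T 2 ^ (2 * (n mod q))))"
    by (rule U1_duplication_index) (use q_pos in simp)
  have 2: "U1 (T 2 ^ (2 * (n mod q)) / T 2 ^ (2 * n))"
    by (rule U1_T_power[OF not_dvd_2]) (simp add: cong_def mod_mult_right_eq)
  have nz: "T 2 \<noteq> 0" using punit_T[OF not_dvd_2] by (simp add: punit_def)
  have e: "G n = g (n mod q)" "G (n + h) = g ((n mod q + h) mod q)" "G h = g h" "G (2 * n) = g (2 * (n mod q) mod q)"
    using h_less by (simp_all add: G_def mod_add_left_eq mod_mult_right_eq)
  show ?thesis unfolding e using U1_mult[OF 1 2] nz by simp
qed

lemma U1_G_reflection: assumes "\<not> q dvd n" "q dvd n + k" shows "U1 (G n * G k / - ((- 1) ^ n))"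
proof -
  define c where "c = n mod q"
  have c: "0 < c" "c < q" using assms(1) q_pos by (auto simp: c_def dvd_eq_mod_eq_0)
  have "q dvd c + k" using assms(2) by (simp add: c_def dvd_eq_mod_eq_0 mod_add_left_eq)
  then have "[c + k = c + (q - c)] (mod q)" using c by (simp add: cong_def dvd_eq_mod_eq_0)
  then have "[k = q - c] (mod q)" by (simp only: cong_add_lcancel_nat)
  then have "G k = G (q - c)" by (rule G_cong)
  then have k: "G k = g (q - c)" using c by (simp add: G_eq_g)
  have "even n \<longleftrightarrow> even c" unfolding c_def using q_h by (simp add: dvd_mod_iff)
  then have s: "(- 1 :: rat) ^ n = (- 1) ^ c" by (simp add: minus_one_power_iff)
  show ?thesis unfolding k s using U1_reflection[OF c] by (simp add: G_def c_def)
qed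

lemma F_frac_G: assumes "x = of_nat n / (of_nat p - 1) + of_int k" shows "F (frac x) = G n"
proof -
  have n: "of_nat n = (of_nat (n mod q) + of_nat (n div q) * of_nat q :: rat)"
    unfolding of_nat_mult[symmetric] of_nat_add[symmetric] by simp
  have "x = of_nat (n mod q) / of_nat q + of_int (int (n div q) + k)"
    unfolding assms of_nat_q[symmetric] by (subst n) (use q_pos in \<open>simp add: field_simps\<close>)
  then have "frac x = of_nat (n mod q) / of_nat q"
    by (rule frac_eqI) (use q_pos in \<open>simp_all add: divide_simps\<close>)
  then show ?thesis by (simp add: G_def g_def of_nat_q)
qed

section \<open>Arguments, floors and powers of \<open>p\<close> in the summands\<close>

definition tau :: "nat \<Rightarrow> rat" where "tau j = of_nat j / (of_nat p - 1)"

lemma tau_range: "j < q \<Longrightarrow> 0 \<le> tau j" "j < q \<Longrightarrow> tau j < 1"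
  using q_pos unfolding tau_def of_nat_q[symmetric] by simp_all

lemma less_tau_iff: "(of_nat a / 4 :: rat) < tau j \<longleftrightarrow> a * q < 4 * j"
proof -
  have "(of_nat a / 4 :: rat) < tau j \<longleftrightarrow> of_nat (a * q) < (of_nat (4 * j) :: rat)"
    using q_pos unfolding tau_def of_nat_q[symmetric] by (simp add: field_simps)
  then show ?thesis by (simp only: of_nat_less_iff)
qed

lemma tau_h: "tau h = 1 / 2"
proof -
  have "(of_nat q :: rat) = 2 * of_nat h" by (subst q_h) simp
  then show ?thesis unfolding tau_def of_nat_q[symmetric] using h_pos by simp
qed

lemma tau_add: "tau (i + j) = tau i + tau j"
  by (simp add: tau_def add_divide_distrib)

lemma F_frac_half_plus: "F (frac (- (1 / 2) + tau j)) = G (j + h)"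
proof (rule F_frac_G[of _ _ "- 1", folded tau_def])
  show "- (1 / 2) + tau j = tau (j + h) + of_int (- 1)" unfolding tau_add tau_h by simp
qed

lemma tau_q: "tau q = 1"
  unfolding tau_def of_nat_q[symmetric] using q_pos by simp

lemma F_frac_half_minus: assumes "j < q" shows "F (frac (1 / 2 - tau j)) = G (h + (q - j))"
proof (rule F_frac_G[of _ _ "- 1", folded tau_def])
  have "h + (q - j) + j = h + q" using assms by simp
  then have "tau (h + (q - j)) + tau j = tau h + tau q"
    unfolding tau_add[symmetric] by simp
  then show "1 / 2 - tau j = tau (h + (q - j)) + of_int (- 1)" unfolding tau_h tau_q by simp
qed

lemma F_frac_tau: "F (frac (tau j)) = G j"
  by (rule F_frac_G[of _ _ 0, folded tau_def]) simp

lemma floor_minus_tau: assumes "0 \<le> a" "a < 1" "j < q"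
  shows "\<lfloor>frac a - tau j\<rfloor> = - of_bool (a < tau j)"
proof -
  have "frac a = a" using assms by (simp add: frac_eq)
  then show ?thesis using assms tau_range[OF assms(3)] by (auto simp: floor_eq_iff)
qed

abbreviation u4 :: int where "u4 \<equiv> lam ^ 4 mod int p"

abbreviation tb :: "nat \<Rightarrow> rat" where "tb j \<equiv> teich_bar_pow_approx p m j u4"

text \<open>Inverse powers are replaced by complementary positive ones, and the residue of
  \<open>lam ^ 4\<close> by \<open>lam ^ 4\<close> itself.\<close>

lemma U1_tb: assumes "j \<le> q" shows "U1 (tb j / T (lam ^ 4) ^ (q - j))"
proof -
  have l4: "\<not> int p dvd lam ^ 4" by (rule not_dvd_power[OF lam])
  then have u0: "u4 \<noteq> 0" by (simp add: dvd_eq_mod_eq_0)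
  have uc: "[u4 = lam ^ 4] (mod int p)" by (simp add: cong_def)
  have lu: "\<not> int p dvd u4" using l4 by (simp add: dvd_eq_mod_eq_0)
  have tb: "tb j = inverse (T u4) ^ j" using u0 by (simp add: teich_bar_pow_approx_def teich_def)
  have "U1 (T (lam ^ 4) / T u4)"
    by (intro U1_I cong_padic cong_sym[OF teich_cong[OF uc]] punit_T l4 lu)
  from U1_divide[OF U1_power[OF this, of j] U1_T_q[OF l4, of 1]]
  have "U1 ((T (lam ^ 4) / T u4) ^ j / T (lam ^ 4) ^ (q * 1))" .
  moreover have "(T (lam ^ 4) / T u4) ^ j / T (lam ^ 4) ^ (q * 1) = tb j / T (lam ^ 4) ^ (q - j)"
  proof -
    have nz: "T (lam ^ 4) \<noteq> 0" using punit_T[OF l4] by (simp add: punit_def)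
    have "T (lam ^ 4) ^ q = T (lam ^ 4) ^ (q - j) * T (lam ^ 4) ^ j"
      using assms by (simp flip: power_add)
    then show ?thesis unfolding tb using nz by (simp add: power_divide power_inverse divide_inverse power_mult_distrib)
  qed
  ultimately show ?thesis by simp
qed

text \<open>Counts which of the parameters 1/4, 1/2, 3/4 have been passed by
  \<open>tau j\<close>.\<close>

definition e3 :: "nat \<Rightarrow> nat" where
  "e3 j = of_bool (q < 4 * j) + of_bool (h < j) + of_bool (3 * q < 4 * j)"

text \<open>The lower parameter 1/2 contributes \<open>- 1\<close> from \<open>h\<close> on, which
  cancels the contribution of 1/4; what is left is written with natural exponents.\<close>

definition e2 :: "nat \<Rightarrow> nat" where
  "e2 j = of_bool (q < 4 * j \<and> j < h) + of_bool (3 * q < 4 * j)"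

definition unit3 :: "nat \<Rightarrow> rat" where
  "unit3 j = (- 1) ^ j * tb j * (F (frac (1 / 4 - tau j)) * F (frac (3 / 4 - tau j)) * G (h + (q - j)) / (F (1 / 4) * F (3 / 4) * G h)) * G j ^ 3"

definition unit2 :: "nat \<Rightarrow> rat" where
  "unit2 j = tb j * (F (frac (1 / 4 - tau j)) * F (frac (3 / 4 - tau j)) / (F (1 / 4) * F (3 / 4))) * (G j * G (j + h) / G h)"

lemma atLeast0_p_minus_2: "{0..p - 2} = {..<q}"
  using gt2 unfolding q_def by auto

lemma less_tau_cases:
  "1 / 4 < tau j \<longleftrightarrow> q < 4 * j" "1 / 2 < tau j \<longleftrightarrow> h < j" "3 / 4 < tau j \<longleftrightarrow> 3 * q < 4 * j"
  using less_tau_iff[of 1 j] less_tau_iff[of 2 j] less_tau_iff[of 3 j] q_h by simp_all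

text \<open>With lower parameter 0 the second floor vanishes, so \<open>- p\<close> appears exactly
  when \<open>tau j\<close> has passed \<open>a\<close>.\<close>

lemma hypergeometric_factor:
  assumes "0 \<le> a" "a < 1" "j < q"
  shows "gamma_p_approx p m (frac (a - tau j)) / gamma_p_approx p m (frac a) *
           (gamma_p_approx p m (frac (- 0 + tau j)) / gamma_p_approx p m (frac (- 0))) *
           (- of_nat p :: rat) powi (- \<lfloor>frac a - tau j\<rfloor> - \<lfloor>frac (- 0) + tau j\<rfloor>)
    = F (frac (a - tau j)) / F a * G j * (- of_nat p) ^ of_bool (a < tau j)"
proof -
  have f: "frac a = a" using assms by (simp add: frac_eq)
  have z: "\<lfloor>tau j\<rfloor> = 0" using tau_range[OF assms(3)] by (simp add: floor_eq_iff)
  show ?thesis unfolding floor_minus_tau[OF assms] using f z by (cases "a < tau j") (simp_all add: F_frac_tau)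
qed

lemma mcG3_sum: "mcG_approx p [1/4, 2/4, 3/4] [0, 0, 0] u4 m
   = - 1 / (of_nat p - 1) * (\<Sum>j<q. unit3 j * (- of_nat p) ^ e3 j)"
  unfolding mcG_approx_def atLeast0_p_minus_2 tau_def[symmetric]
proof (intro arg_cong[where f = "\<lambda>z. - 1 / (of_nat p - 1) * z"] sum.cong refl)
  fix j assume "j \<in> {..<q}"
  then have j: "j < q" by simp
  have 3: "{..<length [1/4, 2/4, 3/4 :: rat]} = {0, Suc 0, Suc (Suc 0)}" by auto
  have s: "(- 1 :: rat) ^ (j * length [1/4, 2/4, 3/4 :: rat]) = (- 1) ^ j"
    by (simp add: minus_one_power_iff)
  have half: "(2 / 4 :: rat) = 1 / 2" by simp
  have a: "(0 :: rat) \<le> 1 / 4" "(1 / 4 :: rat) < 1" "(0 :: rat) \<le> 1 / 2" "(1 / 2 :: rat) < 1" "(0 :: rat) \<le> 3 / 4" "(3 / 4 :: rat) < 1"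
    by simp_all
  have P: "(\<Prod>i<length [1/4, 2/4, 3/4 :: rat].
           let a = [1/4, 2/4, 3/4] ! i; b = [0, 0, 0] ! i; t = tau j in
           gamma_p_approx p m (frac (a - t)) / gamma_p_approx p m (frac a) *
           (gamma_p_approx p m (frac (- b + t)) / gamma_p_approx p m (frac (- b))) *
           (- of_nat p :: rat) powi (- \<lfloor>frac a - t\<rfloor> - \<lfloor>frac (- b) + t\<rfloor>))
     = (F (frac (1 / 4 - tau j)) / F (1 / 4) * G j * (- of_nat p) ^ of_bool (1 / 4 < tau j))
      * ((F (frac (1 / 2 - tau j)) / F (1 / 2) * G j * (- of_nat p) ^ of_bool (1 / 2 < tau j))
       * (F (frac (3 / 4 - tau j)) / F (3 / 4) * G j * (- of_nat p) ^ of_bool (3 / 4 < tau j)))"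
    unfolding 3 Let_def
    unfolding hypergeometric_factor[OF a(1,2) j, symmetric] hypergeometric_factor[OF a(3,4) j, symmetric] hypergeometric_factor[OF a(5,6) j, symmetric]
    by (simp add: half)
  show "(-1) ^ (j * length [1/4, 2/4, 3/4 :: rat]) * tb j *
     (\<Prod>i<length [1/4, 2/4, 3/4 :: rat].
           let a = [1/4, 2/4, 3/4] ! i; b = [0, 0, 0] ! i; t = tau j in
           gamma_p_approx p m (frac (a - t)) / gamma_p_approx p m (frac a) *
           (gamma_p_approx p m (frac (- b + t)) / gamma_p_approx p m (frac (- b))) *
           (- of_nat p :: rat) powi (- \<lfloor>frac a - t\<rfloor> - \<lfloor>frac (- b) + t\<rfloor>))
     = unit3 j * (- of_nat p) ^ e3 j"
    unfolding P s unit3_def e3_def power_add less_tau_cases F_frac_half_minus[OF j] G_h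
    by (simp only: power3_eq_cube times_divide_times_eq times_divide_eq_right times_divide_eq_left divide_divide_eq_left ac_simps)
qed

lemma mcG2_sum: "mcG_approx p [3/4, 1/4] [0, 1/2] u4 m
   = - 1 / (of_nat p - 1) * (\<Sum>j<q. unit2 j * (- of_nat p) ^ e2 j)"
  unfolding mcG_approx_def atLeast0_p_minus_2 tau_def[symmetric]
proof (intro arg_cong[where f = "\<lambda>z. - 1 / (of_nat p - 1) * z"] sum.cong refl)
  fix j assume "j \<in> {..<q}"
  then have j: "j < q" by simp
  have 2: "{..<length [3/4, 1/4 :: rat]} = {0, Suc 0}" by auto
  have s: "(- 1 :: rat) ^ (j * length [3/4, 1/4 :: rat]) = 1" by simp
  have a: "(0 :: rat) \<le> 1 / 4" "(1 / 4 :: rat) < 1" "(0 :: rat) \<le> 3 / 4" "(3 / 4 :: rat) < 1"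
    by simp_all
  have fh: "frac (- (1 / 2) :: rat) = 1 / 2" by (rule frac_eqI[of _ _ "- 1"]) simp_all
  have fq: "frac (1 / 4 :: rat) = 1 / 4" by (simp add: frac_eq)
  have half: "1 / 2 \<le> tau j \<longleftrightarrow> h \<le> j"
    using q_pos unfolding tau_h[symmetric] tau_def of_nat_q[symmetric] by (simp add: divide_le_cancel)
  have fl: "\<lfloor>1 / 2 + tau j\<rfloor> = of_bool (1 / 2 \<le> tau j)"
    using tau_range[OF j] by (auto simp: floor_eq_iff)
  \<comment> \<open>Once \<open>tau j\<close> has reached 1/2 it has passed 1/4 as well, so the
    integer exponent is never negative.\<close>
  have pw: "(- of_nat p :: rat) ^ of_bool (3 / 4 < tau j) * (- of_nat p) powi (of_bool (1 / 4 < tau j) - of_bool (1 / 2 \<le> tau j)) = (- of_nat p) ^ e2 j"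
    unfolding e2_def half less_tau_cases using q_h h_pos by (cases "j < h"; cases "q < 4 * j") (auto simp: power_add)
  have P: "(\<Prod>i<length [3/4, 1/4 :: rat].
           let a = [3/4, 1/4] ! i; b = [0, 1/2] ! i; t = tau j in
           gamma_p_approx p m (frac (a - t)) / gamma_p_approx p m (frac a) *
           (gamma_p_approx p m (frac (- b + t)) / gamma_p_approx p m (frac (- b))) *
           (- of_nat p :: rat) powi (- \<lfloor>frac a - t\<rfloor> - \<lfloor>frac (- b) + t\<rfloor>))
     = (F (frac (3 / 4 - tau j)) / F (3 / 4) * G j * (- of_nat p) ^ of_bool (3 / 4 < tau j))
      * (F (frac (1 / 4 - tau j)) / F (1 / 4) * (G (j + h) / G h) * (- of_nat p) powi (of_bool (1 / 4 < tau j) - of_bool (1 / 2 \<le> tau j)))"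
    unfolding 2 Let_def hypergeometric_factor[OF a(3,4) j, symmetric]
    using floor_minus_tau[OF a(1,2) j] unfolding F_frac_half_plus[symmetric] G_h
    by (simp add: fh fq fl)
  show "(-1) ^ (j * length [3/4, 1/4 :: rat]) * tb j *
     (\<Prod>i<length [3/4, 1/4 :: rat].
           let a = [3/4, 1/4] ! i; b = [0, 1/2] ! i; t = tau j in
           gamma_p_approx p m (frac (a - t)) / gamma_p_approx p m (frac a) *
           (gamma_p_approx p m (frac (- b + t)) / gamma_p_approx p m (frac (- b))) *
           (- of_nat p :: rat) powi (- \<lfloor>frac a - t\<rfloor> - \<lfloor>frac (- b) + t\<rfloor>))
     = unit2 j * (- of_nat p) ^ e2 j"
    unfolding P s unit2_def pw[symmetric]
    by (simp only: mult_1_left times_divide_times_eq times_divide_eq_right times_divide_eq_left divide_divide_eq_left ac_simps)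
qed

section \<open>Matching the two expansions\<close>

text \<open>The surface contributes the factor 256; on the other side it emerges from the powers of
  2 in the duplication formulas.\<close>

abbreviation Z :: rat where "Z \<equiv> T (256 * lam ^ 4)"

abbreviation A3 :: "nat \<Rightarrow> rat" where "A3 j \<equiv> of_int (charsum m (j, j, j, j) 1)"

abbreviation A2 :: "nat \<Rightarrow> rat" where "A2 j \<equiv> of_int (charsum m ((j + h) mod q, (j + h) mod q, j, j) 1)"

lemma punit_V: "punit x \<Longrightarrow> V 0 x"
  by (simp add: punit_def)

lemma U1_absorb: assumes "U1 u" "V 0 x" shows "padic_eq (int M) (x * u) x"
  using peq_mult_left[of "int M" u 1 x] assms by (simp add: U1_def)

lemma Z_power: "Z ^ n = (T 2 ^ (2 * n)) ^ 4 * T (lam ^ 4) ^ n"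
proof -
  have "teich m (256 * lam ^ 4) = teich m 2 ^ 8 * teich m (lam ^ 4)"
    unfolding teich_power[symmetric] teich_mult[symmetric] by simp
  then show ?thesis by (simp add: power_mult_distrib power_mult[symmetric] mult.commute)
qed

lemma lam4: "\<not> int p dvd lam ^ 4"
  by (rule not_dvd_power[OF lam])

lemma not_dvd_Z: "\<not> int p dvd 256 * lam ^ 4"
  using lam4 not_dvd_256 not_dvd_mult by blast

lemma punit_Z: "punit (Z ^ n)"
  by (intro punit_power punit_T not_dvd_Z)

lemma T_nonzero: "T 2 \<noteq> 0" "T (lam ^ 4) \<noteq> 0"
  using punit_T[OF not_dvd_2] punit_T[OF lam4] by (simp_all add: punit_def)

lemma F_nonzero: "F x \<noteq> 0"
  using punit_gamma_p_approx[of m x] by (simp add: punit_def)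

text \<open>The multiplication formula of order four, made of duplications from \<open>n\<close> to
  \<open>2 * n\<close> and on to \<open>4 * n\<close>; reflection then trades \<open>G n\<close> for
  \<open>G j\<close>. The powers of 2 collect to the eighth power of \<open>T 2 ^ n\<close>, which
  completes \<open>Z ^ n\<close>.\<close>

lemma U1_unit3:
  assumes j: "0 < j" "j < q" and n: "n = q - j"
  shows "U1 (unit3 j / - (Z ^ n * G (4 * n) * G j ^ 4))"
proof -
  define s where "s = (- 1 :: rat) ^ j"
  define B where "B = T 2 ^ (2 * n)"
  define D where "D = T 2 ^ h"
  define c where "c = h + 2 * n"
  have jn: "j + n = q" using j n by simp
  have gh: "g h = G h" "g (c mod q) = G c" using h_less by (simp_all add: G_def)
  have AB: "T 2 ^ (h + 2 * n) = D * B" "T 2 ^ (2 * (2 * n)) = B ^ 2" "2 * n + h = c" "2 * (2 * n) = 4 * n"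
    by (simp_all add: B_def D_def c_def power_add power_mult[symmetric] mult.commute)
  have a: "U1 (F (frac (1 / 4 - tau j)) * F (frac (3 / 4 - tau j)) / (G h * G c * (D * B)))"
    using U1_quarters[OF j(2)] unfolding n[symmetric] tau_def[symmetric] AB(1) unfolding c_def[symmetric] gh .
  have b: "U1 (G n * G (h + n) / (G h * G (2 * n) * B))"
    using U1_G_duplication[of n] unfolding B_def by (simp add: add.commute)
  have c: "U1 (G (2 * n) * G c / (G h * G (4 * n) * B ^ 2))"
    using U1_G_duplication[of "2 * n"] unfolding AB(2) unfolding AB(3,4) .
  have d: "U1 (F (1 / 4) * F (3 / 4) / D)" unfolding D_def by (rule U1_quarters_norm)
  have e: "U1 (G h * G h)" using U1_gh_square unfolding gh .
  have nd: "\<not> q dvd j" using j by (auto dest: dvd_imp_le)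
  have f: "U1 (G j * G n / - s)" unfolding s_def by (rule U1_G_reflection[OF nd]) (simp add: jn)
  have t: "U1 (tb j / T (lam ^ 4) ^ n)" unfolding n by (rule U1_tb) (use j in simp)
  have nz: "D \<noteq> 0" "B \<noteq> 0" "s \<noteq> 0" "T (lam ^ 4) ^ n \<noteq> 0" using T_nonzero by (simp_all add: D_def B_def s_def)
  have ident: "(s * t * (x * x2 / (f * gh)) * gj ^ 3) / - (b ^ 4 * l * g4 * gj ^ 4)
     = t / l * (x / (gh * gc * (d * b))) * (gn * x2 / (gh * gi * b)) * (gi * gc / (gh * g4 * b ^ 2)) / (f / d) * (gh * gh) / (gj * gn / - s)"
    if "l \<noteq> 0" "gh \<noteq> 0" "gc \<noteq> 0" "d \<noteq> 0" "b \<noteq> 0" "gn \<noteq> 0" "gi \<noteq> 0" "g4 \<noteq> 0" "f \<noteq> 0" "gj \<noteq> 0" "s \<noteq> 0"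
    for t l x x2 gh gc d b gn gi g4 f gj s :: rat
    using that by (simp add: divide_simps) (simp add: power_numeral_reduce)
  have "unit3 j / - (Z ^ n * G (4 * n) * G j ^ 4)
    = tb j / T (lam ^ 4) ^ n * (F (frac (1 / 4 - tau j)) * F (frac (3 / 4 - tau j)) / (G h * G c * (D * B)))
      * (G n * G (h + n) / (G h * G (2 * n) * B)) * (G (2 * n) * G c / (G h * G (4 * n) * B ^ 2))
      / (F (1 / 4) * F (3 / 4) / D) * (G h * G h) / (G j * G n / - s)"
    unfolding unit3_def Z_power B_def[symmetric] s_def[symmetric] n[symmetric]
    by (rule ident) (use nz F_nonzero in simp_all)
  then show ?thesis by (simp only:) (intro U1_mult U1_divide a b c d e f t)
qed

lemma U1_T2_cycle: assumes "n + j = q" shows "U1 (T 2 ^ (2 * n) * T 2 ^ (2 * j))"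
proof -
  have "2 * n + 2 * j = q * 2" using assms by simp
  then show ?thesis using U1_T_q[OF not_dvd_2, of 2] by (simp flip: power_add)
qed

text \<open>Here the powers of 2 from numerator and denominator parameters belong to the
  complementary indices \<open>n\<close> and \<open>j\<close> and cancel by
  \<open>U1_T2_cycle\<close>.\<close>

lemma U1_unit2:
  assumes j: "j < q" and n: "n = q - j"
  shows "U1 (unit2 j / (T (lam ^ 4) ^ n * G h * G (h + 2 * n) * G (2 * j)))"
proof -
  define B where "B = T 2 ^ (2 * n)"
  define E where "E = T 2 ^ (2 * j)"
  define D where "D = T 2 ^ h"
  define c where "c = h + 2 * n"
  have jn: "n + j = q" using j n by simp
  have gh: "g h = G h" "g (c mod q) = G c" using h_less by (simp_all add: G_def)
  have AB: "T 2 ^ (h + 2 * n) = D * B"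
    by (simp add: B_def D_def power_add)
  have a: "U1 (F (frac (1 / 4 - tau j)) * F (frac (3 / 4 - tau j)) / (G h * G c * (D * B)))"
    using U1_quarters[OF j] unfolding n[symmetric] tau_def[symmetric] AB unfolding c_def[symmetric] gh .
  have b: "U1 (G j * G (j + h) / (G h * G (2 * j) * E))"
    unfolding E_def by (rule U1_G_duplication)
  have d: "U1 (F (1 / 4) * F (3 / 4) / D)" unfolding D_def by (rule U1_quarters_norm)
  have t: "U1 (tb j / T (lam ^ 4) ^ n)" unfolding n by (rule U1_tb) (use j in simp)
  have be: "U1 (B * E)" unfolding B_def E_def by (rule U1_T2_cycle[OF jn])
  have nz: "D \<noteq> 0" "B \<noteq> 0" "E \<noteq> 0" "T (lam ^ 4) ^ n \<noteq> 0" using T_nonzero by (simp_all add: D_def B_def E_def)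
  have ident: "t * (x / f) * (y / gh) / (l * gh * gc * g2)
     = t / l * (x / (gh * gc * (d * b))) / (f / d) * (y / (gh * g2 * e)) * (b * e)"
    if "l \<noteq> 0" "gh \<noteq> 0" "gc \<noteq> 0" "d \<noteq> 0" "b \<noteq> 0" "e \<noteq> 0" "g2 \<noteq> 0" "f \<noteq> 0"
    for t l x y gh gc d b e g2 f :: rat
    using that by (simp add: divide_simps)
  have "unit2 j / (T (lam ^ 4) ^ n * G h * G c * G (2 * j))
    = tb j / T (lam ^ 4) ^ n * (F (frac (1 / 4 - tau j)) * F (frac (3 / 4 - tau j)) / (G h * G c * (D * B)))
      / (F (1 / 4) * F (3 / 4) / D) * (G j * G (j + h) / (G h * G (2 * j) * E)) * (B * E)"
    unfolding unit2_def by (rule ident) (use nz F_nonzero in simp_all)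
  then show ?thesis unfolding c_def[symmetric] by (simp only:) (intro U1_mult U1_divide a b d t be)
qed

text \<open>The left factor is what \<open>charsum_gauss\<close> gives for the shifted indices.
  Duplication at \<open>j\<close> and \<open>2 * j\<close> and reflection of
  \<open>2 * j + h\<close> bring it to the form found in \<open>U1_unit2\<close>.\<close>

lemma U1_charsum2_unit:
  assumes j: "j < q" and n: "n = q - j"
  shows "U1 (Z ^ n * (G j * G (j + h)) ^ 2 / G (4 * j) / unit2 j)"
proof -
  define B where "B = T 2 ^ (2 * n)"
  define E where "E = T 2 ^ (2 * j)"
  define c where "c = h + 2 * n"
  have jn: "n + j = q" using j n by simp
  have b: "U1 (G j * G (j + h) / (G h * G (2 * j) * E))"
    unfolding E_def by (rule U1_G_duplication)
  have EE: "T 2 ^ (2 * (2 * j)) = E ^ 2" "2 * (2 * j) = 4 * j" by (simp_all add: E_def power_mult[symmetric] mult.commute)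
  have b2: "U1 (G (2 * j) * G (2 * j + h) / (G h * G (4 * j) * E ^ 2))"
    using U1_G_duplication[of "2 * j"] unfolding EE(1) unfolding EE(2) .
  \<comment> \<open>Parity: \<open>q\<close> is even and \<open>h\<close> is odd, so reflection
    applies at every \<open>j\<close>.\<close>
  have nd: "\<not> q dvd 2 * j + h"
  proof
    assume "q dvd 2 * j + h"
    then have "2 dvd 2 * j + h" using q_h by (metis dvd_trans dvd_triv_left)
    then show False using odd_h by simp
  qed
  have "2 * j + h + c = 3 * q" using jn q_h unfolding c_def by simp
  then have "q dvd 2 * j + h + c" by simp
  from U1_G_reflection[OF nd this] have r: "U1 (G (2 * j + h) * G c)" using odd_h by simp
  have e: "U1 (G h * G h)" using U1_gh_square h_less by (simp add: G_def)
  have be: "U1 (B * E)" unfolding B_def E_def by (rule U1_T2_cycle[OF jn])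
  have nz: "B \<noteq> 0" "E \<noteq> 0" "T (lam ^ 4) ^ n \<noteq> 0" using T_nonzero by (simp_all add: B_def E_def)
  have ident: "(b ^ 4 * l) * y ^ 2 / g4 / (l * gh * gc * g2)
     = (y / (gh * g2 * e)) ^ 2 * (g2 * x / (gh * g4 * e ^ 2)) / (x * gc) * (gh * gh) * (b * e) ^ 4"
    if "l \<noteq> 0" "gh \<noteq> 0" "gc \<noteq> 0" "x \<noteq> 0" "b \<noteq> 0" "e \<noteq> 0" "g2 \<noteq> 0" "g4 \<noteq> 0"
    for l x y gh gc b e g2 g4 :: rat
    using that by (simp add: divide_simps) (simp add: power_numeral_reduce)
  have "Z ^ n * (G j * G (j + h)) ^ 2 / G (4 * j) / (T (lam ^ 4) ^ n * G h * G c * G (2 * j))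
    = (G j * G (j + h) / (G h * G (2 * j) * E)) ^ 2 * (G (2 * j) * G (2 * j + h) / (G h * G (4 * j) * E ^ 2))
      / (G (2 * j + h) * G c) * (G h * G h) * (B * E) ^ 4"
    unfolding Z_power B_def[symmetric] by (rule ident) (use nz in simp_all)
  moreover have "U1 \<dots>" by (intro U1_mult U1_divide U1_power b b2 r e be)
  ultimately have 1: "U1 (Z ^ n * (G j * G (j + h)) ^ 2 / G (4 * j) / (T (lam ^ 4) ^ n * G h * G c * G (2 * j)))" by (simp only:)
  have "T (lam ^ 4) ^ n * G h * G c * G (2 * j) \<noteq> 0" using nz by simp
  moreover have "x / y = (x / w) / (y / w)" if "w \<noteq> 0" for x y w :: rat using that by simp
  ultimately have "Z ^ n * (G j * G (j + h)) ^ 2 / G (4 * j) / unit2 j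
     = (Z ^ n * (G j * G (j + h)) ^ 2 / G (4 * j) / (T (lam ^ 4) ^ n * G h * G c * G (2 * j))) / (unit2 j / (T (lam ^ 4) ^ n * G h * G c * G (2 * j)))"
    by blast
  then show ?thesis using U1_divide[OF 1 U1_unit2[OF assms, folded c_def]] by (simp only:)
qed

lemma G_residue: assumes "a < q" shows "G a = of_int (gam (padic_residue p m (of_nat a / (of_nat p - 1))))"
  using assms by (simp add: G_def g_def gamma_p_approx_def)

lemma residue_spec_mono: "k \<le> m \<Longrightarrow> padic_eq (int k) (of_nat a / (of_nat p - 1)) (of_nat (padic_residue p m (of_nat a / (of_nat p - 1))))"
  by (rule peq_mono[OF padic_residue_spec[OF V_p_minus_1]]) simp

lemma charsum_gauss:
  assumes a: "a1 < q" "a2 < q" "a3 < q" "a4 < q" and nd: "\<not> q dvd a1 + a2 + a3 + a4"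
  shows "padic_eq (int M) ((- of_nat p) ^ ((a1 + a2 + a3 + a4) div q) * (G a1 * G a2 * G a3 * G a4))
    (- (of_int (charsum m (a1, a2, a3, a4) 1) * G (a1 + a2 + a3 + a4)))"
proof -
  define c where "c = (a1 + a2 + a3 + a4) mod q"
  have c: "c < q" "c \<noteq> 0" "G (a1 + a2 + a3 + a4) = G c"
    using q_pos nd by (simp_all add: c_def dvd_eq_mod_eq_0 G_def)
  have "Suc M \<le> m" using M_less by simp
  note charsum_nontrivial[folded q_def, OF a this residue_spec_mono[OF this] residue_spec_mono[OF this] residue_spec_mono[OF this] residue_spec_mono[OF this] c_def refl
    residue_spec_mono[OF this] c(2)]
  then show ?thesis unfolding c(3) G_residue[OF a(1)] G_residue[OF a(2)] G_residue[OF a(3)] G_residue[OF a(4)] G_residue[OF c(1)]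
    by simp
qed

text \<open>Subtracting the relation for the difference of the two sums from the one for their total
  isolates \<open>p\<close> times the Jacobi sum; \<open>w\<close> is the solution, at the cost of
  one power of \<open>p\<close>.\<close>

lemma charsum_gauss_trivial:
  assumes a: "a1 < q" "a2 < q" "a3 < q" "a4 < q" and e: "a1 + a2 + a3 + a4 = e * q"
    and w: "(if a1 = 0 then of_nat p - 1 else 0) * ((if a2 = 0 then of_nat p - 1 else 0) * ((if a3 = 0 then of_nat p - 1 else 0) * (if a4 = 0 then of_nat p - 1 else 0)))
       - (- of_nat p) ^ e * (G a1 * G a2 * G a3 * G a4) = of_nat p * w"
  shows "padic_eq (int M) (of_int (charsum m (a1, a2, a3, a4) 1)) w"
proof -
  define A where "A s = (of_int (charsum m (a1, a2, a3, a4) s) :: rat)" for s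
  have l: "Suc M \<le> m" "0 < Suc M" using M_less by simp_all
  note charsum_trivial[folded q_def, OF a l(2,1) residue_spec_mono[OF l(1)] residue_spec_mono[OF l(1)] residue_spec_mono[OF l(1)] residue_spec_mono[OF l(1)] e]
  then have 1: "padic_eq (int (Suc M)) ((- of_nat p) ^ e * (G a1 * G a2 * G a3 * G a4)) (A 0 - A 1)"
    unfolding G_residue[OF a(1)] G_residue[OF a(2)] G_residue[OF a(3)] G_residue[OF a(4)] A_def by simp
  have oi: "(of_int (if b then int p - 1 else 0) :: rat) = (if b then of_nat p - 1 else 0)" for b by simp
  have "padic_eq (int (Suc m)) (of_int (charsum m (a1, a2, a3, a4) 0 + (int p - 1) * charsum m (a1, a2, a3, a4) 1))
    (of_int ((if a1 = 0 then int p - 1 else 0) * ((if a2 = 0 then int p - 1 else 0) * ((if a3 = 0 then int p - 1 else 0) * (if a4 = 0 then int p - 1 else 0)))))"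
    unfolding peq_of_int by (rule charsum_total[folded q_def, OF a e])
  then have "padic_eq (int (Suc m)) (A 0 + (of_nat p - 1) * A 1)
    ((if a1 = 0 then of_nat p - 1 else 0) * ((if a2 = 0 then of_nat p - 1 else 0) * ((if a3 = 0 then of_nat p - 1 else 0) * (if a4 = 0 then of_nat p - 1 else 0))))"
    unfolding of_int_mult oi A_def by simp
  then have "padic_eq (int (Suc M)) (A 0 + (of_nat p - 1) * A 1)
    ((if a1 = 0 then of_nat p - 1 else 0) * ((if a2 = 0 then of_nat p - 1 else 0) * ((if a3 = 0 then of_nat p - 1 else 0) * (if a4 = 0 then of_nat p - 1 else 0))))"
    by (rule peq_mono) (use l in simp)
  from peq_diff[OF this peq_sym[OF 1]] have "padic_eq (int (Suc M)) (A 0 + (of_nat p - 1) * A 1 - (A 0 - A 1)) (of_nat p * w)"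
    unfolding w .
  moreover have "A 0 + (of_nat p - 1) * A 1 - (A 0 - A 1) = of_nat p * A 1" by (simp add: algebra_simps)
  ultimately have "V (int M + 1) (of_nat p * (A 1 - w))" by (simp add: padic_eq_def right_diff_distrib add.commute)
  then show ?thesis unfolding V_p_mult_iff padic_eq_def A_def .
qed

text \<open>Since \<open>q = 2 * h\<close> with \<open>h\<close> odd, only multiples of
  \<open>h\<close> could qualify.\<close>

lemma not_dvd_four_times: assumes "0 < j" "j < q" "j \<noteq> h" shows "\<not> q dvd 4 * j"
proof
  assume "q dvd 4 * j"
  then have "h dvd 2 * j" using q_h by simp
  then have "h dvd j" using odd_h coprime_dvd_mult_right_iff[of h 2 j] by (simp add: coprime_right_2_iff_odd)
  then obtain k where k: "j = h * k" ..
  have "h * k < h * 2" "0 < h * k" using assms(1,2) q_h unfolding k by simp_all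
  then have "k < 2" "0 < k" by simp_all
  then have "k = 1" by simp
  then show False using assms(3) k by simp
qed

text \<open>Here the powers of \<open>p\<close> match: the carry of four equal indices is the
  exponent coming from the floors.\<close>

lemma div_4: assumes "j < q" "j \<noteq> h" shows "4 * j div q = e3 j"
proof (rule div_nat_eqI)
  show "q * e3 j \<le> 4 * j" "4 * j < q * Suc (e3 j)"
    using assms quarter_neq[of j] q_h by (auto simp: e3_def)
qed

text \<open>The carry exceeds \<open>e2 j\<close> by one, which is the origin of the factor
  \<open>p\<close> before the second hypergeometric function.\<close>

lemma div_shift: assumes "j < q" shows "(2 * ((j + h) mod q) + 2 * j) div q = Suc (e2 j)"
proof -
  have jj: "(j + h) mod q = (if j < h then j + h else j - h)"
  proof (cases "j < h")
    case False
    then have e: "j + h = (j - h) + q" using q_h by simp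
    have "j - h < q" using assms by simp
    then have "(j + h) mod q = j - h" unfolding e mod_add_self2 by (rule mod_less)
    then show ?thesis using False by simp
  qed (use q_h in simp)
  show ?thesis
  proof (rule div_nat_eqI)
    show "q * Suc (e2 j) \<le> 2 * ((j + h) mod q) + 2 * j" "2 * ((j + h) mod q) + 2 * j < q * Suc (Suc (e2 j))"
      using assms quarter_neq[of j] q_h unfolding jj by (auto simp: e2_def)
  qed
qed

lemma V_neg_p_power: "V 0 ((- of_nat p) ^ n)"
  by (intro V_power0) simp

text \<open>\<open>charsum_gauss\<close> contains \<open>G (4 * j)\<close> on the Jacobi sum side,
  \<open>U1_unit3\<close> contains \<open>G (4 * n)\<close>; reflection with even sign exponent
  matches them.\<close>

lemma term3_generic:
  assumes j: "0 < j" "j < q" "j \<noteq> h"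
  shows "padic_eq (int M) (unit3 j * (- of_nat p) ^ e3 j) (- (Z ^ (q - j) * A3 j))"
proof -
  define n where "n = q - j"
  define P where "P = ((- of_nat p) ^ e3 j :: rat)"
  have jn: "j + n = q" using j by (simp add: n_def)
  have s: "j + j + j + j = 4 * j" by simp
  have nd: "\<not> q dvd 4 * j" by (rule not_dvd_four_times[OF j])
  have "padic_eq (int M) (P * (G j * G j * G j * G j)) (- (A3 j * G (4 * j)))"
    using charsum_gauss[OF j(2) j(2) j(2) j(2)] nd div_4[OF j(2,3)] unfolding s P_def by simp
  then have 1: "padic_eq (int M) (- (Z ^ n * G (4 * n)) * (P * (G j * G j * G j * G j))) (- (Z ^ n * G (4 * n)) * (- (A3 j * G (4 * j))))"
    by (rule peq_mult_left) (intro V_minus punit_V punit_mult punit_Z punit_G)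
  have "4 * j + 4 * n = q * 4" using jn by simp
  then have r: "U1 (G (4 * j) * G (4 * n) / - ((- 1) ^ (4 * j)))" by (intro U1_G_reflection[OF nd]) simp
  have u: "U1 (unit3 j / - (Z ^ n * G (4 * n) * G j ^ 4))" by (rule U1_unit3[OF j(1,2) n_def])
  have pu: "punit (- (Z ^ n * G (4 * n) * G j ^ 4))"
    by (intro punit_minus punit_mult punit_power[of "G j"] punit_Z punit_G)
  from peq_mult_right[OF U1_D[OF u pu] V_neg_p_power[of "e3 j"]]
  have "padic_eq (int M) (unit3 j * P) (- (Z ^ n * G (4 * n) * G j ^ 4) * P)" unfolding P_def .
  also have "- (Z ^ n * G (4 * n) * G j ^ 4) * P = - (Z ^ n * G (4 * n)) * (P * (G j * G j * G j * G j))"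
    by (simp add: power4_eq_xxxx)
  also note 1
  also have "- (Z ^ n * G (4 * n)) * (- (A3 j * G (4 * j))) = - (Z ^ n * A3 j) * (G (4 * j) * G (4 * n) / - ((- 1) ^ (4 * j)))"
    by (simp add: power_mult)
  also have "padic_eq (int M) \<dots> (- (Z ^ n * A3 j))"
    by (intro U1_absorb r V_minus V_mult_integral V_of_int punit_V punit_Z)
  finally show ?thesis unfolding n_def P_def .
qed

text \<open>\<open>Z\<close> is the fourth power of \<open>T (4 * lam)\<close>, so its power
  \<open>h\<close> already has an exponent divisible by \<open>q\<close>.\<close>

lemma U1_Z_h: "U1 (Z ^ h)" and U1_Z_q: "U1 (Z ^ q)"
proof -
  have nd: "\<not> int p dvd 4 * lam" using not_dvd_256 not_dvd_Z lam unfolding not_dvd_mult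
    by (metis dvd_mult2 mult.commute not_dvd_power not_dvd_2 not_dvd_mult numeral_Bit0 mult_2)
  have e: "(256 * lam ^ 4) = (4 * lam) ^ 4" by (simp add: power_mult_distrib)
  have "Z ^ h = T (4 * lam) ^ (q * 2)"
    unfolding e teich_power using q_h by (simp add: power_mult[symmetric] mult.commute)
  then show "U1 (Z ^ h)" using U1_T_q[OF nd, of 2] by simp
  show "U1 (Z ^ q)" using U1_T_q[OF not_dvd_Z, of 1] by simp
qed

lemma U1_gh4: "U1 (G h * G h * G h * G h)"
  using U1_mult[OF U1_gh_square U1_gh_square] h_less by (simp add: G_def mult.assoc)

text \<open>Four quadratic characters: the total sum is 0 and the Gauss product is nearly
  \<open>p^2\<close>, so the Jacobi sum solves \<open>p * w = - p^2\<close>.\<close>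

lemma A3_h: "padic_eq (int M) (A3 h) (- of_nat p)"
proof -
  have sq: "(- of_nat p :: rat) ^ 2 = of_nat p * of_nat p" by (simp only: power2_eq_square minus_mult_minus)
  have "h + h + h + h = 2 * q" using q_h by simp
  then have "padic_eq (int M) (A3 h) (- of_nat p * (G h * G h * G h * G h))"
    using h_pos by (intro charsum_gauss_trivial[OF h_less h_less h_less h_less, of 2]) (simp_all add: sq del: power2_minus)
  also have "padic_eq (int M) \<dots> (- of_nat p)" by (intro U1_absorb U1_gh4 V_minus) simp
  finally show ?thesis .
qed

text \<open>Four trivial characters: the value is \<open>((p - 1)^4 - 1) / p\<close>.\<close>

lemma A3_0: "padic_eq (int M) (A3 0) (of_nat p ^ 3 - 4 * of_nat p ^ 2 + 6 * of_nat p - 4)"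
proof (rule charsum_gauss_trivial[OF q_pos q_pos q_pos q_pos])
  have "G 0 = 1" using q_pos by (simp add: G_def g_0)
  then show "(if 0 = (0 :: nat) then of_nat p - 1 else 0) * ((if 0 = (0 :: nat) then of_nat p - 1 else 0) * ((if 0 = (0 :: nat) then of_nat p - 1 else 0) * (if 0 = (0 :: nat) then of_nat p - 1 else 0)))
       - (- of_nat p) ^ 0 * (G 0 * G 0 * G 0 * G 0) = (of_nat p * (of_nat p ^ 3 - 4 * of_nat p ^ 2 + 6 * of_nat p - 4) :: rat)"
    by (simp add: algebra_simps power2_eq_square power3_eq_cube)
qed simp

text \<open>The trivial product of characters costs the Jacobi sum a factor \<open>p\<close>, but at
  \<open>h\<close> the carry is 2 while \<open>e3 h = 1\<close>, so the generic relation
  persists.\<close>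

lemma term3_h: "padic_eq (int M) (unit3 h * (- of_nat p) ^ e3 h) (- (Z ^ (q - h) * A3 h))"
proof -
  have n: "q - h = h" using q_h by simp
  have e: "e3 h = 1" using q_h h_pos by (simp add: e3_def)
  have "4 * h = 2 * q" using q_h by simp
  then have "q dvd 4 * h" by (simp only: dvd_triv_right)
  then have "G (4 * h) = G 0" by (intro G_cong) (simp add: cong_0_iff)
  then have G4: "G (4 * h) = 1" by (simp add: G_def g_0)
  have u: "U1 (unit3 h / - (Z ^ h * (G h * G h * G h * G h)))"
    using U1_unit3[OF h_pos h_less n[symmetric]] unfolding G4 by (simp add: power4_eq_xxxx)
  have pu: "punit (- (Z ^ h * (G h * G h * G h * G h)))"
    by (intro punit_minus punit_mult punit_Z punit_G)
  have "padic_eq (int M) (unit3 h * - of_nat p) (- (Z ^ h * (G h * G h * G h * G h)) * - of_nat p)"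
    by (intro peq_mult_right U1_D[OF u pu] V_minus V_of_nat)
  also have "- (Z ^ h * (G h * G h * G h * G h)) * - of_nat p = (of_nat p * Z ^ h) * (G h * G h * G h * G h)" by simp
  also have "padic_eq (int M) \<dots> (of_nat p * Z ^ h)"
    by (intro U1_absorb U1_gh4 V_mult_integral V_of_nat punit_V punit_Z)
  also have "of_nat p * Z ^ h = - (Z ^ h * - of_nat p)" by simp
  also have "padic_eq (int M) \<dots> (- (Z ^ h * A3 h))"
    by (intro peq_minus peq_mult_left peq_sym[OF A3_h] punit_V punit_Z)
  finally show ?thesis unfolding n e by simp
qed

lemma term3: "0 < j \<Longrightarrow> j < q \<Longrightarrow> padic_eq (int M) (unit3 j * (- of_nat p) ^ e3 j) (- (Z ^ (q - j) * A3 j))"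
  using term3_h term3_generic by (cases "j = h") auto

lemma unit3_0: "unit3 0 * (- of_nat p) ^ e3 0 = 1"
proof -
  have "\<not> int p dvd u4" using lam4 by (simp add: dvd_eq_mod_eq_0)
  then have tb: "tb 0 = 1" by (simp add: teich_bar_pow_approx_def dvd_eq_mod_eq_0)
  have G: "G 0 = 1" "G (h + q) = G h" using q_pos by (simp_all add: G_def g_0)
  have f: "frac (1 / 4 :: rat) = 1 / 4" "frac (3 / 4 :: rat) = 3 / 4" by (simp_all add: frac_eq)
  show ?thesis unfolding unit3_def using tb G f F_nonzero by (simp add: e3_def tau_def)
qed

lemma term2_generic:
  assumes j: "0 < j" "j < q" "j \<noteq> h"
  shows "padic_eq (int M) (of_nat p * (unit2 j * (- of_nat p) ^ e2 j)) (Z ^ (q - j) * A2 j)"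
proof -
  define n where "n = q - j"
  define i where "i = (j + h) mod q"
  define P where "P = ((- of_nat p) ^ e2 j :: rat)"
  have i: "i < q" unfolding i_def using q_pos by simp
  have Gi: "G i = G (j + h)" by (simp add: G_def i_def)
  have s: "i + i + j + j = 2 * i + 2 * j" by simp
  have sc: "[2 * i + 2 * j = 4 * j] (mod q)"
  proof -
    have "[2 * i + 2 * j = 2 * (j + h) + 2 * j] (mod q)" unfolding i_def
      by (intro cong_add cong_mult cong_refl) (simp add: cong_def)
    moreover have "2 * (j + h) + 2 * j = 4 * j + q" using q_h by simp
    ultimately show ?thesis by (simp add: cong_def)
  qed
  have nd: "\<not> q dvd 2 * i + 2 * j" using not_dvd_four_times[OF j] cong_dvd_iff sc cong_sym by (metis cong_0_iff cong_trans)
  have "padic_eq (int M) (- of_nat p * P * (G i * G i * G j * G j)) (- (A2 j * G (4 * j)))"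
    using charsum_gauss[OF i i j(2) j(2)] nd div_shift[OF j(2)] G_cong[OF sc] unfolding s P_def i_def[symmetric] by simp
  then have 1: "padic_eq (int M) (- (Z ^ n / G (4 * j)) * (- of_nat p * P * (G i * G i * G j * G j))) (- (Z ^ n / G (4 * j)) * (- (A2 j * G (4 * j))))"
    by (rule peq_mult_left) (intro V_minus punit_V punit_divide punit_Z punit_G)
  define W where "W = Z ^ n * (G j * G (j + h)) ^ 2 / G (4 * j)"
  have u: "U1 (W / unit2 j)" unfolding W_def by (rule U1_charsum2_unit[OF j(2) n_def])
  have pW: "punit W" unfolding W_def by (intro punit_divide punit_mult punit_power[of "_ * _"] punit_G punit_Z)
  have "punit (W / (W / unit2 j))" using u by (simp only: punit_divide[OF pW] U1_def)
  moreover have "W / (W / unit2 j) = unit2 j" using pW by (simp add: punit_def)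
  ultimately have pu: "punit (unit2 j)" by (simp only:)
  have "padic_eq (int M) (of_nat p * P * unit2 j) (of_nat p * P * W)"
    by (intro peq_mult_left peq_sym[OF U1_D[OF u pu]] V_mult_integral V_of_nat) (unfold P_def, rule V_neg_p_power)
  also have "of_nat p * P * W = - (Z ^ n / G (4 * j)) * (- of_nat p * P * (G i * G i * G j * G j))"
    unfolding W_def Gi by (simp add: power2_eq_square)
  also note 1
  also have "- (Z ^ n / G (4 * j)) * (- (A2 j * G (4 * j))) = Z ^ n * A2 j" by simp
  finally show ?thesis unfolding n_def P_def by (simp add: ac_simps)
qed

text \<open>At both indices the values of \<open>G\<close> in \<open>U1_unit2\<close> reduce to
  \<open>G h * G h\<close>, and the exponent of \<open>T lam\<close> is a multiple of
  \<open>q\<close>.\<close>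

lemma unit2_near_1: assumes "j = 0 \<or> j = h" shows "padic_eq (int M) (unit2 j * (- of_nat p) ^ e2 j) 1"
proof -
  have j: "j < q" using assms q_pos h_less by auto
  have e: "e2 j = 0" using assms q_h h_pos by (auto simp: e2_def)
  have c1: "[h + 2 * (q - j) = h] (mod q)" "[2 * j = 0] (mod q)"
    using assms q_h by (auto simp: cong_def)
  have G: "G (h + 2 * (q - j)) = G h" "G (2 * j) = 1"
    using G_cong[OF c1(1)] G_cong[OF c1(2)] by (simp_all add: G_def g_0)
  have t: "U1 (T (lam ^ 4) ^ (q - j))"
  proof -
    have "T (lam ^ 4) ^ (q - j) = T lam ^ (q * (if j = 0 then 4 else 2))"
      unfolding teich_power using assms q_h by (auto simp: power_mult[symmetric] mult.commute)
    then show ?thesis using U1_T_q[OF lam] by simp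
  qed
  have "U1 (unit2 j / (T (lam ^ 4) ^ (q - j) * G h * G h))"
    using U1_unit2[OF j refl] unfolding G by simp
  from U1_mult[OF this U1_mult[OF t U1_gh_square]] have "U1 (unit2 j)"
    using h_less T_nonzero by (simp add: G_def[of h, symmetric] G_eq_g[symmetric])
  then show ?thesis unfolding e by (simp add: U1_def)
qed

text \<open>Two characters are quadratic and two trivial, so the total sum is 0 and the carry is 1;
  hence the Jacobi sum is nearly the square of \<open>G h\<close>.\<close>

lemma A2_near_1: assumes "j = 0 \<or> j = h" shows "padic_eq (int M) (Z ^ (q - j) * A2 j) 1"
proof -
  have gh: "U1 (G h * G h)" using U1_gh_square h_less by (simp add: G_def)
  have G0: "G 0 = 1" by (simp add: G_def g_0)
  have h2: "h + h = q" using q_h by simp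
  have hh: "(h + h) mod q = 0" "(0 + h) mod q = h" "h + h = q" unfolding h2 using h_less by simp_all
  have A: "padic_eq (int M) (A2 j) (G h * G h)"
    using assms
  proof
    assume j: "j = 0"
    show ?thesis unfolding j hh(1,2) using h_pos hh(3)
      by (intro charsum_gauss_trivial[OF h_less h_less q_pos q_pos, of 1]) (simp_all add: G0)
  next
    assume j: "j = h"
    show ?thesis unfolding j hh(1,2) using h_pos hh(3)
      by (intro charsum_gauss_trivial[OF q_pos q_pos h_less h_less, of 1]) (simp_all add: G0)
  qed
  have "U1 (Z ^ (q - j))"
    using assms U1_Z_h U1_Z_q q_h by auto
  then have "U1 (Z ^ (q - j) * (G h * G h))" using gh by (rule U1_mult)
  then have 1: "padic_eq (int M) (Z ^ (q - j) * (G h * G h)) 1" by (simp add: U1_def)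
  have "padic_eq (int M) (Z ^ (q - j) * A2 j) (Z ^ (q - j) * (G h * G h))"
    by (intro peq_mult_left A punit_V punit_Z)
  from peq_trans[OF this 1] show ?thesis .
qed

text \<open>Every index but 0 matches up to sign. At 0 the Jacobi sum is \<open>A3_0\<close> while
  the summand is 1, which changes the constant \<open>- 4\<close> to \<open>- 3\<close>.\<close>

lemma sum_A3: "padic_eq (int M) (\<Sum>j<q. Z ^ (q - j) * A3 j)
  (of_nat p ^ 3 - 4 * of_nat p ^ 2 + 6 * of_nat p - 3 - (\<Sum>j<q. unit3 j * (- of_nat p) ^ e3 j))"
proof -
  define B where "B = (of_nat p ^ 3 - 4 * of_nat p ^ 2 + 6 * of_nat p - 4 :: rat)"
  have s: "{..<q} = insert 0 {1..<q}" using q_pos by auto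
  have "padic_eq (int M) (Z ^ q * A3 0) (Z ^ q * B)"
    unfolding B_def by (intro peq_mult_left A3_0 punit_V punit_Z)
  also have "padic_eq (int M) (Z ^ q * B) (1 * B)"
  proof (rule peq_mult_right)
    show "padic_eq (int M) (Z ^ q) 1" using U1_Z_q by (simp add: U1_def)
    show "V 0 B" unfolding B_def by (intro V_add V_diff V_mult_integral V_power0 V_of_nat V_numeral)
  qed
  finally have 0: "padic_eq (int M) (Z ^ q * A3 0) B" by simp
  have "padic_eq (int M) (\<Sum>j\<in>{1..<q}. Z ^ (q - j) * A3 j) (\<Sum>j\<in>{1..<q}. - (unit3 j * (- of_nat p) ^ e3 j))"
  proof (rule peq_sum)
    fix j assume "j \<in> {1..<q}"
    then show "padic_eq (int M) (Z ^ (q - j) * A3 j) (- (unit3 j * (- of_nat p) ^ e3 j))"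
      using peq_minus[OF peq_sym[OF term3[of j]]] by simp
  qed
  from peq_add[OF 0 this]
  have "padic_eq (int M) (\<Sum>j<q. Z ^ (q - j) * A3 j) (B - (\<Sum>j\<in>{1..<q}. unit3 j * (- of_nat p) ^ e3 j))"
    unfolding s by (simp add: sum_negf)
  moreover have "of_nat p ^ 3 - 4 * of_nat p ^ 2 + 6 * of_nat p - 3 - (\<Sum>j<q. unit3 j * (- of_nat p) ^ e3 j)
     = B - (\<Sum>j\<in>{1..<q}. unit3 j * (- of_nat p) ^ e3 j)"
    unfolding s B_def using unit3_0 by simp
  ultimately show ?thesis by (simp only:)
qed

text \<open>At 0 and \<open>h\<close> both sides are nearly 1, without the factor \<open>p\<close>
  of the generic case; including these indices in the multiple of \<open>p\<close> costs
  \<open>1 - p\<close> each.\<close>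

lemma sum_A2: "padic_eq (int M) (\<Sum>j<q. Z ^ (q - j) * A2 j)
  (2 - 2 * of_nat p + of_nat p * (\<Sum>j<q. unit2 j * (- of_nat p) ^ e2 j))"
proof -
  define R where "R = {..<q} - {0, h}"
  define Y where "Y j = unit2 j * (- of_nat p) ^ e2 j" for j
  define X where "X j = Z ^ (q - j) * A2 j" for j
  have split: "(\<Sum>j<q. f j) = f 0 + f h + (\<Sum>j\<in>R. f j)" for f :: "nat \<Rightarrow> rat"
  proof -
    have "{..<q} = insert 0 (insert h R)" using q_pos h_less by (auto simp: R_def)
    moreover have "finite R" "h \<notin> R" "0 \<notin> insert h R" using h_pos by (auto simp: R_def)
    ultimately show ?thesis by (simp add: add.assoc)
  qed
  have "padic_eq (int M) (\<Sum>j\<in>R. X j) (\<Sum>j\<in>R. of_nat p * Y j)"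
  proof (rule peq_sum)
    fix j assume "j \<in> R"
    then have "0 < j" "j < q" "j \<noteq> h" by (auto simp: R_def)
    then show "padic_eq (int M) (X j) (of_nat p * Y j)" unfolding X_def Y_def by (intro peq_sym[OF term2_generic])
  qed
  moreover have "padic_eq (int M) (X 0) 1" "padic_eq (int M) (X h) 1"
    unfolding X_def by (intro A2_near_1; simp)+
  moreover have "padic_eq (int M) (Y 0) 1" "padic_eq (int M) (Y h) 1"
    unfolding Y_def by (intro unit2_near_1; simp)+
  ultimately have "padic_eq (int M) (X 0 + X h + (\<Sum>j\<in>R. X j) + of_nat p * (1 + 1)) (1 + 1 + (\<Sum>j\<in>R. of_nat p * Y j) + of_nat p * (Y 0 + Y h))"
    by (intro peq_add peq_mult_left V_of_nat peq_sym[of _ "Y _"])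
  then have "padic_eq (int M) (X 0 + X h + (\<Sum>j\<in>R. X j) + of_nat p * (1 + 1) - of_nat p * (1 + 1)) (1 + 1 + (\<Sum>j\<in>R. of_nat p * Y j) + of_nat p * (Y 0 + Y h) - of_nat p * (1 + 1))"
    by (intro peq_diff peq_refl)
  moreover have "1 + 1 + (\<Sum>j\<in>R. of_nat p * Y j) + of_nat p * (Y 0 + Y h) - of_nat p * (1 + 1) = 2 - 2 * of_nat p + of_nat p * (\<Sum>j<q. Y j)"
    unfolding split by (simp add: sum_distrib_left algebra_simps)
  moreover have "X 0 + X h + (\<Sum>j\<in>R. X j) + of_nat p * (1 + 1) - of_nat p * (1 + 1) = (\<Sum>j<q. X j)"
    unfolding split by simp
  ultimately show ?thesis unfolding X_def[symmetric] Y_def[symmetric] by (simp only:)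
qed

theorem dwork_count_approx:
  "padic_eq (int M) ((of_nat p ^ 3 - 1) / (of_nat p - 1)
     + mcG_approx p [1/4, 2/4, 3/4] [0, 0, 0] u4 m
     - 3 * of_nat p * mcG_approx p [3/4, 1/4] [0, 1/2] u4 m) (of_nat (dwork_count p lam))"
proof -
  define S3 S2 where "S3 = (\<Sum>j<q. unit3 j * (- of_nat p) ^ e3 j)" and "S2 = (\<Sum>j<q. unit2 j * (- of_nat p) ^ e2 j)"
  define W1 W2 where "W1 = (\<Sum>y\<in>units4. of_bool (onW1 y) :: int)" and "W2 = (\<Sum>y\<in>units4. of_bool (onW1 y) * lg12 y)"
  define P where "P = (of_nat p :: rat)"
  have P1: "P - 1 \<noteq> 0" using punit_p_minus_1 by (simp add: punit_def P_def)
  have oq: "of_int (int q) = P - 1" using of_nat_q by (simp add: P_def)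
  have "padic_eq (int M) (of_int (\<Sum>j<q. teich m (256 * lam ^ 4) ^ (q - j) * charsum m (j, j, j, j) 1)) (of_int (int q * W1))"
    unfolding W1_def by (rule cong_padic[OF sum_onW1_char])
  then have "padic_eq (int M) (\<Sum>j<q. Z ^ (q - j) * A3 j) ((P - 1) * of_int W1)"
    unfolding of_int_mult oq by simp
  from peq_trans[OF peq_sym[OF this] sum_A3]
  have 1: "padic_eq (int M) ((P - 1) * of_int W1) (P ^ 3 - 4 * P ^ 2 + 6 * P - 3 - S3)" unfolding P_def S3_def .
  have "padic_eq (int M) (of_int (\<Sum>j<q. teich m (256 * lam ^ 4) ^ (q - j) * charsum m ((j + h) mod q, (j + h) mod q, j, j) 1)) (of_int (int q * W2))"
    unfolding W2_def by (rule cong_padic[OF sum_onW1_lg12_char])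
  then have "padic_eq (int M) (\<Sum>j<q. Z ^ (q - j) * A2 j) ((P - 1) * of_int W2)"
    unfolding of_int_mult oq by simp
  from peq_trans[OF peq_sym[OF this] sum_A2]
  have 2: "padic_eq (int M) ((P - 1) * of_int W2) (2 - 2 * P + P * S2)" unfolding P_def S2_def .
  have "int (dwork_count p lam) = W1 + 3 * W2 + 4 * (int p + 1)"
    unfolding dwork_count_formula W1_def W2_def by (simp only: distrib_left mult_1_right sum.distrib sum_distrib_left mult.left_commute)
  then have "of_int (int (dwork_count p lam)) = (of_int (W1 + 3 * W2 + 4 * (int p + 1)) :: rat)" by (simp only:)
  then have N: "of_nat (dwork_count p lam) = of_int W1 + 3 * of_int W2 + 4 * (P + 1)" by (simp add: P_def)
  have "padic_eq (int M) ((P - 1) * of_int W1 + 3 * ((P - 1) * of_int W2) + (P - 1) * (4 * (P + 1)))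
     (P ^ 3 - 4 * P ^ 2 + 6 * P - 3 - S3 + 3 * (2 - 2 * P + P * S2) + (P - 1) * (4 * (P + 1)))"
    by (intro peq_add peq_mult_left 1 2 peq_refl V_numeral)
  moreover have "(P - 1) * of_int W1 + 3 * ((P - 1) * of_int W2) + (P - 1) * (4 * (P + 1)) = (P - 1) * of_nat (dwork_count p lam)"
    unfolding N by (simp add: algebra_simps)
  \<comment> \<open>The polynomial parts of both sums and the points with a zero coordinate combine
    to \<open>P ^ 3 - 1\<close>.\<close>
  moreover have "P ^ 3 - 4 * P ^ 2 + 6 * P - 3 - S3 + 3 * (2 - 2 * P + P * S2) + (P - 1) * (4 * (P + 1))
     = (P - 1) * ((P ^ 3 - 1) / (P - 1) + - 1 / (P - 1) * S3 - 3 * P * (- 1 / (P - 1) * S2))"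
  proof -
    have e: "(P ^ 3 - 1) / (P - 1) + - 1 / (P - 1) * S3 - 3 * P * (- 1 / (P - 1) * S2) = (P ^ 3 - 1 - S3 + 3 * P * S2) / (P - 1)"
      by (simp add: add_divide_distrib diff_divide_distrib)
    have "(P - 1) * (x / (P - 1)) = x" for x using P1 by simp
    then show ?thesis unfolding e by (simp only:) (simp add: algebra_simps power2_eq_square power3_eq_cube)
  qed
  ultimately have "padic_eq (int M) ((P - 1) * ((P ^ 3 - 1) / (P - 1) + - 1 / (P - 1) * S3 - 3 * P * (- 1 / (P - 1) * S2))) ((P - 1) * of_nat (dwork_count p lam))"
    using peq_sym by (simp only:)
  then have "padic_eq (int M) ((P ^ 3 - 1) / (P - 1) + - 1 / (P - 1) * S3 - 3 * P * (- 1 / (P - 1) * S2)) (of_nat (dwork_count p lam))"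
    by (rule peq_cancel_left) (unfold P_def, rule punit_p_minus_1)
  then show ?thesis unfolding mcG3_sum mcG2_sum S3_def S2_def P_def .
qed

end

theorem theorem2:
  fixes p :: nat and lam :: int
  assumes "prime p" and "p mod 4 = 3" and "lam \<in> {1..<int p}"
  shows "padic_tendsto p
           (\<lambda>m. (of_nat p ^ 3 - 1) / (of_nat p - 1)
                + mcG_approx p [1/4, 2/4, 3/4] [0, 0, 0] (lam ^ 4 mod int p) m
                - 3 * of_nat p * mcG_approx p [3/4, 1/4] [0, 1/2] (lam ^ 4 mod int p) m)
           (of_nat (dwork_count p lam))"
  unfolding padic_tendsto_def
proof (intro allI exI impI)
  \<comment> \<open>The working precision is \<open>Suc k\<close>, positive even for
    \<open>k = 0\<close>, and the approximation level has to exceed it.\<close>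
  fix k m :: nat assume m: "Suc (Suc k) \<le> m"
  have p: "2 < p" using prime_gt_1_nat[OF assms(1)] assms(2) by (cases "p = 2") auto
  interpret dwork_approx p lam "Suc k" m
    by unfold_locales (use assms p m in \<open>auto dest: zdvd_imp_le\<close>)
  from dwork_count_approx show "padic_cong p k ((of_nat p ^ 3 - 1) / (of_nat p - 1)
                + mcG_approx p [1/4, 2/4, 3/4] [0, 0, 0] (lam ^ 4 mod int p) m
                - 3 * of_nat p * mcG_approx p [3/4, 1/4] [0, 1/2] (lam ^ 4 mod int p) m)
           (of_nat (dwork_count p lam))"
    unfolding padic_cong_iff by (rule peq_mono) simp
qed

end
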